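(* For every $\mathbf f\in\mathbf H_0(\mathrm{div})'$, the problem of seeking $(\boldsymbol\mu,\mathbf u)\in\boldsymbol\Sigma\times\mathbf H_0(\mathrm{div})$ such that $$(\boldsymbol\mu,\boldsymbol\tau)-\langle\mathbf{curl}\,\boldsymbol\tau,\mathbf u\rangle=0\quad\forall\,\boldsymbol\tau\in\boldsymbol\Sigma,$$ $$\langle\mathbf{curl}\,\boldsymbol\mu,\mathbf v\rangle+(\mathrm{div}\,\mathbf u,\mathrm{div}\,\mathbf v)=\langle\mathbf f,\mathbf v\rangle\quad\forall\,\mathbf v\in\mathbf H_0(\mathrm{div})$$ admits a unique solution $(\boldsymbol\mu,\mathbf u)\in\boldsymbol\Sigma\times\mathbf H_0(\mathrm{div})$. There exists a positive constant $C$ independent of $\mathbf f\in\mathbf H_0(\mathrm{div})'$ such that $$\|\boldsymbol\mu\|_{\boldsymbol\Sigma}+\|\mathbf u\|_{\mathbf H(\mathrm{div})}\le C\,\|\mathbf f\|_{\mathbf H_0(\mathrm{div})'}.$$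
   Context: $\Omega\subset\mathbb R^3$ is a bounded Lipschitz polygonal (i.e. polyhedral) domain with exactly one connected component; its topology is otherwise arbitrary. $(\cdot,\cdot)$ and $\|\cdot\|$ are the $L^2(\Omega)$ inner product and norm (scalar or vector), $\langle\cdot,\cdot\rangle$ is the duality pairing between $\mathbf H_0(\mathrm{div})'$ and $\mathbf H_0(\mathrm{div})$. $\mathbf H(\mathrm{div})$ is the usual space on $\Omega$ with graph norm, and $\mathbf H_0(\mathrm{div})$ its subspace with vanishing normal trace on $\partial\Omega$. $\boldsymbol\Sigma=\{\boldsymbol\tau\in\mathbf L^2(\Omega):\mathbf{curl}\,\boldsymbol\tau\in\mathbf H_0(\mathrm{div})'\}$ (the distributional curl extends to a bounded functional on $\mathbf H_0(\mathrm{div})$), with norm $\|\boldsymbol\tau\|_{\boldsymbol\Sigma}^2=\|\boldsymbol\tau\|^2+\|\mathbf{curl}\,\boldsymbol\tau\|_{\mathbf H_0(\mathrm{div})'}^2$, the dual norm being taken with respect to $\|\cdot\|_{\mathbf H(\mathrm{div})}$. *)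

theory Defs
  imports "HOL-Analysis.Analysis"
begin

section \<open>The domain\<close>

text \<open>Up to an orthogonal change of coordinates, near each boundary point the domain is the
  set of points strictly below the graph of a Lipschitz function of two variables.\<close>

definition lipschitz_boundary :: "(real^3) set \<Rightarrow> bool" where
  "lipschitz_boundary \<Omega> \<longleftrightarrow>
    (\<forall>p \<in> frontier \<Omega>. \<exists>U (Q :: real^3 \<Rightarrow> real^3) (g :: real^2 \<Rightarrow> real) L.
       open U \<and> p \<in> U \<and> orthogonal_transformation Q \<and> L-lipschitz_on UNIV g \<and>
       (\<forall>x \<in> U. x \<in> \<Omega> \<longleftrightarrow> Q x $ 3 < g (vector [Q x $ 1, Q x $ 2])))"

definition lipschitz_polyhedral_domain :: "(real^3) set \<Rightarrow> bool" where
  "lipschitz_polyhedral_domain \<Omega> \<longleftrightarrow>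
     \<Omega> \<noteq> {} \<and> open \<Omega> \<and> connected \<Omega> \<and> bounded \<Omega> \<and> lipschitz_boundary \<Omega> \<and>
     (\<exists>P. finite P \<and> (\<forall>S \<in> P. polytope S) \<and> closure \<Omega> = \<Union>P)"

section \<open>Test functions\<close>

definition partial :: "3 \<Rightarrow> (real^3 \<Rightarrow> real) \<Rightarrow> real^3 \<Rightarrow> real" where
  "partial i f x = frechet_derivative f (at x) (axis i 1)"

fun Ck :: "nat \<Rightarrow> (real^3 \<Rightarrow> real) \<Rightarrow> bool" where
  "Ck 0 f \<longleftrightarrow> continuous_on UNIV f"
| "Ck (Suc k) f \<longleftrightarrow> (\<forall>x. f differentiable at x) \<and> (\<forall>i. Ck k (partial i f))"

definition test_functions :: "(real^3) set \<Rightarrow> (real^3 \<Rightarrow> real) set" where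
  "test_functions \<Omega> =
     {\<phi>. (\<forall>k. Ck k \<phi>) \<and> compact (closure {x. \<phi> x \<noteq> 0}) \<and> closure {x. \<phi> x \<noteq> 0} \<subseteq> \<Omega>}"

definition test_fields :: "(real^3) set \<Rightarrow> (real^3 \<Rightarrow> real^3) set" where
  "test_fields \<Omega> = {\<phi>. \<forall>i. (\<lambda>x. \<phi> x $ i) \<in> test_functions \<Omega>}"

definition grad :: "(real^3 \<Rightarrow> real) \<Rightarrow> real^3 \<Rightarrow> real^3" where
  "grad f x = (\<chi> i. partial i f x)"

definition div_field :: "(real^3 \<Rightarrow> real^3) \<Rightarrow> real^3 \<Rightarrow> real" where
  "div_field v x = (\<Sum>i\<in>UNIV. partial i (\<lambda>y. v y $ i) x)"

definition curl_field :: "(real^3 \<Rightarrow> real^3) \<Rightarrow> real^3 \<Rightarrow> real^3" where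
  "curl_field v x = vector
     [partial 2 (\<lambda>y. v y $ 3) x - partial 3 (\<lambda>y. v y $ 2) x,
      partial 3 (\<lambda>y. v y $ 1) x - partial 1 (\<lambda>y. v y $ 3) x,
      partial 1 (\<lambda>y. v y $ 2) x - partial 2 (\<lambda>y. v y $ 1) x]"

section \<open>Square-integrable functions\<close>

text \<open>Elements of the function spaces are represented by functions on the whole of \<open>real^3\<close>;
  only the values on \<open>\<Omega>\<close>, up to Lebesgue null sets, matter.  The value type is \<open>real\<close> for
  scalar functions and \<open>real^3\<close> for vector fields.\<close>

definition L2 :: "(real^3) set \<Rightarrow> (real^3 \<Rightarrow> 'b::euclidean_space) set" where
  "L2 \<Omega> = {f. f \<in> borel_measurable (lebesgue_on \<Omega>) \<and>
               integrable (lebesgue_on \<Omega>) (\<lambda>x. (norm (f x))\<^sup>2)}"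

definition L2_inner ::
    "(real^3) set \<Rightarrow> (real^3 \<Rightarrow> 'b::euclidean_space) \<Rightarrow> (real^3 \<Rightarrow> 'b) \<Rightarrow> real" where
  "L2_inner \<Omega> f g = (\<integral>x. f x \<bullet> g x \<partial>lebesgue_on \<Omega>)"

definition L2_norm :: "(real^3) set \<Rightarrow> (real^3 \<Rightarrow> 'b::euclidean_space) \<Rightarrow> real" where
  "L2_norm \<Omega> f = sqrt (L2_inner \<Omega> f f)"

section \<open>The spaces \<open>H\<^sup>1\<close>, \<open>H(div)\<close> and \<open>H\<^sub>0(div)\<close>\<close>

definition is_weak_grad ::
    "(real^3) set \<Rightarrow> (real^3 \<Rightarrow> real) \<Rightarrow> (real^3 \<Rightarrow> real^3) \<Rightarrow> bool" where
  "is_weak_grad \<Omega> q g \<longleftrightarrow> g \<in> L2 \<Omega> \<and>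
     (\<forall>\<phi> \<in> test_fields \<Omega>. L2_inner \<Omega> g \<phi> = - L2_inner \<Omega> q (div_field \<phi>))"

definition weak_grad :: "(real^3) set \<Rightarrow> (real^3 \<Rightarrow> real) \<Rightarrow> real^3 \<Rightarrow> real^3" where
  "weak_grad \<Omega> q = (SOME g. is_weak_grad \<Omega> q g)"

definition H1 :: "(real^3) set \<Rightarrow> (real^3 \<Rightarrow> real) set" where
  "H1 \<Omega> = {q \<in> L2 \<Omega>. \<exists>g. is_weak_grad \<Omega> q g}"

definition is_weak_div ::
    "(real^3) set \<Rightarrow> (real^3 \<Rightarrow> real^3) \<Rightarrow> (real^3 \<Rightarrow> real) \<Rightarrow> bool" where
  "is_weak_div \<Omega> v d \<longleftrightarrow> d \<in> L2 \<Omega> \<and>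
     (\<forall>\<phi> \<in> test_functions \<Omega>. L2_inner \<Omega> d \<phi> = - L2_inner \<Omega> v (grad \<phi>))"

definition weak_div :: "(real^3) set \<Rightarrow> (real^3 \<Rightarrow> real^3) \<Rightarrow> real^3 \<Rightarrow> real" where
  "weak_div \<Omega> v = (SOME d. is_weak_div \<Omega> v d)"

definition Hdiv :: "(real^3) set \<Rightarrow> (real^3 \<Rightarrow> real^3) set" where
  "Hdiv \<Omega> = {v \<in> L2 \<Omega>. \<exists>d. is_weak_div \<Omega> v d}"

definition Hdiv_norm :: "(real^3) set \<Rightarrow> (real^3 \<Rightarrow> real^3) \<Rightarrow> real" where
  "Hdiv_norm \<Omega> v = sqrt ((L2_norm \<Omega> v)\<^sup>2 + (L2_norm \<Omega> (weak_div \<Omega> v))\<^sup>2)"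

text \<open>The normal trace of a field in \<open>H(div)\<close> is the element of \<open>H\<^sup>-\<^sup>1\<^sup>/\<^sup>2(\<partial>\<Omega>)\<close> defined by
  Green's formula.  Since \<open>H\<^sup>1\<^sup>/\<^sup>2(\<partial>\<Omega>)\<close> is the space of traces of \<open>H\<^sup>1(\<Omega>)\<close>, it is written
  here as a functional on \<open>H\<^sup>1(\<Omega>)\<close>.\<close>

definition normal_trace ::
    "(real^3) set \<Rightarrow> (real^3 \<Rightarrow> real^3) \<Rightarrow> (real^3 \<Rightarrow> real) \<Rightarrow> real" where
  "normal_trace \<Omega> v q = L2_inner \<Omega> v (weak_grad \<Omega> q) + L2_inner \<Omega> (weak_div \<Omega> v) q"

definition H0div :: "(real^3) set \<Rightarrow> (real^3 \<Rightarrow> real^3) set" where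
  "H0div \<Omega> = {v \<in> Hdiv \<Omega>. \<forall>q \<in> H1 \<Omega>. normal_trace \<Omega> v q = 0}"

section \<open>The dual of \<open>H\<^sub>0(div)\<close> and the space \<open>\<Sigma>\<close>\<close>

text \<open>A functional is relevant only through its values on \<open>H0div \<Omega>\<close>; boundedness and linearity
  make it invariant under changes of the argument on null sets.\<close>

definition H0div_dual :: "(real^3) set \<Rightarrow> ((real^3 \<Rightarrow> real^3) \<Rightarrow> real) set" where
  "H0div_dual \<Omega> = {F.
     (\<forall>v \<in> H0div \<Omega>. \<forall>w \<in> H0div \<Omega>. F (\<lambda>x. v x + w x) = F v + F w) \<and>
     (\<forall>c. \<forall>v \<in> H0div \<Omega>. F (\<lambda>x. c *\<^sub>R v x) = c * F v) \<and>
     (\<exists>K. \<forall>v \<in> H0div \<Omega>. \<bar>F v\<bar> \<le> K * Hdiv_norm \<Omega> v)}"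

definition dual_norm :: "(real^3) set \<Rightarrow> ((real^3 \<Rightarrow> real^3) \<Rightarrow> real) \<Rightarrow> real" where
  "dual_norm \<Omega> F = (SUP v \<in> {v \<in> H0div \<Omega>. Hdiv_norm \<Omega> v \<le> 1}. \<bar>F v\<bar>)"

text \<open>\<open>F\<close> is a bounded extension to \<open>H\<^sub>0(div)\<close> of the distributional curl of \<open>\<tau>\<close>.  Test fields
  are dense in \<open>H\<^sub>0(div)\<close>, so the values of \<open>F\<close> on \<open>H0div \<Omega>\<close> are determined by \<open>\<tau>\<close>.\<close>

definition is_weak_curl ::
    "(real^3) set \<Rightarrow> (real^3 \<Rightarrow> real^3) \<Rightarrow> ((real^3 \<Rightarrow> real^3) \<Rightarrow> real) \<Rightarrow> bool" where
  "is_weak_curl \<Omega> \<tau> F \<longleftrightarrow> F \<in> H0div_dual \<Omega> \<and>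
     (\<forall>\<phi> \<in> test_fields \<Omega>. F \<phi> = L2_inner \<Omega> \<tau> (curl_field \<phi>))"

definition weak_curl :: "(real^3) set \<Rightarrow> (real^3 \<Rightarrow> real^3) \<Rightarrow> (real^3 \<Rightarrow> real^3) \<Rightarrow> real" where
  "weak_curl \<Omega> \<tau> = (SOME F. is_weak_curl \<Omega> \<tau> F)"

definition Sigma_space :: "(real^3) set \<Rightarrow> (real^3 \<Rightarrow> real^3) set" where
  "Sigma_space \<Omega> = {\<tau> \<in> L2 \<Omega>. \<exists>F. is_weak_curl \<Omega> \<tau> F}"

definition Sigma_norm :: "(real^3) set \<Rightarrow> (real^3 \<Rightarrow> real^3) \<Rightarrow> real" where
  "Sigma_norm \<Omega> \<tau> = sqrt ((L2_norm \<Omega> \<tau>)\<^sup>2 + (dual_norm \<Omega> (weak_curl \<Omega> \<tau>))\<^sup>2)"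

section \<open>The mixed problem\<close>

definition mixed_solution ::
    "(real^3) set \<Rightarrow> ((real^3 \<Rightarrow> real^3) \<Rightarrow> real) \<Rightarrow> (real^3 \<Rightarrow> real^3) \<Rightarrow> (real^3 \<Rightarrow> real^3) \<Rightarrow> bool"
  where
  "mixed_solution \<Omega> f \<mu> u \<longleftrightarrow>
     \<mu> \<in> Sigma_space \<Omega> \<and> u \<in> H0div \<Omega> \<and>
     (\<forall>\<tau> \<in> Sigma_space \<Omega>. L2_inner \<Omega> \<mu> \<tau> - weak_curl \<Omega> \<tau> u = 0) \<and>
     (\<forall>v \<in> H0div \<Omega>.
        weak_curl \<Omega> \<mu> v + L2_inner \<Omega> (weak_div \<Omega> u) (weak_div \<Omega> v) = f v)"

end

theory Submission
  imports Defs
begin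

text \<open>Formally \<open>\<mu> = curl u\<close>, so the problem is the Dirichlet problem for the vector Laplacian with
  right-hand side \<open>f\<close>.  Test fields \<open>\<phi>\<close> satisfy \<open>\<parallel>\<nabla>\<phi>\<parallel>\<^sup>2 = \<parallel>curl \<phi>\<parallel>\<^sup>2 + \<parallel>div \<phi>\<parallel>\<^sup>2\<close>, hence a Poincare
  inequality in terms of curl and div whatever the topology of the domain, and a solution is
  obtained by minimizing the energy over test fields and passing to the limit.  Test fields are
  dense in \<open>H0div \<Omega>\<close> by a Hilbert space argument: the normal trace is defined by duality with
  \<open>H1 \<Omega>\<close>, and a field orthogonal to all test fields is the gradient of its own divergence.
  Density makes the weak curl unique.  An arbitrary solution is then estimated by testing with
  the constructed solution for the right-hand side \<open>(u, \<cdot>)\<close>.\<close>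

section \<open>Semi-inner products on function spaces\<close>

text \<open>The first equation is tested with all of \<open>Sigma_space \<Omega>\<close>, hence also
  with fields that do not vanish near the boundary, so it imposes a vanishing tangential trace on
  \<open>u\<close> weakly. Together with the normal condition in \<open>H0div \<Omega>\<close> this
  gives full Dirichlet data, and no harmonic fields remain that could spoil coercivity. Two
  obstacles shape the argument. The spaces consist of functions, with \<open>weak_div\<close>,
  \<open>weak_grad\<close> and \<open>weak_curl\<close> picked by choice, so the forms on them are
  only semi-definite and every identity must be insensitive to the choice: almost everywhere for
  divergence and gradient, on \<open>H0div \<Omega>\<close> for the curl. Moreover, density of test
  fields in the graph norm says nothing about their curls, so the \<open>u\<close> of a given
  solution is not known to be a limit of test fields whose curls converge too. The Poincare
  inequality therefore reaches only the constructed solutions directly, which is why a duality step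
  is needed for the others.\<close>

lemma discriminant_le:
  fixes a b r :: real
  assumes quad: "\<And>t. 0 \<le> a + 2 * t * r + t\<^sup>2 * b" and "0 \<le> b"
  shows "r\<^sup>2 \<le> a * b"
proof (cases "b = 0")
  case True
  have "r = 0"
  proof (rule ccontr)
    assume "r \<noteq> 0"
    \<comment> \<open>For \<open>b = 0\<close> the quadratic is affine with slope
      \<open>2 * r\<close>; the chosen \<open>t\<close> gives it the value -1.\<close>
    then show False
      using quad[of "- (a + 1) / (2 * r)"] True by (simp add: field_simps)
  qed
  then show ?thesis using True by simp
next
  case False
  then have "b > 0" using assms(2) by simp
  \<comment> \<open>The minimizer of the quadratic is \<open>t = - r / b\<close>.\<close>
  then have "0 \<le> a - r\<^sup>2 / b"
    using quad[of "- r / b"] by (simp add: field_simps power2_eq_square)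
  then show ?thesis using \<open>b > 0\<close> by (simp add: field_simps)
qed

text \<open>Elements are functions and not classes modulo null sets, so a vector of length zero need
  not be zero and definiteness cannot be asked for. The instances are \<open>L2 \<Omega>\<close>,
  \<open>H0div \<Omega>\<close>, and the test fields under two different forms.\<close>

locale semi_inner_space =
  fixes S :: "('a \<Rightarrow> 'b::real_vector) set" and B :: "('a \<Rightarrow> 'b) \<Rightarrow> ('a \<Rightarrow> 'b) \<Rightarrow> real"
  assumes zero_mem: "(\<lambda>x. 0) \<in> S"
    and add_mem: "v \<in> S \<Longrightarrow> w \<in> S \<Longrightarrow> (\<lambda>x. v x + w x) \<in> S"
    and scale_mem: "v \<in> S \<Longrightarrow> (\<lambda>x. c *\<^sub>R v x) \<in> S"
    and form_add: "v \<in> S \<Longrightarrow> w \<in> S \<Longrightarrow> z \<in> S \<Longrightarrow> B (\<lambda>x. v x + w x) z = B v z + B w z"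
    and form_scale: "v \<in> S \<Longrightarrow> z \<in> S \<Longrightarrow> B (\<lambda>x. c *\<^sub>R v x) z = c * B v z"
    and form_sym: "v \<in> S \<Longrightarrow> w \<in> S \<Longrightarrow> B v w = B w v"
    and form_nonneg: "v \<in> S \<Longrightarrow> 0 \<le> B v v"
begin

lemma combination_mem: "v \<in> S \<Longrightarrow> w \<in> S \<Longrightarrow> (\<lambda>x. a *\<^sub>R v x + b *\<^sub>R w x) \<in> S"
  by (intro add_mem scale_mem)

lemma diff_mem: "v \<in> S \<Longrightarrow> w \<in> S \<Longrightarrow> (\<lambda>x. v x - w x) \<in> S"
  using combination_mem[of v w 1 "-1"] by simp

lemma form_combination:
  assumes "v \<in> S" "w \<in> S" "z \<in> S"
  shows "B (\<lambda>x. a *\<^sub>R v x + b *\<^sub>R w x) z = a * B v z + b * B w z"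
  using assms by (simp add: form_add scale_mem form_scale)

lemma form_combination_right:
  assumes "v \<in> S" "w \<in> S" "z \<in> S"
  shows "B z (\<lambda>x. a *\<^sub>R v x + b *\<^sub>R w x) = a * B z v + b * B z w"
  using form_combination[OF assms] assms by (metis combination_mem form_sym)

lemma form_combination_self:
  assumes "v \<in> S" "w \<in> S"
  shows "B (\<lambda>x. a *\<^sub>R v x + b *\<^sub>R w x) (\<lambda>x. a *\<^sub>R v x + b *\<^sub>R w x)
    = a\<^sup>2 * B v v + 2 * a * b * B v w + b\<^sup>2 * B w w"
  using assms form_sym[of w v]
  by (simp add: form_combination form_combination_right combination_mem power2_eq_square algebra_simps)

lemma form_diff:
  assumes "v \<in> S" "w \<in> S" "z \<in> S"
  shows "B (\<lambda>x. v x - w x) z = B v z - B w z"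
  using form_combination[OF assms, of 1 "-1"] by simp

lemma Cauchy_Schwarz:
  assumes "v \<in> S" "w \<in> S"
  shows "\<bar>B v w\<bar> \<le> sqrt (B v v) * sqrt (B w w)"
proof -
  have quad: "0 \<le> B v v + 2 * t * B v w + t\<^sup>2 * B w w" for t
    using form_nonneg[OF combination_mem[OF assms, of 1 t]] form_combination_self[OF assms, of 1 t] by simp
  then have "(B v w)\<^sup>2 \<le> B v v * B w w"
    by (rule discriminant_le) (rule form_nonneg[OF assms(2)])
  then show ?thesis
    by (metis real_sqrt_abs real_sqrt_le_mono real_sqrt_mult)
qed

lemma triangle:
  assumes "v \<in> S" "w \<in> S"
  shows "sqrt (B (\<lambda>x. v x + w x) (\<lambda>x. v x + w x)) \<le> sqrt (B v v) + sqrt (B w w)"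
proof (rule real_le_lsqrt)
  show "B (\<lambda>x. v x + w x) (\<lambda>x. v x + w x) \<le> (sqrt (B v v) + sqrt (B w w))\<^sup>2"
    using form_combination_self[OF assms, of 1 1] Cauchy_Schwarz[OF assms]
      form_nonneg[OF assms(1)] form_nonneg[OF assms(2)]
    by (simp add: power2_sum abs_le_iff)
qed (simp_all add: assms form_nonneg)

lemma norm_scale:
  "v \<in> S \<Longrightarrow> sqrt (B (\<lambda>x. c *\<^sub>R v x) (\<lambda>x. c *\<^sub>R v x)) = \<bar>c\<bar> * sqrt (B v v)"
  using form_combination_self[of v v c 0]
  by (simp add: real_sqrt_mult)

text \<open>Riesz representation without completeness: a minimizing sequence of
  \<open>B v v - 2 * F v\<close> is Cauchy and represents \<open>F\<close> in the limit.\<close>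

lemma representing_sequence:
  assumes F_add: "\<And>v w. v \<in> S \<Longrightarrow> w \<in> S \<Longrightarrow> F (\<lambda>x. v x + w x) = F v + F w"
    and F_scale: "\<And>c v. v \<in> S \<Longrightarrow> F (\<lambda>x. c *\<^sub>R v x) = c * F v"
    and F_bound: "\<And>v. v \<in> S \<Longrightarrow> \<bar>F v\<bar> \<le> K * sqrt (B v v)"
  obtains \<phi> where "\<And>n. \<phi> n \<in> S"
    and "\<And>e. e > 0 \<Longrightarrow> \<exists>N. \<forall>m\<ge>N. \<forall>n\<ge>N. B (\<lambda>x. \<phi> m x - \<phi> n x) (\<lambda>x. \<phi> m x - \<phi> n x) < e"
    and "\<And>v. v \<in> S \<Longrightarrow> (\<lambda>n. B (\<phi> n) v) \<longlonglongrightarrow> F v"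
proof -
  define J where "J v = B v v - 2 * F v" for v
  define m where "m = (INF v\<in>S. J v)"
  have F_comb: "F (\<lambda>x. a *\<^sub>R v x + b *\<^sub>R w x) = a * F v + b * F w" if "v \<in> S" "w \<in> S" for v w a b
    using that by (simp add: F_add F_scale scale_mem)
  \<comment> \<open>Completing the square bounds \<open>J\<close> from below, so that its infimum is
    meaningful.\<close>
  have low: "- K\<^sup>2 \<le> J v" if "v \<in> S" for v
  proof -
    have "0 \<le> (sqrt (B v v) - K)\<^sup>2" by simp
    also have "\<dots> = B v v - 2 * (K * sqrt (B v v)) + K\<^sup>2"
      using form_nonneg[OF that] by (simp add: power2_diff algebra_simps)
    finally show ?thesis using F_bound[OF that] by (simp add: J_def abs_le_iff)
  qed
  then have bdd: "bdd_below (J ` S)" by (auto intro!: bdd_belowI2)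
  have m_le: "m \<le> J v" if "v \<in> S" for v
    unfolding m_def by (rule cINF_lower[OF bdd that])
  have "\<exists>v\<in>S. J v < m + inverse (real (Suc n))" for n
    using cINF_less_iff[OF _ bdd, THEN iffD1, of "m + inverse (real (Suc n))"] zero_mem
    by (auto simp: m_def)
  then obtain \<phi> where \<phi>: "\<And>n. \<phi> n \<in> S" "\<And>n. J (\<phi> n) < m + inverse (real (Suc n))"
    by metis
  define \<epsilon> where "\<epsilon> n = J (\<phi> n) - m" for n
  have \<epsilon>_nonneg: "0 \<le> \<epsilon> n" for n using m_le[OF \<phi>(1)] by (simp add: \<epsilon>_def)
  have "\<epsilon> \<longlonglongrightarrow> 0"
    by (rule real_tendsto_sandwich[OF _ _ tendsto_const LIMSEQ_inverse_real_of_nat])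
      (use \<epsilon>_nonneg \<phi>(2) in \<open>auto simp: \<epsilon>_def less_imp_le algebra_simps intro!: always_eventually\<close>)
  have parallelogram: "B (\<lambda>x. \<phi> i x - \<phi> j x) (\<lambda>x. \<phi> i x - \<phi> j x) \<le> 2 * \<epsilon> i + 2 * \<epsilon> j" for i j
  proof -
    \<comment> \<open>Minimality is used at the midpoint: the form of the difference equals
      \<open>2 * J (\<phi> i) + 2 * J (\<phi> j) - 4 * J ?h\<close>, and \<open>J ?h\<close> is at
      least \<open>m\<close>.\<close>
    let ?h = "\<lambda>x. (1/2) *\<^sub>R \<phi> i x + (1/2) *\<^sub>R \<phi> j x"
    have "J ?h = B (\<phi> i) (\<phi> i) / 4 + B (\<phi> i) (\<phi> j) / 2 + B (\<phi> j) (\<phi> j) / 4 - F (\<phi> i) - F (\<phi> j)"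
      using \<phi>(1) by (simp add: J_def form_combination_self F_comb power2_eq_square)
    moreover have "B (\<lambda>x. \<phi> i x - \<phi> j x) (\<lambda>x. \<phi> i x - \<phi> j x)
        = B (\<phi> i) (\<phi> i) - 2 * B (\<phi> i) (\<phi> j) + B (\<phi> j) (\<phi> j)"
      using form_combination_self[OF \<phi>(1) \<phi>(1), where a=1 and b="-1"] by simp
    ultimately show ?thesis
      using m_le[OF combination_mem[OF \<phi>(1)[of i] \<phi>(1)[of j], of "1/2" "1/2"]]
      unfolding \<epsilon>_def J_def by argo
  qed
  show thesis
  proof
    show "\<phi> n \<in> S" for n by (rule \<phi>)
    show "\<exists>N. \<forall>m\<ge>N. \<forall>n\<ge>N. B (\<lambda>x. \<phi> m x - \<phi> n x) (\<lambda>x. \<phi> m x - \<phi> n x) < e" if "e > 0" for e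
    proof -
      have "\<forall>\<^sub>F n in sequentially. \<epsilon> n < e / 4"
        using order_tendstoD(2)[OF \<open>\<epsilon> \<longlonglongrightarrow> 0\<close>, of "e/4"] that by simp
      then obtain N where "\<forall>n\<ge>N. \<epsilon> n < e / 4"
        unfolding eventually_sequentially by blast
      then have "B (\<lambda>x. \<phi> i x - \<phi> j x) (\<lambda>x. \<phi> i x - \<phi> j x) < e" if "i \<ge> N" "j \<ge> N" for i j
        using parallelogram[of i j] spec[OF \<open>\<forall>n\<ge>N. \<epsilon> n < e / 4\<close>, of i]
          spec[OF \<open>\<forall>n\<ge>N. \<epsilon> n < e / 4\<close>, of j] that by linarith
      then show ?thesis by blast
    qed
    show "(\<lambda>n. B (\<phi> n) v) \<longlonglongrightarrow> F v" if v: "v \<in> S" for v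
    proof -
      define r where "r n = B (\<phi> n) v - F v" for n
      \<comment> \<open>A move from \<open>\<phi> n\<close> along \<open>v\<close> cannot push
        \<open>J\<close> below \<open>m\<close>; the discriminant of this quadratic in
        \<open>t\<close> bounds the residual \<open>r n\<close> by the defect
        \<open>\<epsilon> n\<close>.\<close>
      have var: "0 \<le> \<epsilon> n + 2 * t * r n + t\<^sup>2 * B v v" for n t
      proof -
        have "J (\<lambda>x. 1 *\<^sub>R \<phi> n x + t *\<^sub>R v x) = J (\<phi> n) + 2 * t * r n + t\<^sup>2 * B v v"
          using \<phi>(1) v form_sym[OF v \<phi>(1), of n]
          by (simp add: J_def form_combination_self F_comb r_def algebra_simps del: scaleR_one)
        then show ?thesis
          using m_le[OF combination_mem[OF \<phi>(1)[of n] v, of 1 t]] by (simp add: \<epsilon>_def)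
      qed
      have "\<bar>r n\<bar> \<le> sqrt (\<epsilon> n * B v v)" for n
        using real_sqrt_le_mono[OF discriminant_le[OF var form_nonneg[OF v], of n]] by simp
      moreover have "(\<lambda>n. sqrt (\<epsilon> n * B v v)) \<longlonglongrightarrow> 0"
        using tendsto_real_sqrt[OF tendsto_mult_left_zero[OF \<open>\<epsilon> \<longlonglongrightarrow> 0\<close>]] by simp
      ultimately have "r \<longlonglongrightarrow> 0"
        by (intro Lim_null_comparison[where f=r]) (auto intro!: always_eventually)
      then show ?thesis unfolding r_def by (rule LIM_zero_cancel)
    qed
  qed
qed

end

section \<open>Square-integrable functions\<close>

lemma L2_measurable: "f \<in> L2 \<Omega> \<Longrightarrow> f \<in> borel_measurable (lebesgue_on \<Omega>)"
  by (simp add: L2_def)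

lemma L2_square_integrable: "f \<in> L2 \<Omega> \<Longrightarrow> integrable (lebesgue_on \<Omega>) (\<lambda>x. (norm (f x))\<^sup>2)"
  by (simp add: L2_def)

lemma L2_inner_integrable:
  assumes "f \<in> L2 \<Omega>" "g \<in> L2 \<Omega>"
  shows "integrable (lebesgue_on \<Omega>) (\<lambda>x. f x \<bullet> g x)"
proof (rule Bochner_Integration.integrable_bound)
  show "integrable (lebesgue_on \<Omega>) (\<lambda>x. (norm (f x))\<^sup>2 + (norm (g x))\<^sup>2)"
    using assms by (intro Bochner_Integration.integrable_add L2_square_integrable)
  show "(\<lambda>x. f x \<bullet> g x) \<in> borel_measurable (lebesgue_on \<Omega>)"
    using assms by (intro borel_measurable_inner L2_measurable)
  have "\<bar>f x \<bullet> g x\<bar> \<le> (norm (f x))\<^sup>2 + (norm (g x))\<^sup>2" for x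
    using Cauchy_Schwarz_ineq2[of "f x" "g x"] sum_squares_bound[of "norm (f x)" "norm (g x)"]
      mult_nonneg_nonneg[of "norm (f x)" "norm (g x)"]
    by simp
  then show "AE x in lebesgue_on \<Omega>. norm (f x \<bullet> g x) \<le> norm ((norm (f x))\<^sup>2 + (norm (g x))\<^sup>2)"
    by simp
qed

lemma L2_add:
  assumes "f \<in> L2 \<Omega>" "g \<in> L2 \<Omega>"
  shows "(\<lambda>x. f x + g x) \<in> L2 \<Omega>"
  unfolding L2_def
proof (intro CollectI conjI)
  show "(\<lambda>x. f x + g x) \<in> borel_measurable (lebesgue_on \<Omega>)"
    using assms by (intro borel_measurable_add L2_measurable)
  have "(norm (f x + g x))\<^sup>2 = (norm (f x))\<^sup>2 + 2 * (f x \<bullet> g x) + (norm (g x))\<^sup>2" for x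
    by (simp add: power2_norm_eq_inner inner_add inner_commute)
  then show "integrable (lebesgue_on \<Omega>) (\<lambda>x. (norm (f x + g x))\<^sup>2)"
    using assms by (simp add: L2_square_integrable L2_inner_integrable)
qed

lemma L2_scaleR: "f \<in> L2 \<Omega> \<Longrightarrow> (\<lambda>x. c *\<^sub>R f x) \<in> L2 \<Omega>"
  by (auto simp: L2_def power_mult_distrib intro: borel_measurable_scaleR)

interpretation L2: semi_inner_space "L2 \<Omega>" "L2_inner \<Omega>" for \<Omega>
proof
  show "(\<lambda>x. 0) \<in> L2 \<Omega>" by (simp add: L2_def)
  fix v w z :: "real^3 \<Rightarrow> 'a" and c :: real
  assume *: "v \<in> L2 \<Omega>"
  show "(\<lambda>x. c *\<^sub>R v x) \<in> L2 \<Omega>" by (rule L2_scaleR[OF *])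
  show "0 \<le> L2_inner \<Omega> v v" by (simp add: L2_inner_def)
  { assume "w \<in> L2 \<Omega>"
    then show "(\<lambda>x. v x + w x) \<in> L2 \<Omega>" by (rule L2_add[OF *])
    show "L2_inner \<Omega> v w = L2_inner \<Omega> w v" by (simp add: L2_inner_def inner_commute)
    assume "z \<in> L2 \<Omega>"
    then show "L2_inner \<Omega> (\<lambda>x. v x + w x) z = L2_inner \<Omega> v z + L2_inner \<Omega> w z"
      using * \<open>w \<in> L2 \<Omega>\<close> by (simp add: L2_inner_def inner_add_left L2_inner_integrable) }
  assume "z \<in> L2 \<Omega>"
  then show "L2_inner \<Omega> (\<lambda>x. c *\<^sub>R v x) z = c * L2_inner \<Omega> v z"
    by (simp add: L2_inner_def)
qed

lemma L2_norm_nonneg: "0 \<le> L2_norm \<Omega> f"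
  by (simp add: L2_norm_def L2_inner_def)

lemma L2_norm_power2: "(L2_norm \<Omega> f)\<^sup>2 = L2_inner \<Omega> f f"
  by (simp add: L2_norm_def L2_inner_def)

lemma L2_Cauchy_Schwarz:
  "f \<in> L2 \<Omega> \<Longrightarrow> g \<in> L2 \<Omega> \<Longrightarrow> \<bar>L2_inner \<Omega> f g\<bar> \<le> L2_norm \<Omega> f * L2_norm \<Omega> g"
  unfolding L2_norm_def by (rule L2.Cauchy_Schwarz)

lemma L2_inner_cong_AE:
  assumes "AE x in lebesgue_on \<Omega>. f x = f' x" "AE x in lebesgue_on \<Omega>. g x = g' x"
    and "f \<in> L2 \<Omega>" "f' \<in> L2 \<Omega>" "g \<in> L2 \<Omega>" "g' \<in> L2 \<Omega>"
  shows "L2_inner \<Omega> f g = L2_inner \<Omega> f' g'"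
  unfolding L2_inner_def
proof (rule integral_cong_AE)
  show "AE x in lebesgue_on \<Omega>. f x \<bullet> g x = f' x \<bullet> g' x"
    using assms(1,2) by eventually_elim simp
qed (simp_all add: borel_measurable_inner L2_measurable assms)

lemma L2_norm_cong_AE:
  "AE x in lebesgue_on \<Omega>. f x = f' x \<Longrightarrow> f \<in> L2 \<Omega> \<Longrightarrow> f' \<in> L2 \<Omega> \<Longrightarrow> L2_norm \<Omega> f = L2_norm \<Omega> f'"
  unfolding L2_norm_def using L2_inner_cong_AE[of f f' \<Omega> f f'] by simp

lemma AE_zero_if_L2_norm_zero:
  assumes "f \<in> L2 \<Omega>" "L2_norm \<Omega> f = 0"
  shows "AE x in lebesgue_on \<Omega>. f x = 0"
  using integral_nonneg_eq_0_iff_AE[OF L2_inner_integrable[OF assms(1,1)]] assms(2)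
  by (simp add: L2_norm_def L2_inner_def)

lemma L2_if_bounded:
  assumes "\<Omega> \<in> lmeasurable" "f \<in> borel_measurable (lebesgue_on \<Omega>)" "\<And>x. norm (f x) \<le> C"
  shows "f \<in> L2 \<Omega>"
proof -
  interpret finite_measure "lebesgue_on \<Omega>" by (rule finite_measure_lebesgue_on[OF assms(1)])
  have "integrable (lebesgue_on \<Omega>) (\<lambda>x. (norm (f x))\<^sup>2)"
    using assms(2,3) by (intro integrable_const_bound[of _ "C\<^sup>2"]) (auto intro!: power_mono)
  then show ?thesis using assms(2) by (simp add: L2_def)
qed

text \<open>Cauchy-Schwarz against the constant 1, which is square integrable because the measure is
  finite.\<close>

lemma L2_imp_L1:
  assumes "\<Omega> \<in> lmeasurable" "f \<in> L2 \<Omega>"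
  shows "integrable (lebesgue_on \<Omega>) f"
    and "(\<integral>x. norm (f x) \<partial>lebesgue_on \<Omega>) \<le> L2_norm \<Omega> f * L2_norm \<Omega> (\<lambda>x. 1::real)"
proof -
  have n: "(\<lambda>x. norm (f x)) \<in> L2 \<Omega>"
    using assms(2) by (auto simp: L2_def intro: borel_measurable_norm)
  have o: "(\<lambda>x. 1::real) \<in> L2 \<Omega>"
    using assms(1) by (intro L2_if_bounded[of _ _ 1]) auto
  have "integrable (lebesgue_on \<Omega>) (\<lambda>x. norm (f x))"
    using L2_inner_integrable[OF n o] by simp
  then show "integrable (lebesgue_on \<Omega>) f"
    using L2_measurable[OF assms(2)] by (simp add: integrable_norm_iff)
  have "L2_norm \<Omega> (\<lambda>x. norm (f x)) = L2_norm \<Omega> f"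
    by (simp add: L2_norm_def L2_inner_def power2_norm_eq_inner[symmetric] power2_eq_square[symmetric])
  then show "(\<integral>x. norm (f x) \<partial>lebesgue_on \<Omega>) \<le> L2_norm \<Omega> f * L2_norm \<Omega> (\<lambda>x. 1::real)"
    using L2_Cauchy_Schwarz[OF n o] by (simp add: L2_inner_def abs_le_iff)
qed

text \<open>Riesz-Fischer. A Cauchy sequence in \<open>L2\<close> is Cauchy in L1, so a subsequence
  converges almost everywhere; Fatou's lemma then carries the quadratic bounds over to the pointwise
  limit.\<close>

lemma L2_complete:
  fixes f :: "nat \<Rightarrow> real^3 \<Rightarrow> 'b::euclidean_space"
  assumes \<Omega>: "\<Omega> \<in> lmeasurable" and f: "\<And>n. f n \<in> L2 \<Omega>"
    and Cauchy: "\<And>e. e > 0 \<Longrightarrow>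
      \<exists>N. \<forall>m\<ge>N. \<forall>n\<ge>N. L2_inner \<Omega> (\<lambda>x. f m x - f n x) (\<lambda>x. f m x - f n x) < e"
  obtains g where "g \<in> L2 \<Omega>" "(\<lambda>n. L2_norm \<Omega> (\<lambda>x. f n x - g x)) \<longlonglongrightarrow> 0"
proof -
  let ?M = "lebesgue_on \<Omega>"
  define c where "c = L2_norm \<Omega> (\<lambda>x. 1::real)"
  have c: "0 \<le> c" by (simp add: c_def L2_norm_nonneg)
  note [measurable] = L2_measurable[OF f]
  have "\<exists>N. \<forall>m\<ge>N. \<forall>n\<ge>N. (\<integral>x. norm (f m x - f n x) \<partial>?M) < e" if "e > 0" for e
  proof -
    \<comment> \<open>The denominator \<open>c + 1\<close> stays positive even if \<open>c\<close>,
      the square root of the volume, is 0.\<close>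
    define d where "d = e / (c + 1)"
    have d: "0 < d" "d * c < e" using that c by (auto simp: d_def field_simps)
    obtain N where N: "L2_inner \<Omega> (\<lambda>x. f m x - f n x) (\<lambda>x. f m x - f n x) < d\<^sup>2"
      if "m \<ge> N" "n \<ge> N" for m n
      using Cauchy[of "d\<^sup>2"] d by auto
    have "(\<integral>x. norm (f m x - f n x) \<partial>?M) < e" if "m \<ge> N" "n \<ge> N" for m n
    proof -
      have "L2_norm \<Omega> (\<lambda>x. f m x - f n x) \<le> d"
        unfolding L2_norm_def using N[OF that] d by (intro real_le_lsqrt) auto
      then have "L2_norm \<Omega> (\<lambda>x. f m x - f n x) * c \<le> d * c"
        using c by (rule mult_right_mono)
      then show ?thesis
        using L2_imp_L1(2)[OF \<Omega> L2.diff_mem[OF f f, of m n]] d by (simp add: c_def)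
    qed
    then show ?thesis by blast
  qed
  then obtain r where r: "strict_mono r" "AE x in ?M. Cauchy (\<lambda>i. f (r i) x)"
    using cauchy_L1_AE_cauchy_subseq[of ?M f] L2_imp_L1(1)[OF \<Omega> f] by blast
  \<comment> \<open>Off the set of convergence \<open>lim\<close> is an unspecified value; that set
    has a null complement.\<close>
  define g where "g x = lim (\<lambda>i. f (r i) x)" for x
  have g_meas [measurable]: "g \<in> borel_measurable ?M"
    unfolding g_def by measurable
  have g_lim: "AE x in ?M. (\<lambda>i. f (r i) x) \<longlonglongrightarrow> g x"
    using r(2) by eventually_elim (simp add: g_def Cauchy_convergent_iff convergent_LIMSEQ_iff)
  \<comment> \<open>Fatou is applied along the subsequence; \<open>r k\<close> is at least
    \<open>k\<close>, so the assumed bound covers its indices as well.\<close>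
  have fatou: "(\<integral>\<^sup>+x. ennreal ((norm (f n x - g x))\<^sup>2) \<partial>?M) \<le> ennreal e"
    if N: "\<And>k. k \<ge> N \<Longrightarrow> L2_inner \<Omega> (\<lambda>x. f n x - f k x) (\<lambda>x. f n x - f k x) \<le> e" for n N e
  proof -
    have "(\<integral>\<^sup>+x. ennreal ((norm (f n x - g x))\<^sup>2) \<partial>?M)
        = (\<integral>\<^sup>+x. liminf (\<lambda>k. ennreal ((norm (f n x - f (r k) x))\<^sup>2)) \<partial>?M)"
    proof (rule nn_integral_cong_AE, use g_lim in eventually_elim)
      case (elim x)
      have "(\<lambda>k. ennreal ((norm (f n x - f (r k) x))\<^sup>2)) \<longlonglongrightarrow> ennreal ((norm (f n x - g x))\<^sup>2)"
        using elim by (intro tendsto_intros tendsto_ennrealI)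
      then show ?case by (rule lim_imp_Liminf[OF sequentially_bot, symmetric])
    qed
    also have "\<dots> \<le> liminf (\<lambda>k. \<integral>\<^sup>+x. ennreal ((norm (f n x - f (r k) x))\<^sup>2) \<partial>?M)"
      by (rule nn_integral_liminf) measurable
    also have "\<dots> \<le> ennreal e"
    proof (rule Liminf_le)
      show "\<forall>\<^sub>F k in sequentially. (\<integral>\<^sup>+x. ennreal ((norm (f n x - f (r k) x))\<^sup>2) \<partial>?M) \<le> ennreal e"
        using eventually_ge_at_top[of N]
      proof eventually_elim
        case (elim k)
        then have "r k \<ge> N" using seq_suble[OF r(1), of k] by simp
        have "(\<integral>\<^sup>+x. ennreal ((norm (f n x - f (r k) x))\<^sup>2) \<partial>?M)
            = ennreal (\<integral>x. (norm (f n x - f (r k) x))\<^sup>2 \<partial>?M)"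
          by (intro nn_integral_eq_integral L2_square_integrable L2.diff_mem f) auto
        also have "\<dots> \<le> ennreal e"
          using N[OF \<open>r k \<ge> N\<close>] by (intro ennreal_leI) (simp add: L2_inner_def power2_norm_eq_inner)
        finally show ?case .
      qed
    qed simp
    finally show ?thesis .
  qed
  have diff: "(\<lambda>x. f n x - g x) \<in> L2 \<Omega> \<and> L2_inner \<Omega> (\<lambda>x. f n x - g x) (\<lambda>x. f n x - g x) \<le> e"
    if N: "\<And>k. k \<ge> N \<Longrightarrow> L2_inner \<Omega> (\<lambda>x. f n x - f k x) (\<lambda>x. f n x - f k x) \<le> e" and "e > 0" for n N e
  proof -
    have le: "(\<integral>\<^sup>+x. ennreal ((norm (f n x - g x))\<^sup>2) \<partial>?M) \<le> ennreal e"
      by (rule fatou) (rule N)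
    have "integrable ?M (\<lambda>x. (norm (f n x - g x))\<^sup>2)"
      by (intro integrableI_bounded) (use le_less_trans[OF le ennreal_less_top] in simp_all)
    then have mem: "(\<lambda>x. f n x - g x) \<in> L2 \<Omega>" by (simp add: L2_def)
    have "ennreal (\<integral>x. (norm (f n x - g x))\<^sup>2 \<partial>?M) \<le> ennreal e"
      using le L2_square_integrable[OF mem] by (subst nn_integral_eq_integral[symmetric]) auto
    then show ?thesis using mem that(2) by (simp add: L2_inner_def power2_norm_eq_inner)
  qed
  obtain N1 where "\<And>m n. m \<ge> N1 \<Longrightarrow> n \<ge> N1 \<Longrightarrow>
      L2_inner \<Omega> (\<lambda>x. f m x - f n x) (\<lambda>x. f m x - f n x) < 1"
    using Cauchy[of 1] by auto
  then have "(\<lambda>x. f N1 x - g x) \<in> L2 \<Omega>" using diff[of N1 N1 1] by (simp add: less_imp_le)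
  \<comment> \<open>\<open>g\<close> is \<open>f N1\<close> minus the difference
    \<open>f N1 - g\<close>, both of which are square integrable.\<close>
  from L2.diff_mem[OF f[of N1] this] have g: "g \<in> L2 \<Omega>" by simp
  have "(\<lambda>n. L2_norm \<Omega> (\<lambda>x. f n x - g x)) \<longlonglongrightarrow> 0"
  proof (rule LIMSEQ_I)
    fix e :: real assume e: "e > 0"
    then obtain N where N: "\<And>m n. m \<ge> N \<Longrightarrow> n \<ge> N \<Longrightarrow>
        L2_inner \<Omega> (\<lambda>x. f m x - f n x) (\<lambda>x. f m x - f n x) < (e/2)\<^sup>2"
      using Cauchy[of "(e/2)\<^sup>2"] by auto
    have "L2_norm \<Omega> (\<lambda>x. f n x - g x) < e" if "n \<ge> N" for n
    proof -
      have "L2_inner \<Omega> (\<lambda>x. f n x - g x) (\<lambda>x. f n x - g x) \<le> (e/2)\<^sup>2"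
        using diff[of N n "(e/2)\<^sup>2"] N[OF that] e by (simp add: less_imp_le)
      then have "L2_norm \<Omega> (\<lambda>x. f n x - g x) \<le> e/2"
        unfolding L2_norm_def using e by (intro real_le_lsqrt) auto
      then show ?thesis using e by simp
    qed
    then show "\<exists>no. \<forall>n\<ge>no. norm (L2_norm \<Omega> (\<lambda>x. f n x - g x) - 0) < e"
      by (intro exI[of _ N]) (simp add: L2_norm_nonneg)
  qed
  with g show thesis by (rule that)
qed

lemma L2_inner_tendsto:
  assumes "\<And>n. f n \<in> L2 \<Omega>" "g \<in> L2 \<Omega>" "h \<in> L2 \<Omega>"
    and "(\<lambda>n. L2_norm \<Omega> (\<lambda>x. f n x - g x)) \<longlonglongrightarrow> 0"
  shows "(\<lambda>n. L2_inner \<Omega> (f n) h) \<longlonglongrightarrow> L2_inner \<Omega> g h"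
proof -
  have "\<bar>L2_inner \<Omega> (f n) h - L2_inner \<Omega> g h\<bar> \<le> L2_norm \<Omega> (\<lambda>x. f n x - g x) * L2_norm \<Omega> h" for n
    using L2_Cauchy_Schwarz[OF L2.diff_mem[OF assms(1,2)] assms(3)] assms(1-3)
    by (simp add: L2.form_diff)
  then show ?thesis
    by (intro LIM_zero_cancel[OF Lim_null_comparison[OF always_eventually tendsto_mult_left_zero
          [where c="L2_norm \<Omega> h", OF assms(4)]]]) simp
qed

lemma L2_norm_tendsto:
  assumes "\<And>n. f n \<in> L2 \<Omega>" "g \<in> L2 \<Omega>"
    and "(\<lambda>n. L2_norm \<Omega> (\<lambda>x. f n x - g x)) \<longlonglongrightarrow> 0"
  shows "(\<lambda>n. L2_norm \<Omega> (f n)) \<longlonglongrightarrow> L2_norm \<Omega> g"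
proof -
  have "\<bar>L2_norm \<Omega> (f n) - L2_norm \<Omega> g\<bar> \<le> L2_norm \<Omega> (\<lambda>x. f n x - g x)" for n
  proof -
    have "L2_norm \<Omega> (f n) \<le> L2_norm \<Omega> (\<lambda>x. f n x - g x) + L2_norm \<Omega> g"
      using L2.triangle[OF L2.diff_mem[OF assms(1,2)] assms(2)] by (simp add: L2_norm_def)
    moreover have "L2_norm \<Omega> g \<le> L2_norm \<Omega> (f n) + L2_norm \<Omega> (\<lambda>x. f n x - g x)"
      using L2.triangle[OF assms(1)[of n] L2_scaleR[OF L2.diff_mem[OF assms(1,2)], of "-1" n]]
        L2.norm_scale[OF L2.diff_mem[OF assms(1,2)], of "-1" n]
      by (simp add: L2_norm_def)
    ultimately show ?thesis by simp
  qed
  then show ?thesis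
    by (intro LIM_zero_cancel[OF Lim_null_comparison[OF always_eventually assms(3)]]) simp
qed

section \<open>Test functions\<close>

lemma has_derivative_frechet:
  "f differentiable (at x) \<Longrightarrow> (f has_derivative frechet_derivative f (at x)) (at x)"
  by (simp add: frechet_derivative_works)

lemma partial_eqI: "(f has_derivative f') (at x) \<Longrightarrow> partial i f x = f' (axis i 1)"
  by (metis partial_def frechet_derivative_at)

lemma partial_const [simp]: "partial i (\<lambda>x. c) = (\<lambda>x. 0)"
  by (rule ext) (rule partial_eqI, rule has_derivative_const)

lemma partial_add:
  "f differentiable (at x) \<Longrightarrow> g differentiable (at x) \<Longrightarrow>
    partial i (\<lambda>x. f x + g x) x = partial i f x + partial i g x"
  by (rule partial_eqI[THEN trans], rule has_derivative_add, (rule has_derivative_frechet, assumption)+)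
    (simp add: partial_def)

lemma partial_mult:
  "f differentiable (at x) \<Longrightarrow> g differentiable (at x) \<Longrightarrow>
    partial i (\<lambda>x. f x * g x) x = f x * partial i g x + partial i f x * g x"
  by (rule partial_eqI[THEN trans], rule has_derivative_mult, (rule has_derivative_frechet, assumption)+)
    (simp add: partial_def)

lemma partial_cmult:
  "f differentiable (at x) \<Longrightarrow> partial i (\<lambda>x. c * f x) x = c * partial i f x"
  using partial_mult[of "\<lambda>x. c" x f i] by simp

lemma partial_coordinate: "partial i (\<lambda>x. x $ j) = (\<lambda>x. if i = j then 1 else 0)"
proof
  fix x
  have "((\<lambda>x::real^3. x $ j) has_derivative (\<lambda>x. x $ j)) (at x)"
    by (rule bounded_linear_imp_has_derivative[OF bounded_linear_vec_nth])
  from partial_eqI[OF this, of i] show "partial i (\<lambda>x. x $ j) x = (if i = j then 1 else 0)"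
    by (simp add: axis_def)
qed

lemma Ck_continuous: "Ck k f \<Longrightarrow> continuous_on UNIV f"
  by (cases k) (auto simp: continuous_on_eq_continuous_within differentiable_imp_continuous_within)

lemma Ck_SucD: "Ck (Suc k) f \<Longrightarrow> Ck k f"
proof (induction k arbitrary: f)
  case 0
  then show ?case using Ck_continuous[OF 0] by simp
qed simp

lemma Ck_const: "Ck k (\<lambda>x. c)"
  by (induction k arbitrary: c) auto

lemma Ck_add: "Ck k f \<Longrightarrow> Ck k g \<Longrightarrow> Ck k (\<lambda>x. f x + g x)"
proof (induction k arbitrary: f g)
  case 0
  then show ?case by (auto intro: continuous_on_add)
next
  case (Suc k)
  then have "partial i (\<lambda>x. f x + g x) = (\<lambda>x. partial i f x + partial i g x)" for i
    by (auto simp: partial_add)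
  with Suc show ?case by auto
qed

lemma Ck_mult: "Ck k f \<Longrightarrow> Ck k g \<Longrightarrow> Ck k (\<lambda>x. f x * g x)"
proof (induction k arbitrary: f g)
  case 0
  then show ?case by (auto intro: continuous_on_mult)
next
  case (Suc k)
  then have "partial i (\<lambda>x. f x * g x) = (\<lambda>x. f x * partial i g x + partial i f x * g x)" for i
    by (auto simp: partial_mult)
  with Suc Ck_SucD[OF Suc.prems(1)] Ck_SucD[OF Suc.prems(2)] show ?case
    by (auto intro!: Ck_add)
qed

lemma Ck_coordinate: "Ck k (\<lambda>x. x $ j)"
proof (cases k)
  case (Suc n)
  have "(\<lambda>x::real^3. x $ j) differentiable (at x)" for x
    by (rule bounded_linear_imp_differentiable[OF bounded_linear_vec_nth])
  with Suc show ?thesis by (simp add: partial_coordinate Ck_const)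
qed (auto intro: continuous_intros)

section \<open>Supports, closure properties and integrability of test functions\<close>

lemma test_functionI:
  assumes "\<And>k. Ck k \<phi>" "compact K" "K \<subseteq> \<Omega>" "\<And>x. x \<notin> K \<Longrightarrow> \<phi> x = 0"
  shows "\<phi> \<in> test_functions \<Omega>"
proof -
  have "closure {x. \<phi> x \<noteq> 0} \<subseteq> K"
    using assms(2,4) by (intro closure_minimal compact_imp_closed) auto
  then show ?thesis
    using assms(1-3) compact_Int_closed[of K "closure {x. \<phi> x \<noteq> 0}"]
    by (auto simp: test_functions_def Int_absorb1)
qed

lemma test_function_support:
  assumes "\<phi> \<in> test_functions \<Omega>"
  shows "\<exists>K. compact K \<and> K \<subseteq> \<Omega> \<and> (\<forall>x. x \<notin> K \<longrightarrow> \<phi> x = 0)"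
proof (intro exI conjI allI impI)
  show "compact (closure {x. \<phi> x \<noteq> 0})" "closure {x. \<phi> x \<noteq> 0} \<subseteq> \<Omega>"
    using assms by (auto simp: test_functions_def)
  show "\<phi> x = 0" if "x \<notin> closure {x. \<phi> x \<noteq> 0}" for x
    using that closure_subset[of "{x. \<phi> x \<noteq> 0}"] by blast
qed

lemma partial_eq_0_outside:
  assumes "closed K" "\<And>x. x \<notin> K \<Longrightarrow> \<phi> x = 0" "x \<notin> K"
  shows "partial i \<phi> x = 0"
proof -
  have "((\<lambda>x. 0) has_derivative (\<lambda>x. 0)) (at x)" by simp
  then have "(\<phi> has_derivative (\<lambda>x. 0)) (at x)"
    by (rule has_derivative_transform_within_open[where s="- K"]) (use assms in auto)
  then show ?thesis by (rule partial_eqI)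
qed

lemma test_function_Ck: "\<phi> \<in> test_functions \<Omega> \<Longrightarrow> Ck k \<phi>"
  by (simp add: test_functions_def)

lemma test_function_differentiable: "\<phi> \<in> test_functions \<Omega> \<Longrightarrow> \<phi> differentiable (at x)"
  using test_function_Ck[of \<phi> \<Omega> 1] by simp

lemma test_function_continuous: "\<phi> \<in> test_functions \<Omega> \<Longrightarrow> continuous_on UNIV \<phi>"
  using test_function_Ck[of \<phi> \<Omega> 0] by simp

lemma test_function_zero: "(\<lambda>x. 0) \<in> test_functions \<Omega>"
  by (rule test_functionI[of _ "{}"]) (auto simp: Ck_const)

lemma test_function_add:
  assumes "\<phi> \<in> test_functions \<Omega>" "\<psi> \<in> test_functions \<Omega>"
  shows "(\<lambda>x. \<phi> x + \<psi> x) \<in> test_functions \<Omega>"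
proof -
  obtain K where "compact K" "K \<subseteq> \<Omega>" "\<And>x. x \<notin> K \<Longrightarrow> \<phi> x = 0"
    using test_function_support[OF assms(1)] by blast
  moreover obtain L where "compact L" "L \<subseteq> \<Omega>" "\<And>x. x \<notin> L \<Longrightarrow> \<psi> x = 0"
    using test_function_support[OF assms(2)] by blast
  ultimately show ?thesis
    using assms by (intro test_functionI[of _ "K \<union> L"] Ck_add) (auto simp: test_function_Ck)
qed

lemma test_function_mult:
  assumes "\<And>k. Ck k f" "\<phi> \<in> test_functions \<Omega>"
  shows "(\<lambda>x. f x * \<phi> x) \<in> test_functions \<Omega>"
proof -
  obtain K where "compact K" "K \<subseteq> \<Omega>" "\<And>x. x \<notin> K \<Longrightarrow> \<phi> x = 0"
    using test_function_support[OF assms(2)] by blast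
  then show ?thesis
    using assms by (intro test_functionI[of _ K] Ck_mult) (auto simp: test_function_Ck)
qed

lemma test_function_diff:
  assumes "\<phi> \<in> test_functions \<Omega>" "\<psi> \<in> test_functions \<Omega>"
  shows "(\<lambda>x. \<phi> x - \<psi> x) \<in> test_functions \<Omega>"
  using test_function_add[OF assms(1) test_function_mult[of "\<lambda>x. -1", OF Ck_const assms(2)]] by simp

lemma test_function_partial:
  assumes "\<phi> \<in> test_functions \<Omega>"
  shows "partial i \<phi> \<in> test_functions \<Omega>"
proof -
  have "Ck k (partial i \<phi>)" for k
    using test_function_Ck[OF assms, of "Suc k"] by simp
  moreover obtain K where K: "compact K" "K \<subseteq> \<Omega>" "\<And>x. x \<notin> K \<Longrightarrow> \<phi> x = 0"
    using test_function_support[OF assms] by blast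
  ultimately show ?thesis
    using partial_eq_0_outside[OF compact_imp_closed[OF K(1)] K(3)] by (intro test_functionI[of _ K])
qed

lemma test_function_bounded:
  assumes "\<phi> \<in> test_functions \<Omega>"
  obtains C where "C > 0" "\<And>x. \<bar>\<phi> x\<bar> \<le> C"
proof -
  obtain K where K: "compact K" "K \<subseteq> \<Omega>" "\<And>x. x \<notin> K \<Longrightarrow> \<phi> x = 0"
    using test_function_support[OF assms] by blast
  have "bounded (\<phi> ` K)"
    using K(1) test_function_continuous[OF assms]
    by (intro compact_imp_bounded compact_continuous_image) (auto intro: continuous_on_subset)
  then obtain C where "\<And>x. x \<in> K \<Longrightarrow> norm (\<phi> x) \<le> C" "C > 0"
    by (auto simp: bounded_pos)
  then show thesis using that[of C] K(3) by (metis abs_zero less_imp_le real_norm_def)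
qed

lemma test_function_integrable:
  assumes "\<phi> \<in> test_functions \<Omega>"
  shows "integrable lborel \<phi>"
proof -
  obtain K where K: "compact K" "K \<subseteq> \<Omega>" "\<And>x. x \<notin> K \<Longrightarrow> \<phi> x = 0"
    using test_function_support[OF assms] by blast
  have "integrable lborel (\<lambda>x. indicator K x *\<^sub>R \<phi> x)"
    using K(1) test_function_continuous[OF assms]
    by (intro borel_integrable_compact) (auto intro: continuous_on_subset)
  moreover have "(\<lambda>x. indicator K x *\<^sub>R \<phi> x) = \<phi>"
    by (rule ext) (use K(3) in \<open>auto simp: indicator_def\<close>)
  ultimately show ?thesis by simp
qed

section \<open>Difference quotients and translation invariance\<close>

lemma integral_lborel_translate:
  fixes f :: "real^3 \<Rightarrow> real"
  assumes "f \<in> borel_measurable borel"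
  shows "(\<integral>x. f (x + c) \<partial>lborel) = (\<integral>x. f x \<partial>lborel)"
proof -
  have "(\<integral>x. f x \<partial>lborel) = (\<integral>x. f x \<partial>distr lborel borel ((+) c))"
    by (simp add: lborel_distr_plus)
  also have "\<dots> = (\<integral>x. f (c + x) \<partial>lborel)"
    by (rule integral_distr) (use assms in auto)
  finally show ?thesis by (simp add: add.commute)
qed

lemma difference_quotient_tendsto:
  assumes "f differentiable (at x)" "h \<longlonglongrightarrow> 0" "\<And>n. h n \<noteq> 0"
  shows "(\<lambda>n. (f (x + h n *\<^sub>R axis i 1) - f x) / h n) \<longlonglongrightarrow> partial i f x"
proof -
  have "((\<lambda>t. x + t *\<^sub>R axis i 1) has_derivative (\<lambda>t. t *\<^sub>R axis i 1)) (at (0::real))"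
    by (auto intro!: derivative_eq_intros)
  moreover have "(f has_derivative frechet_derivative f (at x)) (at (x + 0 *\<^sub>R axis i 1))"
    using has_derivative_frechet[OF assms(1)] by simp
  ultimately have "((\<lambda>t. f (x + t *\<^sub>R axis i 1)) has_derivative
      (\<lambda>t. frechet_derivative f (at x) (t *\<^sub>R axis i 1))) (at (0::real))"
    by (rule has_derivative_compose)
  moreover have "frechet_derivative f (at x) (t *\<^sub>R axis i 1) = partial i f x * t" for t
    using linear_frechet_derivative[OF assms(1)] by (simp add: partial_def linear_cmul)
  ultimately have "((\<lambda>t. f (x + t *\<^sub>R axis i 1)) has_field_derivative partial i f x) (at 0)"
    by (simp add: has_field_derivative_def)
  then have "(\<lambda>t. (f (x + t *\<^sub>R axis i 1) - f x) / t) \<midarrow>0\<rightarrow> partial i f x"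
    by (simp add: DERIV_def)
  then show ?thesis
    by (rule filterlim_compose) (use assms(2,3) in \<open>simp add: filterlim_at\<close>)
qed

lemma difference_quotient_bound:
  assumes "\<And>x. f differentiable (at x)" "\<And>x. \<bar>partial i f x\<bar> \<le> C" "h \<noteq> 0"
  shows "\<bar>(f (x + h *\<^sub>R axis i 1) - f x) / h\<bar> \<le> C"
proof -
  define g where "g t = f (x + t *\<^sub>R axis i 1)" for t
  have g: "(g has_field_derivative partial i f (x + t *\<^sub>R axis i 1)) (at t)" for t
  proof -
    have "((\<lambda>t. x + t *\<^sub>R axis i 1) has_derivative (\<lambda>t. t *\<^sub>R axis i 1)) (at t)"
      by (auto intro!: derivative_eq_intros)
    from has_derivative_compose[OF this has_derivative_frechet[OF assms(1)]]
    have "((\<lambda>t. f (x + t *\<^sub>R axis i 1)) has_derivative (\<lambda>s. frechet_derivative f (at (x + t *\<^sub>R axis i 1)) (s *\<^sub>R axis i 1))) (at t)" .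
    moreover have "frechet_derivative f (at (x + t *\<^sub>R axis i 1)) (s *\<^sub>R axis i 1)
        = partial i f (x + t *\<^sub>R axis i 1) * s" for s
      using linear_frechet_derivative[OF assms(1)] by (simp add: partial_def linear_cmul)
    ultimately show ?thesis by (simp add: has_field_derivative_def g_def[abs_def])
  qed
  have "norm (g h - g 0) \<le> C * norm (h - 0)"
    by (rule field_differentiable_bound[where S=UNIV and f'="\<lambda>t. partial i f (x + t *\<^sub>R axis i 1)"])
      (use assms(2) g in auto)
  then show ?thesis using assms(3) by (simp add: g_def abs_divide field_simps)
qed

lemma difference_quotient_support:
  fixes f :: "real^3 \<Rightarrow> real"
  assumes "\<And>x. R < norm x \<Longrightarrow> f x = 0" "\<bar>h\<bar> \<le> 1" "R + 1 < norm x"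
  shows "f (x + h *\<^sub>R axis i 1) - f x = 0"
proof -
  have "norm x \<le> norm (x + h *\<^sub>R axis i 1) + norm (h *\<^sub>R axis i (1::real))"
    using norm_triangle_ineq4[of "x + h *\<^sub>R axis i 1" "h *\<^sub>R axis i 1"] by (simp only: add_diff_cancel)
  then show ?thesis using assms(1)[of x] assms(1)[of "x + h *\<^sub>R axis i 1"] assms(2,3)
    by (simp add: norm_axis_1)
qed

text \<open>Supplies an integrable majorant for dominated convergence, uniform in the step and the
  direction. The mean value theorem bounds the quotient, and a step of length at most 1 enlarges the
  support by at most 1.\<close>

lemma test_function_difference_quotient:
  assumes "f \<in> test_functions \<Omega>"
  obtains C R where "C > 0" "\<And>x h i. h \<noteq> 0 \<Longrightarrow> \<bar>h\<bar> \<le> 1 \<Longrightarrow>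
    \<bar>(f (x + h *\<^sub>R axis i 1) - f x) / h\<bar> \<le> C * indicator (cball 0 R) x"
proof -
  have "\<exists>C>0. \<forall>x. \<bar>partial i f x\<bar> \<le> C" for i
    using test_function_bounded[OF test_function_partial[OF assms, of i]] by metis
  then obtain c where c: "\<And>i. c i > 0" "\<And>i x. \<bar>partial i f x\<bar> \<le> c i" by metis
  \<comment> \<open>The sum over the three directions serves as one bound for all of them.\<close>
  define C where "C = (\<Sum>i\<in>UNIV. c i)"
  have cC: "c i \<le> C" for i
    unfolding C_def by (intro member_le_sum) (auto intro: less_imp_le c)
  then have bound: "\<bar>partial i f x\<bar> \<le> C" for i x using c(2) order_trans by blast
  obtain K where K: "compact K" "K \<subseteq> \<Omega>" "\<And>x. x \<notin> K \<Longrightarrow> f x = 0"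
    using test_function_support[OF assms] by blast
  obtain R where R: "\<And>x. x \<in> K \<Longrightarrow> norm x \<le> R"
    using compact_imp_bounded[OF K(1)] by (auto simp: bounded_iff)
  have supp: "f x = 0" if "R < norm x" for x
    using K(3) R[of x] that by force
  show thesis
  proof (rule that)
    show "C > 0" using c(1)[of 1] cC[of 1] by simp
    fix x and h :: real and i assume h: "h \<noteq> 0" "\<bar>h\<bar> \<le> 1"
    show "\<bar>(f (x + h *\<^sub>R axis i 1) - f x) / h\<bar> \<le> C * indicator (cball 0 (R + 1)) x"
      using difference_quotient_bound[OF test_function_differentiable[OF assms] bound h(1), where x=x and i=i]
        difference_quotient_support[OF supp h(2), where x=x and i=i]
      by (cases "R + 1 < norm x") (auto simp: indicator_def)
  qed
qed

lemma integrable_indicator_cball: "integrable lborel (\<lambda>x::real^3. c * indicator (cball 0 R) x :: real)"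
  by (intro integrable_mult_right integrable_real_indicator emeasure_bounded_finite) auto

text \<open>The integral of each difference quotient vanishes by translation invariance, and
  dominated convergence passes this on to the derivative.\<close>

lemma integral_partial_eq_0:
  assumes "f \<in> test_functions \<Omega>"
  shows "(\<integral>x. partial i f x \<partial>lborel) = 0"
proof -
  obtain C R where CR: "\<And>x h i. h \<noteq> 0 \<Longrightarrow> \<bar>h\<bar> \<le> 1 \<Longrightarrow>
      \<bar>(f (x + h *\<^sub>R axis i 1) - f x) / h\<bar> \<le> C * indicator (cball 0 R) x"
    using test_function_difference_quotient[OF assms] by metis
  define h :: "nat \<Rightarrow> real" where "h n = inverse (Suc n)" for n
  have h: "h \<longlonglongrightarrow> 0" "h n \<noteq> 0" "\<bar>h n\<bar> \<le> 1" for n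
    using LIMSEQ_inverse_real_of_nat by (simp_all add: h_def[abs_def] inverse_le_1_iff del: of_nat_Suc)
  have [measurable]: "f \<in> borel_measurable borel" "partial i f \<in> borel_measurable borel"
    using assms by (auto intro: borel_measurable_continuous_onI test_function_continuous test_function_partial)
  have "(\<lambda>n. \<integral>x. (f (x + h n *\<^sub>R axis i 1) - f x) / h n \<partial>lborel) \<longlonglongrightarrow> (\<integral>x. partial i f x \<partial>lborel)"
  proof (rule integral_dominated_convergence[where w="\<lambda>x. C * indicator (cball 0 R) x"])
    show "integrable lborel (\<lambda>x::real^3. C * indicator (cball 0 R) x)"
      by (rule integrable_indicator_cball)
    show "AE x in lborel. (\<lambda>n. (f (x + h n *\<^sub>R axis i 1) - f x) / h n) \<longlonglongrightarrow> partial i f x"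
      using difference_quotient_tendsto[OF test_function_differentiable[OF assms] h(1,2)] by simp
  qed (use CR h in auto)
  moreover have "(\<integral>x. (f (x + h n *\<^sub>R axis i 1) - f x) / h n \<partial>lborel) = 0" for n
  proof -
    have i: "integrable lborel f" by (rule test_function_integrable[OF assms])
    have "integrable (distr lborel borel ((+) (h n *\<^sub>R axis i 1))) f"
      using i by (simp add: lborel_distr_plus)
    then have "integrable lborel (\<lambda>x. f (x + h n *\<^sub>R axis i 1))"
      by (subst (asm) integrable_distr_eq) (auto simp: add.commute)
    with i show ?thesis by (simp add: integral_lborel_translate)
  qed
  ultimately have "(\<lambda>n. 0) \<longlonglongrightarrow> (\<integral>x. partial i f x \<partial>lborel)" by (simp only:)
  then show ?thesis by (simp add: LIMSEQ_const_iff)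
qed

text \<open>Both sides are limits of integrals of products of difference quotients, which agree by
  translation invariance.\<close>

lemma integral_partial_swap:
  assumes "f \<in> test_functions \<Omega>" "g \<in> test_functions \<Omega>"
  shows "(\<integral>x. partial i f x * partial j g x \<partial>lborel) = (\<integral>x. partial j f x * partial i g x \<partial>lborel)"
proof -
  obtain C R where CR: "C > 0" "\<And>x h i. h \<noteq> 0 \<Longrightarrow> \<bar>h\<bar> \<le> 1 \<Longrightarrow>
      \<bar>(f (x + h *\<^sub>R axis i 1) - f x) / h\<bar> \<le> C * indicator (cball 0 R) x"
    using test_function_difference_quotient[OF assms(1)] by metis
  obtain C' R' where CR': "C' > 0" "\<And>x h i. h \<noteq> 0 \<Longrightarrow> \<bar>h\<bar> \<le> 1 \<Longrightarrow>
      \<bar>(g (x + h *\<^sub>R axis i 1) - g x) / h\<bar> \<le> C' * indicator (cball 0 R') x"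
    using test_function_difference_quotient[OF assms(2)] by metis
  define h :: "nat \<Rightarrow> real" where "h n = inverse (Suc n)" for n
  have h: "h \<longlonglongrightarrow> 0" "(\<lambda>n. - h n) \<longlonglongrightarrow> 0" "h n \<noteq> 0" "- h n \<noteq> 0" "\<bar>h n\<bar> \<le> 1" "\<bar>- h n\<bar> \<le> 1" for n
    using LIMSEQ_inverse_real_of_nat tendsto_minus[OF LIMSEQ_inverse_real_of_nat]
    by (simp_all add: h_def[abs_def] inverse_le_1_iff del: of_nat_Suc)
  have [measurable]: "f \<in> borel_measurable borel" "partial i f \<in> borel_measurable borel"
     "g \<in> borel_measurable borel" "partial i g \<in> borel_measurable borel" for i
    using assms by (auto intro: borel_measurable_continuous_onI test_function_continuous test_function_partial)
  define q where "q s i f x = (f (x + s *\<^sub>R axis i 1) - f x) / s" for s i and f :: "real^3 \<Rightarrow> real" and x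
  have lim: "(\<lambda>n. \<integral>x. q (s n) i f x * q (s n) j g x \<partial>lborel) \<longlonglongrightarrow> (\<integral>x. partial i f x * partial j g x \<partial>lborel)"
    if s: "s \<longlonglongrightarrow> 0" "\<And>n. s n \<noteq> 0" "\<And>n. \<bar>s n\<bar> \<le> 1" for s i j
  proof (rule integral_dominated_convergence[where w="\<lambda>x. (C * C') * indicator (cball 0 R) x"])
    show "(\<lambda>x. partial i f x * partial j g x) \<in> borel_measurable lborel"
      "\<And>n. (\<lambda>x. q (s n) i f x * q (s n) j g x) \<in> borel_measurable lborel"
      unfolding q_def by measurable
    show "integrable lborel (\<lambda>x::real^3. (C * C') * indicator (cball 0 R) x)"
      by (rule integrable_indicator_cball)
    show "AE x in lborel. (\<lambda>n. q (s n) i f x * q (s n) j g x) \<longlonglongrightarrow> partial i f x * partial j g x"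
      unfolding q_def using assms s
      by (intro AE_I2 tendsto_mult difference_quotient_tendsto) (auto intro: test_function_differentiable)
    show "AE x in lborel. norm (q (s n) i f x * q (s n) j g x) \<le> (C * C') * indicator (cball 0 R) x" for n
    proof (rule AE_I2)
      fix x
      have "\<bar>q (s n) i f x\<bar> \<le> C * indicator (cball 0 R) x"
        using CR(2)[OF s(2,3), where x=x and i=i] by (simp only: q_def)
      moreover have "\<bar>q (s n) j g x\<bar> \<le> C' * indicator (cball 0 R') x"
        using CR'(2)[OF s(2,3), where x=x and i=j] by (simp only: q_def)
      \<comment> \<open>The factor coming from \<open>f\<close> already confines the product to a
        ball, so only boundedness is kept of the other one.\<close>
      moreover have "C' * indicator (cball 0 R') x \<le> C'"
        using CR'(1) by (simp add: indicator_def)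
      ultimately have "\<bar>q (s n) i f x\<bar> * \<bar>q (s n) j g x\<bar> \<le> (C * indicator (cball 0 R) x) * C'"
        using CR(1) by (intro mult_mono) auto
      then show "norm (q (s n) i f x * q (s n) j g x) \<le> (C * C') * indicator (cball 0 R) x"
        by (simp add: abs_mult mult_ac)
    qed
  qed
  have int: "integrable lborel (\<lambda>x. f (x + a) * g (x + b))" for a b
  proof -
    obtain B where B: "\<And>x. \<bar>g x\<bar> \<le> B" using test_function_bounded[OF assms(2)] by metis
    have "integrable (distr lborel borel ((+) a)) f"
      using test_function_integrable[OF assms(1)] by (simp add: lborel_distr_plus)
    then have "integrable lborel (\<lambda>x. B * f (x + a))"
      by (subst (asm) integrable_distr_eq) (auto simp: add.commute)
    then show ?thesis
    proof (rule Bochner_Integration.integrable_bound)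
      have "\<bar>f (x + a)\<bar> * \<bar>g (x + b)\<bar> \<le> \<bar>f (x + a)\<bar> * \<bar>B\<bar>" for x
        using B[of "x + b"] by (intro mult_left_mono) auto
      then show "AE x in lborel. norm (f (x + a) * g (x + b)) \<le> norm (B * f (x + a))"
        by (simp add: abs_mult mult.commute)
    qed measurable
  qed
  have eq: "(\<integral>x. q s i f x * q s j g x \<partial>lborel) = (\<integral>x. q (-s) j f x * q (-s) i g x \<partial>lborel)"
    if "s \<noteq> 0" for s
  proof -
    define a b where "a = s *\<^sub>R axis i (1::real)" and "b = s *\<^sub>R axis j (1::real)"
    define I where "I a b = (\<integral>x. f (x + a) * g (x + b) \<partial>lborel)" for a b
    have shift: "I (a + c) (b + c) = I a b" for a b c
      unfolding I_def using integral_lborel_translate[of "\<lambda>x. f (x + a) * g (x + b)" c]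
      by (simp add: add_ac)
    have expand: "(\<integral>x. (f (x + a) - f x) * (g (x + b) - g x) \<partial>lborel) = I a b - I a 0 - I 0 b + I 0 0" for a b
    proof -
      have "(f (x + a) - f x) * (g (x + b) - g x) =
          f (x + a) * g (x + b) - f (x + a) * g (x + 0) - f (x + 0) * g (x + b) + f (x + 0) * g (x + 0)" for x
        by (simp add: algebra_simps)
      then show ?thesis unfolding I_def by (simp only:) (simp add: int del: add_0_right)
    qed
    \<comment> \<open>Translation by \<open>- a - b\<close> turns the shifts \<open>a, b\<close>
      into \<open>- b, - a\<close>: the directions are exchanged at the price of a reversed step,
      which disappears in the limit because both \<open>h\<close> and its negative tend to
      0.\<close>
    have "I a b = I (- b) (- a)" "I a 0 = I 0 (- a)" "I 0 b = I (- b) 0"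
      using shift[of a "- a - b" b] shift[of a "- a" 0] shift[of 0 "- b" b] by simp_all
    then have "(\<integral>x. (f (x + a) - f x) * (g (x + b) - g x) \<partial>lborel)
        = (\<integral>x. (f (x + - b) - f x) * (g (x + - a) - g x) \<partial>lborel)"
      unfolding expand by simp
    moreover have "q s i f x * q s j g x = inverse (s * s) * ((f (x + a) - f x) * (g (x + b) - g x))"
      "q (-s) j f x * q (-s) i g x = inverse (s * s) * ((f (x + - b) - f x) * (g (x + - a) - g x))" for x
      by (simp_all add: q_def a_def b_def field_simps)
    ultimately show ?thesis by (simp del: minus_add_distrib add_uminus_conv_diff)
  qed
  show ?thesis
    using LIMSEQ_unique[OF lim[OF h(2,4,6), of j i]] lim[OF h(1,3,5), of i j] eq h(3) by simp
qed

section \<open>Integration by parts and a Poincare inequality\<close>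

locale bounded_open_domain =
  fixes \<Omega> :: "(real^3) set"
  assumes open_domain: "open \<Omega>" and bounded_domain: "bounded \<Omega>"
begin

lemma lmeasurable_domain: "\<Omega> \<in> lmeasurable"
  by (rule lmeasurable_open[OF bounded_domain open_domain])

text \<open>Moves from the restricted Lebesgue measure of the definitions to \<open>lborel\<close>,
  where the translation arguments live.\<close>

lemma integral_domain:
  fixes f :: "real^3 \<Rightarrow> real"
  assumes "f \<in> borel_measurable borel" "\<And>x. x \<notin> \<Omega> \<Longrightarrow> f x = 0"
  shows "(\<integral>x. f x \<partial>lebesgue_on \<Omega>) = (\<integral>x. f x \<partial>lborel)"
proof -
  have "(\<integral>x. f x \<partial>lebesgue_on \<Omega>) = (\<integral>x. indicator \<Omega> x *\<^sub>R f x \<partial>lebesgue)"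
    using lmeasurable_domain by (intro integral_restrict_space) (auto dest: fmeasurableD)
  also have "(\<lambda>x. indicator \<Omega> x *\<^sub>R f x) = f"
    by (rule ext) (use assms(2) in \<open>auto simp: indicator_def\<close>)
  also have "(\<integral>x. f x \<partial>lebesgue) = (\<integral>x. f x \<partial>lborel)"
    using assms(1) by (intro integral_completion) simp
  finally show ?thesis .
qed

lemma test_function_zero_outside: "\<phi> \<in> test_functions \<Omega> \<Longrightarrow> x \<notin> \<Omega> \<Longrightarrow> \<phi> x = 0"
  using test_function_support[of \<phi> \<Omega>] by blast

lemma test_function_measurable: "\<phi> \<in> test_functions \<Omega> \<Longrightarrow> \<phi> \<in> borel_measurable borel"
  by (rule borel_measurable_continuous_onI[OF test_function_continuous])

lemma integral_test_function:
  "\<phi> \<in> test_functions \<Omega> \<Longrightarrow> (\<integral>x. \<phi> x \<partial>lebesgue_on \<Omega>) = (\<integral>x. \<phi> x \<partial>lborel)"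
  by (rule integral_domain) (auto intro: test_function_measurable test_function_zero_outside)

lemma test_function_L2:
  assumes "\<phi> \<in> test_functions \<Omega>"
  shows "\<phi> \<in> L2 \<Omega>"
proof -
  obtain C where C: "\<And>x. \<bar>\<phi> x\<bar> \<le> C"
    using test_function_bounded[OF assms] by blast
  have "\<phi> \<in> borel_measurable (lebesgue_on \<Omega>)"
    using continuous_on_subset[OF test_function_continuous[OF assms], of \<Omega>] lmeasurable_domain
    by (intro continuous_imp_measurable_on_sets_lebesgue) auto
  then show ?thesis
    using C by (intro L2_if_bounded[OF lmeasurable_domain, of _ C]) auto
qed

section \<open>Test fields and their divergence, curl and gradient\<close>

lemma test_field_component: "\<phi> \<in> test_fields \<Omega> \<Longrightarrow> (\<lambda>x. \<phi> x $ i) \<in> test_functions \<Omega>"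
  by (simp add: test_fields_def)

lemma test_field_L2:
  assumes "\<phi> \<in> test_fields \<Omega>"
  shows "\<phi> \<in> L2 \<Omega>"
proof -
  have "continuous_on UNIV (\<lambda>x. \<chi> i. \<phi> x $ i)"
    using test_function_continuous[OF test_field_component[OF assms]]
    by (intro continuous_on_vec_lambda) blast
  then have "\<phi> \<in> borel_measurable (lebesgue_on \<Omega>)"
    using continuous_on_subset[of UNIV \<phi> \<Omega>] lmeasurable_domain
    by (intro continuous_imp_measurable_on_sets_lebesgue) auto
  moreover have "\<exists>C. \<forall>x. \<bar>\<phi> x $ i\<bar> \<le> C" for i
    using test_function_bounded[OF test_field_component[OF assms, of i]] by blast
  then obtain C where C: "\<And>i x. \<bar>\<phi> x $ i\<bar> \<le> C i" by metis
  have "norm (\<phi> x) \<le> (\<Sum>i\<in>UNIV. C i)" for x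
    by (rule order_trans[OF norm_le_l1_cart]) (intro sum_mono C)
  ultimately show ?thesis by (intro L2_if_bounded[OF lmeasurable_domain])
qed

lemma test_field_zero: "(\<lambda>x. 0) \<in> test_fields \<Omega>"
  by (simp add: test_fields_def test_function_zero)

lemma test_field_add: "\<phi> \<in> test_fields \<Omega> \<Longrightarrow> \<psi> \<in> test_fields \<Omega> \<Longrightarrow> (\<lambda>x. \<phi> x + \<psi> x) \<in> test_fields \<Omega>"
  by (simp add: test_fields_def test_function_add)

lemma test_field_scaleR: "\<phi> \<in> test_fields \<Omega> \<Longrightarrow> (\<lambda>x. c *\<^sub>R \<phi> x) \<in> test_fields \<Omega>"
  using test_function_mult[of "\<lambda>x. c"] by (simp add: test_fields_def Ck_const)

text \<open>Lets a scalar test function probe a single component of a vector field.\<close>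

lemma test_field_axis:
  assumes "\<psi> \<in> test_functions \<Omega>"
  shows "(\<lambda>x. axis i (\<psi> x)) \<in> test_fields \<Omega>"
proof -
  have "(\<lambda>x. axis i (\<psi> x) $ j) = (if j = i then \<psi> else (\<lambda>x. 0))" for j
    by (simp add: axis_def fun_eq_iff)
  then show ?thesis using assms by (simp add: test_fields_def test_function_zero)
qed

lemma test_field_differentiable:
  "\<phi> \<in> test_fields \<Omega> \<Longrightarrow> (\<lambda>x. \<phi> x $ i) differentiable (at x)"
  by (rule test_function_differentiable[OF test_field_component])

lemma partial_test_field:
  "\<phi> \<in> test_fields \<Omega> \<Longrightarrow> partial i (\<lambda>x. \<phi> x $ j) \<in> test_functions \<Omega>"
  by (intro test_function_partial test_field_component)

lemma div_field_test:
  assumes "\<phi> \<in> test_fields \<Omega>"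
  shows "div_field \<phi> \<in> test_functions \<Omega>"
  unfolding div_field_def[abs_def] sum_3
  by (intro test_function_add partial_test_field assms)

lemma curl_field_test:
  assumes "\<phi> \<in> test_fields \<Omega>"
  shows "curl_field \<phi> \<in> test_fields \<Omega>"
  unfolding test_fields_def mem_Collect_eq forall_3 curl_field_def[abs_def] vector_3
  by (intro conjI test_function_diff partial_test_field assms)

lemma div_field_add:
  "\<phi> \<in> test_fields \<Omega> \<Longrightarrow> \<psi> \<in> test_fields \<Omega> \<Longrightarrow>
    div_field (\<lambda>x. \<phi> x + \<psi> x) = (\<lambda>x. div_field \<phi> x + div_field \<psi> x)"
  by (rule ext) (simp add: div_field_def partial_add test_field_differentiable sum.distrib)

lemma div_field_scaleR:
  "\<phi> \<in> test_fields \<Omega> \<Longrightarrow> div_field (\<lambda>x. c *\<^sub>R \<phi> x) = (\<lambda>x. c *\<^sub>R div_field \<phi> x)"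
  by (rule ext) (simp add: div_field_def partial_cmult test_field_differentiable sum_distrib_left)

lemma curl_field_add:
  "\<phi> \<in> test_fields \<Omega> \<Longrightarrow> \<psi> \<in> test_fields \<Omega> \<Longrightarrow>
    curl_field (\<lambda>x. \<phi> x + \<psi> x) = (\<lambda>x. curl_field \<phi> x + curl_field \<psi> x)"
  by (rule ext) (simp add: curl_field_def vec_eq_iff forall_3 partial_add test_field_differentiable)

lemma curl_field_scaleR:
  "\<phi> \<in> test_fields \<Omega> \<Longrightarrow> curl_field (\<lambda>x. c *\<^sub>R \<phi> x) = (\<lambda>x. c *\<^sub>R curl_field \<phi> x)"
  by (rule ext)
    (simp add: curl_field_def vec_eq_iff forall_3 partial_cmult test_field_differentiable right_diff_distrib)

lemma grad_component: "(\<lambda>x. grad \<psi> x $ i) = partial i \<psi>"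
  by (simp add: grad_def)

lemma grad_test:
  assumes "\<psi> \<in> test_functions \<Omega>"
  shows "grad \<psi> \<in> test_fields \<Omega>"
  unfolding test_fields_def mem_Collect_eq grad_component
  by (intro allI test_function_partial assms)

lemma integrable_test_mult:
  "\<phi> \<in> test_functions \<Omega> \<Longrightarrow> \<psi> \<in> test_functions \<Omega> \<Longrightarrow> integrable lborel (\<lambda>x. \<phi> x * \<psi> x)"
  by (rule test_function_integrable[OF test_function_mult[OF test_function_Ck]])

lemma L2_inner_test:
  assumes "\<phi> \<in> test_functions \<Omega>" "\<psi> \<in> test_functions \<Omega>"
  shows "L2_inner \<Omega> \<phi> \<psi> = (\<integral>x. \<phi> x * \<psi> x \<partial>lborel)"
  using integral_test_function[OF test_function_mult[OF test_function_Ck[OF assms(1)] assms(2)]]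
  by (simp add: L2_inner_def)

lemma L2_inner_test_fields:
  assumes "\<phi> \<in> test_fields \<Omega>" "\<psi> \<in> test_fields \<Omega>"
  shows "L2_inner \<Omega> \<phi> \<psi> = (\<Sum>i\<in>UNIV. \<integral>x. \<phi> x $ i * \<psi> x $ i \<partial>lborel)"
proof -
  have "L2_inner \<Omega> \<phi> \<psi> = (\<integral>x. (\<Sum>i\<in>UNIV. \<phi> x $ i * \<psi> x $ i) \<partial>lebesgue_on \<Omega>)"
    by (simp add: L2_inner_def inner_vec_def)
  also have "\<dots> = (\<Sum>i\<in>UNIV. \<integral>x. \<phi> x $ i * \<psi> x $ i \<partial>lebesgue_on \<Omega>)"
    using L2_inner_integrable[OF test_function_L2[OF test_field_component[OF assms(1)]]
        test_function_L2[OF test_field_component[OF assms(2)]]]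
    by (intro Bochner_Integration.integral_sum) simp
  also have "\<dots> = (\<Sum>i\<in>UNIV. \<integral>x. \<phi> x $ i * \<psi> x $ i \<partial>lborel)"
    using L2_inner_test[OF test_field_component[OF assms(1)] test_field_component[OF assms(2)]]
    by (intro sum.cong) (auto simp: L2_inner_def)
  finally show ?thesis .
qed

lemma integration_by_parts:
  assumes "\<phi> \<in> test_functions \<Omega>" "\<psi> \<in> test_functions \<Omega>"
  shows "(\<integral>x. partial i \<phi> x * \<psi> x \<partial>lborel) = - (\<integral>x. \<phi> x * partial i \<psi> x \<partial>lborel)"
proof -
  have "(\<lambda>x. \<phi> x * \<psi> x) \<in> test_functions \<Omega>"
    by (rule test_function_mult[OF test_function_Ck[OF assms(1)] assms(2)])
  from integral_partial_eq_0[OF this, of i]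
  have "(\<integral>x. \<phi> x * partial i \<psi> x + partial i \<phi> x * \<psi> x \<partial>lborel) = 0"
    using assms by (simp add: partial_mult test_function_differentiable)
  then show ?thesis
    using assms by (simp add: integrable_test_mult test_function_partial)
qed

lemma div_field_integration_by_parts:
  assumes "\<phi> \<in> test_fields \<Omega>" "\<psi> \<in> test_functions \<Omega>"
  shows "L2_inner \<Omega> (div_field \<phi>) \<psi> = - L2_inner \<Omega> \<phi> (grad \<psi>)"
proof -
  have "L2_inner \<Omega> (div_field \<phi>) \<psi> = (\<integral>x. (\<Sum>i\<in>UNIV. partial i (\<lambda>y. \<phi> y $ i) x * \<psi> x) \<partial>lborel)"
    by (subst L2_inner_test[OF div_field_test[OF assms(1)] assms(2)])
      (simp add: div_field_def sum_distrib_right)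
  also have "\<dots> = (\<Sum>i\<in>UNIV. \<integral>x. partial i (\<lambda>y. \<phi> y $ i) x * \<psi> x \<partial>lborel)"
    using integrable_test_mult[OF partial_test_field[OF assms(1)] assms(2)]
    by (intro Bochner_Integration.integral_sum) simp
  also have "\<dots> = (\<Sum>i\<in>UNIV. - (\<integral>x. \<phi> x $ i * partial i \<psi> x \<partial>lborel))"
    by (intro sum.cong refl integration_by_parts test_field_component assms)
  also have "\<dots> = - L2_inner \<Omega> \<phi> (grad \<psi>)"
    by (subst L2_inner_test_fields[OF assms(1) grad_test[OF assms(2)]]) (simp add: grad_def sum_negf)
  finally show ?thesis .
qed

text \<open>The derivative of \<open>x $ i * (\<phi> x)\<^sup>2\<close> in direction
  \<open>i\<close> is the square of \<open>\<phi>\<close> plus a cross term, and it integrates to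
  zero. Young's inequality absorbs half of the square; removing the factor 1/2 gives the constant
  \<open>4 * R\<^sup>2\<close>.\<close>

lemma Poincare_partial:
  assumes "\<phi> \<in> test_functions \<Omega>" "\<And>x. x \<in> \<Omega> \<Longrightarrow> norm x \<le> R"
  shows "(\<integral>x. \<phi> x * \<phi> x \<partial>lborel) \<le> 4 * R\<^sup>2 * (\<integral>x. partial i \<phi> x * partial i \<phi> x \<partial>lborel)"
proof -
  have sq: "(\<lambda>x. \<phi> x * \<phi> x) \<in> test_functions \<Omega>"
    by (rule test_function_mult[OF test_function_Ck[OF assms(1)] assms(1)])
  have t: "(\<lambda>x. x $ i * (\<phi> x * \<phi> x)) \<in> test_functions \<Omega>"
    by (rule test_function_mult[OF Ck_coordinate sq])
  have p: "partial i (\<lambda>x. x $ i * (\<phi> x * \<phi> x)) x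
      = x $ i * (\<phi> x * partial i \<phi> x + partial i \<phi> x * \<phi> x) + \<phi> x * \<phi> x" for x
    unfolding partial_mult[OF bounded_linear_imp_differentiable[OF bounded_linear_vec_nth]
        test_function_differentiable[OF sq]]
      partial_mult[OF test_function_differentiable[OF assms(1)] test_function_differentiable[OF assms(1)]]
    by (simp add: partial_coordinate)
  have le: "(1/2) * (\<phi> x * \<phi> x) \<le> partial i (\<lambda>x. x $ i * (\<phi> x * \<phi> x)) x
      + 2 * R\<^sup>2 * (partial i \<phi> x * partial i \<phi> x)" for x
  proof (cases "x \<in> \<Omega>")
    case True
    then have "\<bar>x $ i\<bar> \<le> R" using assms(2) component_le_norm_cart order_trans by blast
    then have "(x $ i)\<^sup>2 \<le> R\<^sup>2" by (metis abs_ge_zero power2_abs power_mono)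
    then have "2 * (x $ i)\<^sup>2 * (partial i \<phi> x)\<^sup>2 \<le> 2 * R\<^sup>2 * (partial i \<phi> x)\<^sup>2"
      by (intro mult_right_mono) auto
    \<comment> \<open>Half of this square is Young's inequality for the cross term.\<close>
    moreover have "0 \<le> (\<phi> x + 2 * (x $ i) * partial i \<phi> x)\<^sup>2" by simp
    ultimately show ?thesis unfolding p by (simp add: power2_eq_square algebra_simps)
  next
    case False
    then show ?thesis using test_function_zero_outside[OF assms(1)] by (simp add: p)
  qed
  have "(\<integral>x. (1/2) * (\<phi> x * \<phi> x) \<partial>lborel) \<le> (\<integral>x. partial i (\<lambda>x. x $ i * (\<phi> x * \<phi> x)) x
      + 2 * R\<^sup>2 * (partial i \<phi> x * partial i \<phi> x) \<partial>lborel)"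
    using le by (intro integral_mono integrable_mult_right Bochner_Integration.integrable_add
        integrable_test_mult assms(1) test_function_integrable[OF test_function_partial[OF t]] test_function_partial)
  also have "\<dots> = 2 * R\<^sup>2 * (\<integral>x. partial i \<phi> x * partial i \<phi> x \<partial>lborel)"
    using integral_partial_eq_0[OF t, of i] test_function_integrable[OF test_function_partial[OF t], of i]
      integrable_test_mult[OF test_function_partial[OF assms(1)] test_function_partial[OF assms(1)], of i i]
    by simp
  finally show ?thesis by simp
qed

text \<open>The mixed terms in \<open>|curl \<phi>|\<^sup>2 + (div \<phi>)\<^sup>2\<close> integrate to zero.\<close>

lemma gradient_energy:
  assumes "\<phi> \<in> test_fields \<Omega>"
  shows "L2_inner \<Omega> (curl_field \<phi>) (curl_field \<phi>) + L2_inner \<Omega> (div_field \<phi>) (div_field \<phi>)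
    = (\<Sum>j\<in>UNIV. \<Sum>i\<in>UNIV. \<integral>x. partial i (\<lambda>y. \<phi> y $ j) x * partial i (\<lambda>y. \<phi> y $ j) x \<partial>lborel)"
proof -
  define D where "D i j = partial i (\<lambda>y. \<phi> y $ j)" for i j
  define I where "I i j k l = (\<integral>x. D i j x * D k l x \<partial>lborel)" for i j k l
  have int: "integrable lborel (\<lambda>x. D i j x * D k l x)" for i j k l
    unfolding D_def by (intro integrable_test_mult partial_test_field assms)
  have swap: "I i i j j = I j i i j" for i j
    unfolding I_def D_def
    by (rule integral_partial_swap[of _ \<Omega>]) (rule test_field_component[OF assms])+
  have sym: "I i j k l = I k l i j" for i j k l
    by (simp add: I_def mult.commute)
  have diff: "(\<integral>x. (D i j x - D j i x) * (D i j x - D j i x) \<partial>lborel) = I i j i j - 2 * I i j j i + I j i j i" for i j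
  proof -
    have "(D i j x - D j i x) * (D i j x - D j i x)
        = D i j x * D i j x - 2 * (D i j x * D j i x) + D j i x * D j i x" for x
      by (simp add: algebra_simps)
    then show ?thesis by (simp add: I_def int)
  qed
  have curl: "L2_inner \<Omega> (curl_field \<phi>) (curl_field \<phi>)
      = (I 2 3 2 3 - 2 * I 2 3 3 2 + I 3 2 3 2) + (I 3 1 3 1 - 2 * I 3 1 1 3 + I 1 3 1 3)
        + (I 1 2 1 2 - 2 * I 1 2 2 1 + I 2 1 2 1)"
    by (subst L2_inner_test_fields[OF curl_field_test curl_field_test, OF assms assms])
      (simp only: sum_3 curl_field_def vector_3 D_def[symmetric] diff)
  have "(D 1 1 x + D 2 2 x + D 3 3 x) * (D 1 1 x + D 2 2 x + D 3 3 x)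
      = D 1 1 x * D 1 1 x + D 2 2 x * D 2 2 x + D 3 3 x * D 3 3 x
        + 2 * (D 1 1 x * D 2 2 x) + 2 * (D 1 1 x * D 3 3 x) + 2 * (D 2 2 x * D 3 3 x)" for x
    by (simp add: algebra_simps)
  then have div: "L2_inner \<Omega> (div_field \<phi>) (div_field \<phi>)
      = I 1 1 1 1 + I 2 2 2 2 + I 3 3 3 3 + 2 * I 1 1 2 2 + 2 * I 1 1 3 3 + 2 * I 2 2 3 3"
    by (subst L2_inner_test[OF div_field_test div_field_test, OF assms assms])
      (simp add: div_field_def sum_3 D_def[symmetric] I_def int)
  show ?thesis
    unfolding curl div D_def[symmetric] I_def[symmetric] sum_3
    using swap[of 1 2] swap[of 1 3] swap[of 2 3] sym[of 1 2 2 1] sym[of 2 3 3 2] sym[of 1 3 3 1] by simp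
qed

text \<open>The componentwise estimate bounds a test field by its full gradient, whose energy
  \<open>gradient_energy\<close> rewrites in terms of curl and divergence.\<close>

lemma Poincare:
  obtains C where "C > 0" "\<And>\<phi>. \<phi> \<in> test_fields \<Omega> \<Longrightarrow> L2_inner \<Omega> \<phi> \<phi> \<le>
    C * (L2_inner \<Omega> (curl_field \<phi>) (curl_field \<phi>) + L2_inner \<Omega> (div_field \<phi>) (div_field \<phi>))"
proof -
  obtain R where R: "R > 0" "\<And>x. x \<in> \<Omega> \<Longrightarrow> norm x \<le> R"
    using bounded_domain by (auto simp: bounded_pos)
  show thesis
  proof (rule that[of "4 * R\<^sup>2"])
    fix \<phi> assume \<phi>: "\<phi> \<in> test_fields \<Omega>"
    define E where "E i j = (\<integral>x. partial i (\<lambda>y. \<phi> y $ j) x * partial i (\<lambda>y. \<phi> y $ j) x \<partial>lborel)" for i j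
    have E: "E i j \<ge> 0" for i j
      by (simp add: E_def)
    have "L2_inner \<Omega> \<phi> \<phi> = (\<Sum>j\<in>UNIV. \<integral>x. \<phi> x $ j * \<phi> x $ j \<partial>lborel)"
      by (rule L2_inner_test_fields[OF \<phi> \<phi>])
    also have "\<dots> \<le> (\<Sum>j\<in>UNIV. 4 * R\<^sup>2 * (\<Sum>i\<in>UNIV. E i j))"
    proof (rule sum_mono)
      fix j :: 3
      \<comment> \<open>A single direction suffices for each component; the non-negative energies of
        the other two are added only to complete the gradient.\<close>
      have "(\<integral>x. \<phi> x $ j * \<phi> x $ j \<partial>lborel) \<le> 4 * R\<^sup>2 * E 1 j"
        unfolding E_def by (rule Poincare_partial[OF test_field_component[OF \<phi>] R(2)])
      also have "\<dots> \<le> 4 * R\<^sup>2 * (\<Sum>i\<in>UNIV. E i j)"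
        by (intro mult_left_mono member_le_sum) (auto simp: E)
      finally show "(\<integral>x. \<phi> x $ j * \<phi> x $ j \<partial>lborel) \<le> 4 * R\<^sup>2 * (\<Sum>i\<in>UNIV. E i j)" .
    qed
    also have "\<dots> = 4 * R\<^sup>2 * (L2_inner \<Omega> (curl_field \<phi>) (curl_field \<phi>) + L2_inner \<Omega> (div_field \<phi>) (div_field \<phi>))"
      by (simp only: gradient_energy[OF \<phi>] E_def sum_distrib_left)
    finally show "L2_inner \<Omega> \<phi> \<phi> \<le>
        4 * R\<^sup>2 * (L2_inner \<Omega> (curl_field \<phi>) (curl_field \<phi>) + L2_inner \<Omega> (div_field \<phi>) (div_field \<phi>))" .
  qed (use R in simp)
qed

end

section \<open>Bump functions and the fundamental lemma\<close>

text \<open>Naming the derivatives of all orders at once makes the next derivative explicit, both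
  under affine substitution and in the passage to \<open>Ck\<close>.\<close>

definition smooth_real :: "(real \<Rightarrow> real) \<Rightarrow> bool" where
  "smooth_real g \<longleftrightarrow> (\<exists>D. D 0 = g \<and> (\<forall>k t. (D k has_real_derivative D (Suc k) t) (at t)))"

lemma smooth_real_affine:
  assumes "smooth_real g"
  shows "smooth_real (\<lambda>t. g (c * t + d))"
proof -
  obtain D where D: "D 0 = g" "\<And>k t. (D k has_real_derivative D (Suc k) t) (at t)"
    using assms by (auto simp: smooth_real_def)
  have "((\<lambda>t. c ^ k * D k (c * t + d)) has_real_derivative c ^ Suc k * D (Suc k) (c * t + d)) (at t)" for k t
  proof -
    have "((\<lambda>t. c * t + d) has_real_derivative c) (at t)"
      by (auto intro!: derivative_eq_intros)
    from DERIV_cmult[OF DERIV_chain2[OF D(2) this], of "c ^ k" k] show ?thesis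
      by (simp add: mult_ac)
  qed
  then show ?thesis
    unfolding smooth_real_def by (intro exI[of _ "\<lambda>k t. c ^ k * D k (c * t + d)"]) (simp add: D(1))
qed

lemma Ck_smooth_real_component:
  assumes "smooth_real g"
  shows "Ck k (\<lambda>x. g (x $ i))"
proof -
  obtain D where D: "D 0 = g" "\<And>k t. (D k has_real_derivative D (Suc k) t) (at t)"
    using assms by (auto simp: smooth_real_def)
  have der: "((\<lambda>x. D n (x $ i)) has_derivative (\<lambda>h. h $ i * D (Suc n) (x $ i))) (at x)" for n and x :: "real^3"
  proof -
    have "((\<lambda>x. x $ i) has_derivative (\<lambda>h. h $ i)) (at x)"
      by (rule bounded_linear_imp_has_derivative[OF bounded_linear_vec_nth])
    from has_derivative_compose[OF this D(2)[of n "x $ i", unfolded has_field_derivative_def]]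
    show ?thesis by (simp add: mult.commute)
  qed
  have partial: "partial j (\<lambda>x. D n (x $ i)) = (\<lambda>x. (if i = j then 1 else 0) * D (Suc n) (x $ i))" for j n
    by (rule ext) (simp add: partial_eqI[OF der] axis_def)
  \<comment> \<open>The order \<open>n\<close> must vary in the induction, since a partial
    derivative leads from \<open>D n\<close> to \<open>D (Suc n)\<close>.\<close>
  have "Ck k (\<lambda>x. D n (x $ i))" for n
  proof (induction k arbitrary: n)
    case 0
    then show ?case
      using has_derivative_continuous[OF der] by (simp add: continuous_on_eq_continuous_within)
  next
    case (Suc k)
    have "(\<lambda>x. D n (x $ i)) differentiable (at x)" for x
      using der by (rule differentiableI)
    then show ?case by (simp add: partial Ck_mult Ck_const Suc)
  qed
  from this[of 0] show ?thesis by (simp add: D(1))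
qed

text \<open>The classical smooth function that vanishes to infinite order at 0 without vanishing to
  the right of it.\<close>

definition flat :: "real \<Rightarrow> real" where
  "flat t = (if t > 0 then exp (- (1 / t)) else 0)"

text \<open>Evaluated at the reciprocal of a small positive number, this gives the one-sided
  derivatives at 0 of \<open>flat\<close> and of all its derivatives.\<close>

lemma poly_div_exp_tendsto_0: "((\<lambda>x::real. poly p x / exp x) \<longlongrightarrow> 0) at_top"
proof -
  have "((\<lambda>x::real. \<Sum>i\<le>degree p. coeff p i * (x ^ i / exp x)) \<longlongrightarrow> (\<Sum>i\<le>degree p. coeff p i * 0)) at_top"
    by (intro tendsto_sum tendsto_mult tendsto_const tendsto_power_div_exp_0)
  then show ?thesis by (simp add: poly_altdef sum_divide_distrib)
qed

text \<open>The derivatives of \<open>flat\<close> at \<open>t > 0\<close> are polynomials in \<open>1/t\<close> times \<open>exp (-1/t)\<close>.\<close>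

lemma smooth_real_flat: "smooth_real flat"
proof -
  \<comment> \<open>Differentiating \<open>poly q (1 / t) * exp (- (1 / t))\<close> produces the
    factor \<open>1 / t\<^sup>2\<close>, which is the polynomial \<open>[:0, 0, 1:]\<close> at
    \<open>1 / t\<close>, times \<open>q - pderiv q\<close>.\<close>
  define p :: "nat \<Rightarrow> real poly" where "p = rec_nat 1 (\<lambda>k q. [:0, 0, 1:] * (q - pderiv q))"
  define D where "D k t = (if t > 0 then poly (p k) (1 / t) * exp (- (1 / t)) else 0)" for k and t :: real
  have p0: "p 0 = 1" and pSuc: "p (Suc k) = [:0, 0, 1:] * (p k - pderiv (p k))" for k
    by (simp_all add: p_def)
  have "D 0 = flat"
    by (rule ext) (simp add: D_def flat_def p0)
  moreover have "(D k has_real_derivative D (Suc k) t) (at t)" for k t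
  proof -
    consider "t > 0" | "t < 0" | "t = 0" by linarith
    then show ?thesis
    proof cases
      case 1
      have "((\<lambda>t. poly (p k) (1 / t) * exp (- (1 / t))) has_real_derivative
          poly (p (Suc k)) (1 / t) * exp (- (1 / t))) (at t)"
        using 1 by (auto intro!: derivative_eq_intros DERIV_chain2[OF poly_DERIV] 
            simp: pSuc power2_eq_square algebra_simps)
      then have "(D k has_real_derivative poly (p (Suc k)) (1 / t) * exp (- (1 / t))) (at t)"
        by (rule has_field_derivative_transform_within_open[where S="{0<..}"]) (use 1 in \<open>auto simp: D_def\<close>)
      then show ?thesis using 1 by (simp add: D_def)
    next
      case 2
      have "((\<lambda>t. 0) has_real_derivative 0) (at t)" by simp
      then have "(D k has_real_derivative 0) (at t)"
        by (rule has_field_derivative_transform_within_open[where S="{..<0}"]) (use 2 in \<open>auto simp: D_def\<close>)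
      then show ?thesis using 2 by (simp add: D_def)
    next
      case 3
      have "((\<lambda>h. D k h / h) \<longlongrightarrow> 0) (at_right 0)"
      proof -
        \<comment> \<open>\<open>pCons 0\<close> multiplies the polynomial by its variable, here
          \<open>1 / h\<close>, which accounts for the division by \<open>h\<close>.\<close>
        have "((\<lambda>h::real. poly (pCons 0 (p k)) (inverse h) / exp (inverse h)) \<longlongrightarrow> 0) (at_right 0)"
          by (rule filterlim_compose[OF poly_div_exp_tendsto_0 filterlim_inverse_at_top_right])
        moreover have "\<forall>\<^sub>F h in at_right 0. poly (pCons 0 (p k)) (inverse h) / exp (inverse h) = D k h / h"
          using eventually_at_right_less[of "0::real"]
          by eventually_elim (simp add: D_def exp_minus field_simps)
        ultimately show ?thesis by (rule Lim_transform_eventually)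
      qed
      moreover have "((\<lambda>h. D k h / h) \<longlongrightarrow> 0) (at_left 0)"
      proof (rule tendsto_eventually)
        show "\<forall>\<^sub>F h in at_left 0. D k h / h = 0"
          by (auto simp: D_def eventually_at_filter intro: always_eventually)
      qed
      ultimately have "((\<lambda>h. D k h / h) \<longlongrightarrow> 0) (at 0)" by (intro filterlim_split_at)
      then show ?thesis using 3 by (simp add: DERIV_def D_def)
    qed
  qed
  ultimately show ?thesis unfolding smooth_real_def by blast
qed

lemma flat_tendsto: "(\<lambda>n. flat (real (Suc n) * s)) \<longlonglongrightarrow> (if s > 0 then 1 else 0)"
proof (cases "s > 0")
  case True
  have "(\<lambda>n. exp (- (inverse (real (Suc n)) * inverse s))) \<longlonglongrightarrow> exp (- (0 * inverse s))"
    by (intro tendsto_intros LIMSEQ_inverse_real_of_nat)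
  then show ?thesis using True by (simp add: flat_def divide_inverse inverse_mult_distrib mult.commute)
next
  case False
  then have "flat (real (Suc n) * s) = 0" for n by (auto simp: flat_def zero_less_mult_iff)
  then show ?thesis using False by simp
qed

lemma flat_bounds: "0 \<le> flat t" "flat t \<le> 1"
  by (auto simp: flat_def)

text \<open>A smooth approximation of the indicator of the open box, with values between 0 and 1;
  larger \<open>n\<close> makes the flanks steeper without enlarging the support.\<close>

definition box_bump :: "real^3 \<Rightarrow> real^3 \<Rightarrow> nat \<Rightarrow> real^3 \<Rightarrow> real" where
  "box_bump a b n x = (\<Prod>i\<in>UNIV. flat (real (Suc n) * (x $ i - a $ i)) * flat (real (Suc n) * (b $ i - x $ i)))"

lemma Ck_prod: "(\<And>i. i \<in> A \<Longrightarrow> Ck k (f i)) \<Longrightarrow> Ck k (\<lambda>x. \<Prod>i\<in>A. f i x)"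
  by (induction A rule: infinite_finite_induct) (simp_all add: Ck_const Ck_mult)

lemma Ck_box_bump: "Ck k (box_bump a b n)"
proof -
  have "Ck k (\<lambda>x. flat (real (Suc n) * (x $ i - a $ i)))" for i
    using Ck_smooth_real_component[OF smooth_real_affine
        [OF smooth_real_flat, of "real (Suc n)" "- real (Suc n) * a $ i"], of k i]
    by (simp add: algebra_simps)
  moreover have "Ck k (\<lambda>x. flat (real (Suc n) * (b $ i - x $ i)))" for i
    using Ck_smooth_real_component[OF smooth_real_affine
        [OF smooth_real_flat, of "- real (Suc n)" "real (Suc n) * b $ i"], of k i]
    by (simp add: algebra_simps)
  ultimately show ?thesis
    unfolding box_bump_def[abs_def] by (intro Ck_prod Ck_mult)
qed

lemma box_bump_bounds: "0 \<le> box_bump a b n x" "box_bump a b n x \<le> 1"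
  unfolding box_bump_def by (auto intro!: prod_nonneg prod_le_1 mult_le_one flat_bounds mult_nonneg_nonneg)

lemma box_bump_tendsto: "(\<lambda>n. box_bump a b n x) \<longlonglongrightarrow> indicator (box a b) x"
proof -
  have "(\<lambda>n. box_bump a b n x) \<longlonglongrightarrow>
      (\<Prod>i\<in>UNIV. (if x $ i - a $ i > 0 then 1 else 0) * (if b $ i - x $ i > 0 then 1 else 0))"
    unfolding box_bump_def by (intro tendsto_prod tendsto_mult flat_tendsto)
  moreover have "(\<Prod>i\<in>UNIV. (if x $ i - a $ i > 0 then 1 else 0) * (if b $ i - x $ i > 0 then 1 else 0))
      = (indicator (box a b) x :: real)"
    by (simp add: mem_box_cart indicator_def prod.neutral)
  ultimately show ?thesis by simp
qed

lemma box_bump_test: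
  assumes "cbox a b \<subseteq> \<Omega>"
  shows "box_bump a b n \<in> test_functions \<Omega>"
proof (rule test_functionI[of _ "cbox a b"])
  fix x assume "x \<notin> cbox a b"
  then obtain i where "x $ i < a $ i \<or> b $ i < x $ i" by (auto simp: mem_box_cart not_le)
  then have "flat (real (Suc n) * (x $ i - a $ i)) * flat (real (Suc n) * (b $ i - x $ i)) = 0"
    by (auto simp: flat_def zero_less_mult_iff)
  then show "box_bump a b n x = 0" unfolding box_bump_def by (intro prod_zero) auto
qed (use assms Ck_box_bump in auto)

context bounded_open_domain
begin

text \<open>The bumps converge to the indicator of the box, with majorant
  \<open>\<bar>d x\<bar>\<close>, which is integrable because the domain has finite measure.\<close>

lemma integral_box_eq_0:
  fixes d :: "real^3 \<Rightarrow> real"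
  assumes d: "d \<in> L2 \<Omega>" "\<And>\<phi>. \<phi> \<in> test_functions \<Omega> \<Longrightarrow> L2_inner \<Omega> d \<phi> = 0"
    and ab: "cbox a b \<subseteq> \<Omega>"
  shows "(\<integral>x. indicator (box a b) x * d x \<partial>lebesgue_on \<Omega>) = 0"
proof -
  have int: "integrable (lebesgue_on \<Omega>) d" by (rule L2_imp_L1(1)[OF lmeasurable_domain d(1)])
  note [measurable] = L2_measurable[OF d(1)]
  have [measurable]: "box_bump a b n \<in> borel_measurable (lebesgue_on \<Omega>)" for n
    using L2_measurable[OF test_function_L2[OF box_bump_test[OF ab]]] .
  have "(\<lambda>n. \<integral>x. box_bump a b n x * d x \<partial>lebesgue_on \<Omega>) \<longlonglongrightarrow> (\<integral>x. indicator (box a b) x * d x \<partial>lebesgue_on \<Omega>)"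
  proof (rule integral_dominated_convergence[where w="\<lambda>x. \<bar>d x\<bar>"])
    have [measurable]: "indicator (box a b) \<in> borel_measurable (lebesgue_on \<Omega>)"
      by (intro measurable_restrict_space1 borel_measurable_indicator) auto
    show "(\<lambda>x. indicator (box a b) x * d x) \<in> borel_measurable (lebesgue_on \<Omega>)" by measurable
    show "integrable (lebesgue_on \<Omega>) (\<lambda>x. \<bar>d x\<bar>)" using int by simp
    show "AE x in lebesgue_on \<Omega>. (\<lambda>n. box_bump a b n x * d x) \<longlonglongrightarrow> indicator (box a b) x * d x"
      by (intro AE_I2 tendsto_mult box_bump_tendsto tendsto_const)
    show "AE x in lebesgue_on \<Omega>. norm (box_bump a b n x * d x) \<le> \<bar>d x\<bar>" for n
      using box_bump_bounds[of a b n] by (intro AE_I2) (simp add: abs_mult mult_left_le_one_le)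
  qed measurable
  moreover have "(\<integral>x. box_bump a b n x * d x \<partial>lebesgue_on \<Omega>) = 0" for n
    using d(2)[OF box_bump_test[OF ab]] by (simp add: L2_inner_def mult.commute)
  ultimately show ?thesis by (simp add: LIMSEQ_const_iff)
qed

text \<open>The fundamental lemma of the calculus of variations. Inside a fixed box the integrals of
  \<open>d\<close> over all smaller boxes vanish; boxes are stable under intersection and generate
  the Borel sets, so all set integrals vanish. Countably many boxes exhaust the domain.\<close>

lemma AE_eq_0_if_orthogonal_to_test_functions:
  fixes d :: "real^3 \<Rightarrow> real"
  assumes d: "d \<in> L2 \<Omega>" "\<And>\<phi>. \<phi> \<in> test_functions \<Omega> \<Longrightarrow> L2_inner \<Omega> d \<phi> = 0"
  shows "AE x in lebesgue_on \<Omega>. d x = 0"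
proof -
  have \<Omega>: "\<Omega> \<inter> space lebesgue \<in> sets lebesgue" using lmeasurable_domain by auto
  have int: "integrable lebesgue (\<lambda>x. indicator \<Omega> x *\<^sub>R d x)"
    using L2_imp_L1(1)[OF lmeasurable_domain d(1)] by (rule integrable_restrict_space[OF \<Omega>, THEN iffD1])
  have box: "AE x in lebesgue. x \<in> cbox a b \<longrightarrow> d x = 0" if ab: "cbox a b \<subseteq> \<Omega>" for a b
  proof -
    \<comment> \<open>Cutting off to one box inside the domain makes the integral over any box
      \<open>box u v\<close> that of \<open>d\<close> over an intersection whose closed version
      still lies in the domain.\<close>
    define f where "f x = indicator (box a b) x *\<^sub>R (indicator \<Omega> x *\<^sub>R d x)" for x
    have f: "integrable lebesgue f"
      unfolding f_def by (rule integrable_mult_indicator[OF _ int]) simp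
    have f_box: "set_lebesgue_integral lebesgue (box u v) f = 0" for u v
    proof -
      define u' where "u' = (\<Sum>i\<in>Basis. max (u \<bullet> i) (a \<bullet> i) *\<^sub>R i)"
      define v' where "v' = (\<Sum>i\<in>Basis. min (v \<bullet> i) (b \<bullet> i) *\<^sub>R i)"
      have uv: "box u v \<inter> box a b = box u' v'" "cbox u v \<inter> cbox a b = cbox u' v'"
        by (simp_all only: box_Int_box Int_interval u'_def v'_def)
      have "set_lebesgue_integral lebesgue (box u v) f
          = (\<integral>x. indicator \<Omega> x *\<^sub>R (indicator (box u' v') x * d x) \<partial>lebesgue)"
        unfolding set_lebesgue_integral_def f_def uv(1)[symmetric]
        by (intro Bochner_Integration.integral_cong) (auto simp: indicator_def)
      also have "\<dots> = (\<integral>x. indicator (box u' v') x * d x \<partial>lebesgue_on \<Omega>)"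
        by (rule integral_restrict_space[OF \<Omega>, symmetric])
      also have "\<dots> = 0" using uv(2) ab by (intro integral_box_eq_0[OF d]) auto
      finally show ?thesis .
    qed
    have f_borel: "set_lebesgue_integral lebesgue A f = 0" if "A \<in> sets borel" for A
    proof -
      let ?G = "range (\<lambda>(u, v). box u v :: (real^3) set)"
      have borel: "sets borel = sigma_sets UNIV ?G"
        by (subst borel_eq_box) (rule sets_measure_of, simp)
      have "Int_stable ?G"
      proof (rule Int_stableI)
        fix A B assume "A \<in> ?G" "B \<in> ?G"
        then obtain s t s' t' :: "real^3" where "A = box s t" "B = box s' t'" by auto
        then have "A \<inter> B = (\<lambda>(u, v). box u v) (\<Sum>i\<in>Basis. max (s \<bullet> i) (s' \<bullet> i) *\<^sub>R i,
            \<Sum>i\<in>Basis. min (t \<bullet> i) (t' \<bullet> i) *\<^sub>R i)"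
          by (simp add: box_Int_box)
        then show "A \<inter> B \<in> ?G" by (rule range_eqI)
      qed
      moreover have "?G \<subseteq> Pow UNIV" by simp
      moreover have "A \<in> sigma_sets UNIV ?G"
        using that borel by simp
      ultimately show ?thesis
      proof (induction rule: sigma_sets_induct_disjoint)
        case (compl A)
        have A: "A \<in> sets lebesgue" using compl(1) borel by simp
        \<comment> \<open>\<open>f\<close> vanishes off \<open>box a b\<close>, so its integral over
          the whole space is again a box integral; complements need this.\<close>
        have "set_lebesgue_integral lebesgue (box a b) f = (\<integral>x. f x \<partial>lebesgue)"
          unfolding set_lebesgue_integral_def f_def
          by (intro Bochner_Integration.integral_cong) (auto simp: indicator_def)
        then have "(\<integral>x. f x \<partial>lebesgue) = 0" using f_box by simp
        moreover have "set_lebesgue_integral lebesgue (UNIV - A) f = (\<integral>x. f x - indicator A x *\<^sub>R f x \<partial>lebesgue)"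
          unfolding set_lebesgue_integral_def
          by (intro Bochner_Integration.integral_cong) (auto simp: indicator_def)
        ultimately show ?case
          using compl(2) f integrable_mult_indicator[OF A f] by (simp add: set_lebesgue_integral_def)
      next
        case (union A)
        have A: "A i \<in> sets lebesgue" for i
          using union(2) borel by (intro sets_completionI_sets) auto
        have "set_lebesgue_integral lebesgue (\<Union>i. A i) f = (\<Sum>i. set_lebesgue_integral lebesgue (A i) f)"
        proof (rule lebesgue_integral_countable_add[OF A])
          show "set_integrable lebesgue (\<Union>i. A i) f"
            unfolding set_integrable_def using A by (intro integrable_mult_indicator[OF _ f]) auto
        qed (use union(1) in \<open>auto simp: disjoint_family_on_def\<close>)
        then show ?case using union(3) by simp
      next
        case (basic A)
        then show ?case using f_box by auto
      qed (simp add: set_lebesgue_integral_def)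
    qed
    \<comment> \<open>A Lebesgue set differs from a Borel set only by a subset of a null
      set.\<close>
    have "set_lebesgue_integral lebesgue A f = 0" if A: "A \<in> sets lebesgue" for A
    proof -
      obtain S N N' where SN: "A = S \<union> N" "N \<subseteq> N'" "N' \<in> null_sets lborel" "S \<in> sets lborel"
        using sets_completionE[OF A] by blast
      have "AE x in lebesgue. x \<notin> N'" by (rule AE_completion[OF AE_not_in[OF SN(3)]])
      then have "AE x in lebesgue. indicator A x *\<^sub>R f x = indicator S x *\<^sub>R f x"
        by eventually_elim (use SN in \<open>auto simp: indicator_def\<close>)
      moreover have "S \<in> sets lebesgue" using SN by auto
      ultimately have "set_lebesgue_integral lebesgue A f = set_lebesgue_integral lebesgue S f"
        unfolding set_lebesgue_integral_def using A f
        by (intro integral_cong_AE borel_measurable_integrable integrable_mult_indicator)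
      then show ?thesis using f_borel SN(4) by simp
    qed
    then have "AE x in lebesgue. f x = 0"
      by (intro density_unique_real[OF f]) (simp_all add: set_lebesgue_integral_def)
    moreover have "AE x in lebesgue. x \<notin> cbox a b - box a b"
      using negligible_frontier_interval[of a b] by (intro AE_not_in) (simp add: negligible_iff_null_sets)
    ultimately show ?thesis
      by eventually_elim (use ab in \<open>auto simp: f_def indicator_def\<close>)
  qed
  obtain \<D> where \<D>: "countable \<D>" "\<D> \<subseteq> Pow \<Omega>" "\<And>X. X \<in> \<D> \<Longrightarrow> \<exists>a b. X = cbox a b" "\<Union>\<D> = \<Omega>"
    using open_countable_Union_open_cbox[OF open_domain] by blast
  have "AE x in lebesgue. x \<in> X \<longrightarrow> d x = 0" if "X \<in> \<D>" for X
    using \<D>(2,3) box that by blast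
  then have "\<forall>X\<in>\<D>. AE x in lebesgue. x \<in> X \<longrightarrow> d x = 0" by (rule ballI)
  then have "AE x in lebesgue. \<forall>X\<in>\<D>. x \<in> X \<longrightarrow> d x = 0"
    by (rule AE_ball_countable[OF \<D>(1), THEN iffD2])
  then have "AE x in lebesgue. x \<in> \<Omega> \<longrightarrow> d x = 0"
    by eventually_elim (use \<D>(4) in auto)
  then show ?thesis using \<Omega> by (simp add: AE_restrict_space_iff)
qed

end

section \<open>Density of test fields\<close>

lemma L2_component:
  fixes g :: "real^3 \<Rightarrow> real^3"
  assumes "g \<in> L2 \<Omega>"
  shows "(\<lambda>x. g x $ i) \<in> L2 \<Omega>"
proof -
  have "(\<lambda>x. g x \<bullet> axis i 1) \<in> borel_measurable (lebesgue_on \<Omega>)"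
    using L2_measurable[OF assms] by simp
  then have meas: "(\<lambda>x. g x $ i) \<in> borel_measurable (lebesgue_on \<Omega>)"
    by (simp add: inner_axis)
  moreover have "integrable (lebesgue_on \<Omega>) (\<lambda>x. (norm (g x $ i))\<^sup>2)"
  proof (rule Bochner_Integration.integrable_bound[OF L2_square_integrable[OF assms]])
    show "AE x in lebesgue_on \<Omega>. norm ((norm (g x $ i))\<^sup>2) \<le> norm ((norm (g x))\<^sup>2)"
      using component_le_norm_cart[of _ i] by (intro AE_I2) (simp add: abs_le_square_iff[symmetric])
  qed (use meas in simp)
  ultimately show ?thesis by (simp add: L2_def)
qed

lemma L2_inner_sym: "L2_inner \<Omega> f g = L2_inner \<Omega> g f"
  by (simp add: L2_inner_def inner_commute)

definition Hdiv_inner :: "(real^3) set \<Rightarrow> (real^3 \<Rightarrow> real^3) \<Rightarrow> (real^3 \<Rightarrow> real^3) \<Rightarrow> real" where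
  "Hdiv_inner \<Omega> v w = L2_inner \<Omega> v w + L2_inner \<Omega> (weak_div \<Omega> v) (weak_div \<Omega> w)"

lemma Hdiv_norm_eq: "Hdiv_norm \<Omega> v = sqrt (Hdiv_inner \<Omega> v v)"
  by (simp add: Hdiv_norm_def Hdiv_inner_def L2_norm_power2)

lemma Hdiv_norm_power2: "(Hdiv_norm \<Omega> v)\<^sup>2 = (L2_norm \<Omega> v)\<^sup>2 + (L2_norm \<Omega> (weak_div \<Omega> v))\<^sup>2"
  by (simp add: Hdiv_norm_def)

lemma Hdiv_norm_nonneg: "0 \<le> Hdiv_norm \<Omega> v"
  by (simp add: Hdiv_norm_def)

lemma L2_norm_le_Hdiv_norm: "L2_norm \<Omega> v \<le> Hdiv_norm \<Omega> v"
  unfolding Hdiv_norm_def by (rule real_le_rsqrt) simp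

lemma L2_norm_weak_div_le_Hdiv_norm: "L2_norm \<Omega> (weak_div \<Omega> v) \<le> Hdiv_norm \<Omega> v"
  unfolding Hdiv_norm_def by (rule real_le_rsqrt) simp

context bounded_open_domain
begin

text \<open>\<open>weak_grad\<close>, like \<open>weak_div\<close>, is an arbitrary choice; being
  determined almost everywhere is enough, since inner products in \<open>L2\<close> see no
  more.\<close>

lemma weak_grad_unique:
  assumes "is_weak_grad \<Omega> q g" "is_weak_grad \<Omega> q g'"
  shows "AE x in lebesgue_on \<Omega>. g x = g' x"
proof -
  have g: "g \<in> L2 \<Omega>" "g' \<in> L2 \<Omega>" using assms by (auto simp: is_weak_grad_def)
  have "AE x in lebesgue_on \<Omega>. (g x - g' x) $ i = 0" for i
  proof (rule AE_eq_0_if_orthogonal_to_test_functions)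
    show "(\<lambda>x. (g x - g' x) $ i) \<in> L2 \<Omega>" by (rule L2_component[OF L2.diff_mem[OF g]])
    fix \<psi> assume "\<psi> \<in> test_functions \<Omega>"
    then have t: "(\<lambda>x. axis i (\<psi> x)) \<in> test_fields \<Omega>" by (rule test_field_axis)
    have "L2_inner \<Omega> (\<lambda>x. (g x - g' x) $ i) \<psi> = L2_inner \<Omega> (\<lambda>x. g x - g' x) (\<lambda>x. axis i (\<psi> x))"
      by (simp add: L2_inner_def inner_axis)
    also have "\<dots> = 0"
      using assms t L2.form_diff[OF g test_field_L2[OF t]] by (simp add: is_weak_grad_def)
    finally show "L2_inner \<Omega> (\<lambda>x. (g x - g' x) $ i) \<psi> = 0" .
  qed
  then have "AE x in lebesgue_on \<Omega>. (g x - g' x) $ 1 = 0 \<and> (g x - g' x) $ 2 = 0 \<and> (g x - g' x) $ 3 = 0"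
    by simp
  then show ?thesis by eventually_elim (simp add: vec_eq_iff forall_3)
qed

lemma weak_div_unique:
  assumes "is_weak_div \<Omega> v d" "is_weak_div \<Omega> v d'"
  shows "AE x in lebesgue_on \<Omega>. d x = d' x"
proof -
  have d: "d \<in> L2 \<Omega>" "d' \<in> L2 \<Omega>" using assms by (auto simp: is_weak_div_def)
  have "AE x in lebesgue_on \<Omega>. d x - d' x = 0"
    using assms L2.form_diff[OF d test_function_L2] L2.diff_mem[OF d]
    by (intro AE_eq_0_if_orthogonal_to_test_functions) (simp_all add: is_weak_div_def)
  then show ?thesis by simp
qed

section \<open>Chosen weak derivatives and the linear structure of \<open>H0div\<close>\<close>

lemma is_weak_div_weak_div: "v \<in> Hdiv \<Omega> \<Longrightarrow> is_weak_div \<Omega> v (weak_div \<Omega> v)"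
  using someI_ex[of "is_weak_div \<Omega> v"] by (simp add: Hdiv_def weak_div_def)

lemma weak_div_L2: "v \<in> Hdiv \<Omega> \<Longrightarrow> weak_div \<Omega> v \<in> L2 \<Omega>"
  using is_weak_div_weak_div by (simp add: is_weak_div_def)

lemma HdivI: "v \<in> L2 \<Omega> \<Longrightarrow> is_weak_div \<Omega> v d \<Longrightarrow> v \<in> Hdiv \<Omega>"
  by (auto simp: Hdiv_def)

lemma weak_div_AE:
  assumes "v \<in> L2 \<Omega>" "is_weak_div \<Omega> v d"
  shows "AE x in lebesgue_on \<Omega>. weak_div \<Omega> v x = d x"
  by (rule weak_div_unique[OF is_weak_div_weak_div[OF HdivI[OF assms]] assms(2)])

lemma is_weak_grad_weak_grad: "q \<in> H1 \<Omega> \<Longrightarrow> is_weak_grad \<Omega> q (weak_grad \<Omega> q)"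
  using someI_ex[of "is_weak_grad \<Omega> q"] by (simp add: H1_def weak_grad_def)

lemma weak_grad_L2: "q \<in> H1 \<Omega> \<Longrightarrow> weak_grad \<Omega> q \<in> L2 \<Omega>"
  using is_weak_grad_weak_grad by (simp add: is_weak_grad_def)

lemma H1_L2: "q \<in> H1 \<Omega> \<Longrightarrow> q \<in> L2 \<Omega>"
  by (simp add: H1_def)

lemma H0div_Hdiv: "v \<in> H0div \<Omega> \<Longrightarrow> v \<in> Hdiv \<Omega>"
  by (simp add: H0div_def)

lemma H0div_L2: "v \<in> H0div \<Omega> \<Longrightarrow> v \<in> L2 \<Omega>"
  by (simp add: H0div_def Hdiv_def)

lemma weak_div_H0div_L2: "v \<in> H0div \<Omega> \<Longrightarrow> weak_div \<Omega> v \<in> L2 \<Omega>"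
  by (rule weak_div_L2[OF H0div_Hdiv])

lemma H0div_Green:
  "v \<in> H0div \<Omega> \<Longrightarrow> q \<in> H1 \<Omega> \<Longrightarrow> L2_inner \<Omega> v (weak_grad \<Omega> q) + L2_inner \<Omega> (weak_div \<Omega> v) q = 0"
  by (simp add: H0div_def normal_trace_def)

text \<open>Membership may be checked with any weak divergence in place of the chosen one.\<close>

lemma H0divI:
  assumes "v \<in> L2 \<Omega>" "is_weak_div \<Omega> v d"
    and "\<And>q. q \<in> H1 \<Omega> \<Longrightarrow> L2_inner \<Omega> v (weak_grad \<Omega> q) + L2_inner \<Omega> d q = 0"
  shows "v \<in> H0div \<Omega>"
proof -
  have v: "v \<in> Hdiv \<Omega>" by (rule HdivI[OF assms(1,2)])
  have "L2_inner \<Omega> (weak_div \<Omega> v) q = L2_inner \<Omega> d q" if "q \<in> H1 \<Omega>" for q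
    using weak_div_AE[OF assms(1,2)] weak_div_L2[OF v] assms(2) H1_L2[OF that]
    by (intro L2_inner_cong_AE) (auto simp: is_weak_div_def)
  then show ?thesis using v assms(3) by (simp add: H0div_def normal_trace_def)
qed

lemma is_weak_div_add:
  assumes "is_weak_div \<Omega> v d" "is_weak_div \<Omega> w e" "v \<in> L2 \<Omega>" "w \<in> L2 \<Omega>"
  shows "is_weak_div \<Omega> (\<lambda>x. v x + w x) (\<lambda>x. d x + e x)"
  using assms
  by (simp add: is_weak_div_def L2_add L2.form_add test_function_L2 test_field_L2 grad_test)

lemma is_weak_div_scaleR:
  assumes "is_weak_div \<Omega> v d" "v \<in> L2 \<Omega>"
  shows "is_weak_div \<Omega> (\<lambda>x. c *\<^sub>R v x) (\<lambda>x. c *\<^sub>R d x)"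
  using assms L2.form_scale[of d \<Omega>] L2_scaleR[of d \<Omega> c]
  by (simp add: is_weak_div_def L2.form_scale test_function_L2 test_field_L2 grad_test)

lemma is_weak_div_test_field: "\<phi> \<in> test_fields \<Omega> \<Longrightarrow> is_weak_div \<Omega> \<phi> (div_field \<phi>)"
  by (simp add: is_weak_div_def test_function_L2 div_field_test div_field_integration_by_parts)

lemma H0div_add_weak_div:
  assumes "v \<in> H0div \<Omega>" "w \<in> H0div \<Omega>"
  shows "is_weak_div \<Omega> (\<lambda>x. v x + w x) (\<lambda>x. weak_div \<Omega> v x + weak_div \<Omega> w x)"
  using assms by (intro is_weak_div_add is_weak_div_weak_div H0div_Hdiv H0div_L2)

lemma H0div_scaleR_weak_div:
  assumes "v \<in> H0div \<Omega>"
  shows "is_weak_div \<Omega> (\<lambda>x. c *\<^sub>R v x) (\<lambda>x. c *\<^sub>R weak_div \<Omega> v x)"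
  using assms by (intro is_weak_div_scaleR is_weak_div_weak_div H0div_Hdiv H0div_L2)

lemma H0div_add:
  assumes "v \<in> H0div \<Omega>" "w \<in> H0div \<Omega>"
  shows "(\<lambda>x. v x + w x) \<in> H0div \<Omega>"
proof (rule H0divI[OF L2_add H0div_add_weak_div[OF assms]])
  show "v \<in> L2 \<Omega>" "w \<in> L2 \<Omega>" using assms by (auto intro: H0div_L2)
  fix q assume q: "q \<in> H1 \<Omega>"
  show "L2_inner \<Omega> (\<lambda>x. v x + w x) (weak_grad \<Omega> q) + L2_inner \<Omega> (\<lambda>x. weak_div \<Omega> v x + weak_div \<Omega> w x) q = 0"
    using H0div_Green[OF assms(1) q] H0div_Green[OF assms(2) q] assms q
    by (simp add: L2.form_add H0div_L2 weak_div_H0div_L2 weak_grad_L2 H1_L2)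
qed

lemma H0div_scaleR:
  assumes "v \<in> H0div \<Omega>"
  shows "(\<lambda>x. c *\<^sub>R v x) \<in> H0div \<Omega>"
proof (rule H0divI[OF L2_scaleR H0div_scaleR_weak_div[OF assms]])
  show "v \<in> L2 \<Omega>" using assms by (rule H0div_L2)
  fix q assume q: "q \<in> H1 \<Omega>"
  show "L2_inner \<Omega> (\<lambda>x. c *\<^sub>R v x) (weak_grad \<Omega> q) + L2_inner \<Omega> (\<lambda>x. c *\<^sub>R weak_div \<Omega> v x) q = 0"
    using arg_cong[OF H0div_Green[OF assms q], of "\<lambda>t. c * t"]
      L2.form_scale[OF weak_div_H0div_L2[OF assms] H1_L2[OF q], of c]
      L2.form_scale[OF H0div_L2[OF assms] weak_grad_L2[OF q], of c]
    by (simp add: distrib_left)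
qed

text \<open>For a test field, the vanishing of the normal trace is the defining identity of the weak
  gradient.\<close>

lemma test_field_H0div:
  assumes "\<phi> \<in> test_fields \<Omega>"
  shows "\<phi> \<in> H0div \<Omega>"
proof (rule H0divI[OF test_field_L2[OF assms] is_weak_div_test_field[OF assms]])
  fix q assume q: "q \<in> H1 \<Omega>"
  have "L2_inner \<Omega> (weak_grad \<Omega> q) \<phi> = - L2_inner \<Omega> q (div_field \<phi>)"
    using is_weak_grad_weak_grad[OF q] assms by (simp add: is_weak_grad_def)
  then show "L2_inner \<Omega> \<phi> (weak_grad \<Omega> q) + L2_inner \<Omega> (div_field \<phi>) q = 0"
    using L2_inner_sym[of \<Omega> \<phi>] L2_inner_sym[of \<Omega> q] by simp
qed

lemma weak_div_inner_cong:
  assumes "v \<in> L2 \<Omega>" "is_weak_div \<Omega> v d" "e \<in> L2 \<Omega>"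
  shows "L2_inner \<Omega> (weak_div \<Omega> v) e = L2_inner \<Omega> d e"
  using weak_div_AE[OF assms(1,2)] weak_div_L2[OF HdivI[OF assms(1,2)]] assms(2,3)
  by (intro L2_inner_cong_AE) (auto simp: is_weak_div_def)

lemma weak_div_inner_cong_right:
  assumes "v \<in> L2 \<Omega>" "is_weak_div \<Omega> v d" "e \<in> L2 \<Omega>"
  shows "L2_inner \<Omega> e (weak_div \<Omega> v) = L2_inner \<Omega> e d"
  using weak_div_inner_cong[OF assms] by (simp only: L2_inner_sym[of \<Omega> e])

text \<open>\<open>weak_div\<close> is linear only up to null sets, so linearity of the form is
  obtained by exchanging the chosen divergence under the inner product.\<close>

sublocale H0div: semi_inner_space "H0div \<Omega>" "Hdiv_inner \<Omega>"
proof
  show "(\<lambda>x. 0) \<in> H0div \<Omega>" by (rule test_field_H0div[OF test_field_zero])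
  fix v w z :: "real^3 \<Rightarrow> real^3" and c :: real
  assume v: "v \<in> H0div \<Omega>"
  show "(\<lambda>x. c *\<^sub>R v x) \<in> H0div \<Omega>" by (rule H0div_scaleR[OF v])
  show "0 \<le> Hdiv_inner \<Omega> v v" by (simp add: Hdiv_inner_def L2_inner_def)
  { assume w: "w \<in> H0div \<Omega>"
    show "(\<lambda>x. v x + w x) \<in> H0div \<Omega>" by (rule H0div_add[OF v w])
    show "Hdiv_inner \<Omega> v w = Hdiv_inner \<Omega> w v"
      unfolding Hdiv_inner_def by (intro arg_cong2[of _ _ _ _ "(+)"] L2_inner_sym)
    assume z: "z \<in> H0div \<Omega>"
    show "Hdiv_inner \<Omega> (\<lambda>x. v x + w x) z = Hdiv_inner \<Omega> v z + Hdiv_inner \<Omega> w z"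
      using v w z
      by (simp add: Hdiv_inner_def weak_div_inner_cong[OF _ H0div_add_weak_div] L2.form_add
          L2_add H0div_L2 weak_div_H0div_L2) }
  assume z: "z \<in> H0div \<Omega>"
  have "L2_inner \<Omega> (weak_div \<Omega> (\<lambda>x. c *\<^sub>R v x)) (weak_div \<Omega> z) = L2_inner \<Omega> (\<lambda>x. c *\<^sub>R weak_div \<Omega> v x) (weak_div \<Omega> z)"
    using v z by (intro weak_div_inner_cong H0div_scaleR_weak_div L2_scaleR H0div_L2 weak_div_H0div_L2)
  also have "\<dots> = c * L2_inner \<Omega> (weak_div \<Omega> v) (weak_div \<Omega> z)"
    using v z by (intro L2.form_scale weak_div_H0div_L2)
  finally show "Hdiv_inner \<Omega> (\<lambda>x. c *\<^sub>R v x) z = c * Hdiv_inner \<Omega> v z"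
    using v z by (simp add: Hdiv_inner_def L2.form_scale H0div_L2 distrib_left)
qed

section \<open>Limits of test fields in the graph norm\<close>

lemma Hdiv_inner_test_fields:
  assumes "\<phi> \<in> test_fields \<Omega>" "\<psi> \<in> test_fields \<Omega>"
  shows "Hdiv_inner \<Omega> \<phi> \<psi> = L2_inner \<Omega> \<phi> \<psi> + L2_inner \<Omega> (div_field \<phi>) (div_field \<psi>)"
  using assms
  by (simp add: Hdiv_inner_def weak_div_inner_cong[OF _ is_weak_div_test_field]
      weak_div_inner_cong_right[OF _ is_weak_div_test_field]
      test_field_L2 weak_div_H0div_L2 test_field_H0div test_function_L2 div_field_test)

lemma test_field_diff: "\<phi> \<in> test_fields \<Omega> \<Longrightarrow> \<psi> \<in> test_fields \<Omega> \<Longrightarrow> (\<lambda>x. \<phi> x - \<psi> x) \<in> test_fields \<Omega>"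
  using test_field_add[of \<phi> "\<lambda>x. (-1) *\<^sub>R \<psi> x"] test_field_scaleR[of \<psi> "-1"] by simp

lemma div_field_diff:
  "\<phi> \<in> test_fields \<Omega> \<Longrightarrow> \<psi> \<in> test_fields \<Omega> \<Longrightarrow>
    div_field (\<lambda>x. \<phi> x - \<psi> x) = (\<lambda>x. div_field \<phi> x - div_field \<psi> x)"
  using div_field_add[of \<phi> "\<lambda>x. (-1) *\<^sub>R \<psi> x"] test_field_scaleR[of \<psi> "-1"] div_field_scaleR[of \<psi> "-1"]
  by simp

lemma curl_field_diff:
  "\<phi> \<in> test_fields \<Omega> \<Longrightarrow> \<psi> \<in> test_fields \<Omega> \<Longrightarrow>
    curl_field (\<lambda>x. \<phi> x - \<psi> x) = (\<lambda>x. curl_field \<phi> x - curl_field \<psi> x)"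
  using curl_field_add[of \<phi> "\<lambda>x. (-1) *\<^sub>R \<psi> x"] test_field_scaleR[of \<psi> "-1"] curl_field_scaleR[of \<psi> "-1"]
  by simp

text \<open>Both the weak divergence and the vanishing normal trace are identities between inner
  products with fixed square integrable functions, so they survive separate \<open>L2\<close> limits
  of the fields and of their divergences.\<close>

lemma Hdiv_Cauchy_test_fields_limit:
  assumes \<phi>: "\<And>n. \<phi> n \<in> test_fields \<Omega>"
    and Cauchy: "\<And>e. e > 0 \<Longrightarrow> \<exists>N. \<forall>m\<ge>N. \<forall>n\<ge>N.
      Hdiv_inner \<Omega> (\<lambda>x. \<phi> m x - \<phi> n x) (\<lambda>x. \<phi> m x - \<phi> n x) < e"
  obtains u where "u \<in> H0div \<Omega>"
    "(\<lambda>n. L2_norm \<Omega> (\<lambda>x. \<phi> n x - u x)) \<longlonglongrightarrow> 0"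
    "(\<lambda>n. L2_norm \<Omega> (\<lambda>x. div_field (\<phi> n) x - weak_div \<Omega> u x)) \<longlonglongrightarrow> 0"
proof -
  note \<phi>_L2 = test_field_L2[OF \<phi>] and div_L2 = test_function_L2[OF div_field_test[OF \<phi>]]
  have inner: "Hdiv_inner \<Omega> (\<lambda>x. \<phi> m x - \<phi> n x) (\<lambda>x. \<phi> m x - \<phi> n x)
      = L2_inner \<Omega> (\<lambda>x. \<phi> m x - \<phi> n x) (\<lambda>x. \<phi> m x - \<phi> n x)
      + L2_inner \<Omega> (\<lambda>x. div_field (\<phi> m) x - div_field (\<phi> n) x) (\<lambda>x. div_field (\<phi> m) x - div_field (\<phi> n) x)" for m n
    by (simp add: Hdiv_inner_test_fields test_field_diff \<phi> div_field_diff)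
  have nonneg: "0 \<le> L2_inner \<Omega> f f" for f :: "real^3 \<Rightarrow> 'a::euclidean_space"
    by (simp add: L2_inner_def)
  have C1: "\<exists>N. \<forall>m\<ge>N. \<forall>n\<ge>N. L2_inner \<Omega> (\<lambda>x. \<phi> m x - \<phi> n x) (\<lambda>x. \<phi> m x - \<phi> n x) < e" if "e > 0" for e
    using Cauchy[OF that] nonneg[of "\<lambda>x. div_field (\<phi> _) x - div_field (\<phi> _) x"] unfolding inner
    by (meson add_increasing2 le_less_trans order_refl)
  obtain u where u: "u \<in> L2 \<Omega>" "(\<lambda>n. L2_norm \<Omega> (\<lambda>x. \<phi> n x - u x)) \<longlonglongrightarrow> 0"
    by (rule L2_complete[where f=\<phi>, OF lmeasurable_domain \<phi>_L2 C1])
  have C2: "\<exists>N. \<forall>m\<ge>N. \<forall>n\<ge>N. L2_inner \<Omega> (\<lambda>x. div_field (\<phi> m) x - div_field (\<phi> n) x)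
      (\<lambda>x. div_field (\<phi> m) x - div_field (\<phi> n) x) < e" if "e > 0" for e
    using Cauchy[OF that] nonneg[of "\<lambda>x. \<phi> _ x - \<phi> _ x"] unfolding inner
    by (meson add_increasing le_less_trans order_refl)
  obtain d where d: "d \<in> L2 \<Omega>" "(\<lambda>n. L2_norm \<Omega> (\<lambda>x. div_field (\<phi> n) x - d x)) \<longlonglongrightarrow> 0"
    by (rule L2_complete[where f="\<lambda>n. div_field (\<phi> n)", OF lmeasurable_domain div_L2 C2])
  note u_lim = L2_inner_tendsto[OF \<phi>_L2 u(1) _ u(2)] and d_lim = L2_inner_tendsto[OF div_L2 d(1) _ d(2)]
  have div: "is_weak_div \<Omega> u d"
    unfolding is_weak_div_def
  proof (intro conjI ballI d)
    fix \<psi> assume \<psi>: "\<psi> \<in> test_functions \<Omega>"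
    have "(\<lambda>n. - L2_inner \<Omega> (\<phi> n) (grad \<psi>)) \<longlonglongrightarrow> - L2_inner \<Omega> u (grad \<psi>)"
      by (intro tendsto_minus u_lim test_field_L2 grad_test \<psi>)
    moreover have "(\<lambda>n. - L2_inner \<Omega> (\<phi> n) (grad \<psi>)) \<longlonglongrightarrow> L2_inner \<Omega> d \<psi>"
      using d_lim[OF test_function_L2[OF \<psi>]] by (simp add: div_field_integration_by_parts[OF \<phi> \<psi>])
    ultimately show "L2_inner \<Omega> d \<psi> = - L2_inner \<Omega> u (grad \<psi>)" by (rule LIMSEQ_unique[symmetric])
  qed
  have H0: "u \<in> H0div \<Omega>"
  proof (rule H0divI[OF u(1) div])
    fix q assume q: "q \<in> H1 \<Omega>"
    have "(\<lambda>n. L2_inner \<Omega> (\<phi> n) (weak_grad \<Omega> q) + L2_inner \<Omega> (div_field (\<phi> n)) q)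
        \<longlonglongrightarrow> L2_inner \<Omega> u (weak_grad \<Omega> q) + L2_inner \<Omega> d q"
      by (intro tendsto_add u_lim d_lim weak_grad_L2 H1_L2 q)
    moreover have "L2_inner \<Omega> (\<phi> n) (weak_grad \<Omega> q) + L2_inner \<Omega> (div_field (\<phi> n)) q = 0" for n
      using H0div_Green[OF test_field_H0div[OF \<phi>] q]
      by (simp add: weak_div_inner_cong[OF \<phi>_L2 is_weak_div_test_field[OF \<phi>] H1_L2[OF q]])
    ultimately show "L2_inner \<Omega> u (weak_grad \<Omega> q) + L2_inner \<Omega> d q = 0"
      by (simp add: LIMSEQ_const_iff)
  qed
  have "L2_norm \<Omega> (\<lambda>x. div_field (\<phi> n) x - weak_div \<Omega> u x) = L2_norm \<Omega> (\<lambda>x. div_field (\<phi> n) x - d x)" for n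
  proof (rule L2_norm_cong_AE)
    show "AE x in lebesgue_on \<Omega>. div_field (\<phi> n) x - weak_div \<Omega> u x = div_field (\<phi> n) x - d x"
      using weak_div_AE[OF u(1) div] by eventually_elim simp
  qed (intro L2.diff_mem div_L2 weak_div_H0div_L2 H0 d)+
  then show thesis using that[OF H0 u(2)] d(2) by simp
qed

lemma Hdiv_norm_tendsto_0:
  assumes \<phi>: "\<And>n. \<phi> n \<in> test_fields \<Omega>" and u: "u \<in> H0div \<Omega>"
    and "(\<lambda>n. L2_norm \<Omega> (\<lambda>x. \<phi> n x - u x)) \<longlonglongrightarrow> 0"
    and "(\<lambda>n. L2_norm \<Omega> (\<lambda>x. div_field (\<phi> n) x - weak_div \<Omega> u x)) \<longlonglongrightarrow> 0"
  shows "(\<lambda>n. Hdiv_norm \<Omega> (\<lambda>x. \<phi> n x - u x)) \<longlonglongrightarrow> 0"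
proof -
  have "L2_norm \<Omega> (weak_div \<Omega> (\<lambda>x. \<phi> n x - u x)) = L2_norm \<Omega> (\<lambda>x. div_field (\<phi> n) x - weak_div \<Omega> u x)" for n
  proof (rule L2_norm_cong_AE)
    have "is_weak_div \<Omega> (\<lambda>x. \<phi> n x + (-1) *\<^sub>R u x) (\<lambda>x. div_field (\<phi> n) x + (-1) *\<^sub>R weak_div \<Omega> u x)"
      by (intro is_weak_div_add is_weak_div_test_field \<phi> H0div_scaleR_weak_div u test_field_L2 L2_scaleR H0div_L2)
    then show "AE x in lebesgue_on \<Omega>. weak_div \<Omega> (\<lambda>x. \<phi> n x - u x) x = div_field (\<phi> n) x - weak_div \<Omega> u x"
      using weak_div_AE[OF L2.diff_mem[OF test_field_L2[OF \<phi>] H0div_L2[OF u]]] by simp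
  qed (intro L2.diff_mem weak_div_H0div_L2 H0div.diff_mem test_field_H0div \<phi> u test_function_L2 div_field_test)+
  then have "Hdiv_norm \<Omega> (\<lambda>x. \<phi> n x - u x) = sqrt ((L2_norm \<Omega> (\<lambda>x. \<phi> n x - u x))\<^sup>2
      + (L2_norm \<Omega> (\<lambda>x. div_field (\<phi> n) x - weak_div \<Omega> u x))\<^sup>2)" for n
    by (simp add: Hdiv_norm_def)
  moreover have "(\<lambda>n. sqrt ((L2_norm \<Omega> (\<lambda>x. \<phi> n x - u x))\<^sup>2
      + (L2_norm \<Omega> (\<lambda>x. div_field (\<phi> n) x - weak_div \<Omega> u x))\<^sup>2)) \<longlonglongrightarrow> sqrt (0\<^sup>2 + 0\<^sup>2)"
    by (intro tendsto_intros assms)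
  ultimately show ?thesis by simp
qed

text \<open>A field \<open>w\<close> in \<open>H0div \<Omega>\<close> orthogonal to all test fields satisfies \<open>grad (div w) = w\<close>
  weakly, so testing its vanishing normal trace against \<open>div w\<close> gives \<open>w = 0\<close>.\<close>

lemma Hdiv_inner_eq_0_if_orthogonal:
  assumes w: "w \<in> H0div \<Omega>" and orth: "\<And>\<psi>. \<psi> \<in> test_fields \<Omega> \<Longrightarrow> Hdiv_inner \<Omega> w \<psi> = 0"
  shows "Hdiv_inner \<Omega> w w = 0"
proof -
  let ?q = "weak_div \<Omega> w"
  have "L2_inner \<Omega> w \<psi> = - L2_inner \<Omega> ?q (div_field \<psi>)" if "\<psi> \<in> test_fields \<Omega>" for \<psi>
    using orth[OF that] weak_div_inner_cong_right[OF test_field_L2[OF that] is_weak_div_test_field[OF that]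
        weak_div_H0div_L2[OF w]]
    by (simp add: Hdiv_inner_def)
  then have grad: "is_weak_grad \<Omega> ?q w"
    using H0div_L2[OF w] by (simp add: is_weak_grad_def)
  then have q: "?q \<in> H1 \<Omega>"
    using weak_div_H0div_L2[OF w] by (auto simp: H1_def)
  have "L2_inner \<Omega> w (weak_grad \<Omega> ?q) = L2_inner \<Omega> w w"
    by (rule L2_inner_cong_AE[OF _ weak_grad_unique[OF is_weak_grad_weak_grad[OF q] grad]])
      (simp_all add: H0div_L2[OF w] weak_grad_L2[OF q])
  then show ?thesis using H0div_Green[OF w q] by (simp add: Hdiv_inner_def)
qed

text \<open>With the form restricted to test fields, a representing sequence takes the place of the
  orthogonal projection onto their closure.\<close>

sublocale test_fields: semi_inner_space "test_fields \<Omega>" "Hdiv_inner \<Omega>"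
  by standard (simp_all add: test_field_zero test_field_add test_field_scaleR test_field_H0div
      H0div.form_add H0div.form_scale H0div.form_sym H0div.form_nonneg)

text \<open>The sequence representing the inner product with \<open>v\<close> converges to the
  projection \<open>p\<close> of \<open>v\<close> onto the closure of the test fields, and the error
  \<open>p - v\<close> is orthogonal to them, hence of length zero.\<close>

lemma test_fields_dense:
  assumes v: "v \<in> H0div \<Omega>"
  obtains \<phi> where "\<And>n. \<phi> n \<in> test_fields \<Omega>" "(\<lambda>n. Hdiv_norm \<Omega> (\<lambda>x. \<phi> n x - v x)) \<longlonglongrightarrow> 0"
proof -
  have "\<exists>\<phi>. (\<forall>n. \<phi> n \<in> test_fields \<Omega>) \<and> (\<forall>e>0. \<exists>N. \<forall>m\<ge>N. \<forall>n\<ge>N.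
      Hdiv_inner \<Omega> (\<lambda>x. \<phi> m x - \<phi> n x) (\<lambda>x. \<phi> m x - \<phi> n x) < e) \<and>
      (\<forall>\<psi>\<in>test_fields \<Omega>. (\<lambda>n. Hdiv_inner \<Omega> (\<phi> n) \<psi>) \<longlonglongrightarrow> Hdiv_inner \<Omega> v \<psi>)"
  proof (rule test_fields.representing_sequence[of "Hdiv_inner \<Omega> v" "sqrt (Hdiv_inner \<Omega> v v)"])
    fix \<psi> \<eta> :: "real^3 \<Rightarrow> real^3" and c :: real assume \<psi>: "\<psi> \<in> test_fields \<Omega>"
    note \<psi>' = test_field_H0div[OF \<psi>]
    show "Hdiv_inner \<Omega> v (\<lambda>x. c *\<^sub>R \<psi> x) = c * Hdiv_inner \<Omega> v \<psi>"
      using H0div.form_combination_right[OF \<psi>' \<psi>' v, of c 0] by simp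
    show "\<bar>Hdiv_inner \<Omega> v \<psi>\<bar> \<le> sqrt (Hdiv_inner \<Omega> v v) * sqrt (Hdiv_inner \<Omega> \<psi> \<psi>)"
      by (rule H0div.Cauchy_Schwarz[OF v \<psi>'])
    assume "\<eta> \<in> test_fields \<Omega>"
    from H0div.form_combination_right[OF \<psi>' test_field_H0div[OF this] v, of 1 1]
    show "Hdiv_inner \<Omega> v (\<lambda>x. \<psi> x + \<eta> x) = Hdiv_inner \<Omega> v \<psi> + Hdiv_inner \<Omega> v \<eta>" by simp
  qed blast
  then obtain \<phi> where \<phi>: "\<And>n. \<phi> n \<in> test_fields \<Omega>"
    and Cauchy: "\<And>e. e > 0 \<Longrightarrow> \<exists>N. \<forall>m\<ge>N. \<forall>n\<ge>N.
      Hdiv_inner \<Omega> (\<lambda>x. \<phi> m x - \<phi> n x) (\<lambda>x. \<phi> m x - \<phi> n x) < e"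
    and lim: "\<And>\<psi>. \<psi> \<in> test_fields \<Omega> \<Longrightarrow> (\<lambda>n. Hdiv_inner \<Omega> (\<phi> n) \<psi>) \<longlonglongrightarrow> Hdiv_inner \<Omega> v \<psi>"
    by blast
  obtain p where p: "p \<in> H0div \<Omega>" "(\<lambda>n. L2_norm \<Omega> (\<lambda>x. \<phi> n x - p x)) \<longlonglongrightarrow> 0"
    "(\<lambda>n. L2_norm \<Omega> (\<lambda>x. div_field (\<phi> n) x - weak_div \<Omega> p x)) \<longlonglongrightarrow> 0"
    using Hdiv_Cauchy_test_fields_limit[of \<phi>, OF \<phi> Cauchy] by blast
  have p_lim: "(\<lambda>n. Hdiv_norm \<Omega> (\<lambda>x. \<phi> n x - p x)) \<longlonglongrightarrow> 0"
    by (rule Hdiv_norm_tendsto_0[OF \<phi> p])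
  define w where "w x = p x - v x" for x
  have w: "w \<in> H0div \<Omega>" unfolding w_def by (rule H0div.diff_mem[OF p(1) v])
  have "Hdiv_inner \<Omega> w \<psi> = 0" if \<psi>: "\<psi> \<in> test_fields \<Omega>" for \<psi>
  proof -
    have "(\<lambda>n. L2_inner \<Omega> (\<phi> n) \<psi> + L2_inner \<Omega> (div_field (\<phi> n)) (div_field \<psi>))
        \<longlonglongrightarrow> L2_inner \<Omega> p \<psi> + L2_inner \<Omega> (weak_div \<Omega> p) (div_field \<psi>)"
      by (intro tendsto_add L2_inner_tendsto[OF test_field_L2[OF \<phi>] H0div_L2[OF p(1)] _ p(2)]
          L2_inner_tendsto[OF test_function_L2[OF div_field_test[OF \<phi>]] weak_div_H0div_L2[OF p(1)] _ p(3)]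
          test_field_L2 test_function_L2 div_field_test \<psi>)
    then have "(\<lambda>n. Hdiv_inner \<Omega> (\<phi> n) \<psi>) \<longlonglongrightarrow> Hdiv_inner \<Omega> p \<psi>"
      using weak_div_inner_cong_right[OF test_field_L2[OF \<psi>] is_weak_div_test_field[OF \<psi>] weak_div_H0div_L2[OF p(1)]]
      by (simp add: Hdiv_inner_test_fields \<phi> \<psi> Hdiv_inner_def[of \<Omega> p])
    then have "Hdiv_inner \<Omega> p \<psi> = Hdiv_inner \<Omega> v \<psi>"
      using lim[OF \<psi>] by (rule LIMSEQ_unique)
    then show ?thesis
      unfolding w_def using H0div.form_diff[OF p(1) v test_field_H0div[OF \<psi>]] by simp
  qed
  then have w0: "Hdiv_inner \<Omega> w w = 0" by (rule Hdiv_inner_eq_0_if_orthogonal[OF w])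
  \<comment> \<open>\<open>w\<close> has length zero but need not be the zero function, so
    \<open>p\<close> is exchanged for \<open>v\<close> by the triangle inequality.\<close>
  have "(\<lambda>n. Hdiv_norm \<Omega> (\<lambda>x. \<phi> n x - v x)) \<longlonglongrightarrow> 0"
  proof (rule Lim_null_comparison[OF always_eventually p_lim], intro allI)
    fix n
    have "(\<lambda>x. \<phi> n x - v x) = (\<lambda>x. (\<phi> n x - p x) + w x)" by (simp add: w_def)
    then have "Hdiv_norm \<Omega> (\<lambda>x. \<phi> n x - v x) \<le> Hdiv_norm \<Omega> (\<lambda>x. \<phi> n x - p x) + Hdiv_norm \<Omega> w"
      using H0div.triangle[OF H0div.diff_mem[OF test_field_H0div[OF \<phi>] p(1)] w, of n]
      by (simp add: Hdiv_norm_eq)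
    then show "norm (Hdiv_norm \<Omega> (\<lambda>x. \<phi> n x - v x)) \<le> Hdiv_norm \<Omega> (\<lambda>x. \<phi> n x - p x)"
      using w0 by (simp add: Hdiv_norm_nonneg Hdiv_norm_eq[of \<Omega> w])
  qed
  with \<phi> show thesis by (rule that)
qed

end

section \<open>The mixed problem\<close>

context bounded_open_domain
begin

section \<open>The dual space and its norm\<close>

lemma H0div_dual_add:
  "F \<in> H0div_dual \<Omega> \<Longrightarrow> v \<in> H0div \<Omega> \<Longrightarrow> w \<in> H0div \<Omega> \<Longrightarrow> F (\<lambda>x. v x + w x) = F v + F w"
  by (simp add: H0div_dual_def)

lemma H0div_dual_scaleR: "F \<in> H0div_dual \<Omega> \<Longrightarrow> v \<in> H0div \<Omega> \<Longrightarrow> F (\<lambda>x. c *\<^sub>R v x) = c * F v"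
  by (simp add: H0div_dual_def)

lemma H0div_dual_bound: "F \<in> H0div_dual \<Omega> \<Longrightarrow> \<exists>K. \<forall>v\<in>H0div \<Omega>. \<bar>F v\<bar> \<le> K * Hdiv_norm \<Omega> v"
  by (simp add: H0div_dual_def)

lemma H0div_dual_diff:
  assumes "F \<in> H0div_dual \<Omega>" "v \<in> H0div \<Omega>" "w \<in> H0div \<Omega>"
  shows "F (\<lambda>x. v x - w x) = F v - F w"
  using H0div_dual_add[OF assms(1,2) H0div_scaleR[OF assms(3)], of "-1"] H0div_dual_scaleR[OF assms(1,3), of "-1"]
  by simp

lemma H0div_dual_minus:
  assumes "F \<in> H0div_dual \<Omega>" "G \<in> H0div_dual \<Omega>"
  shows "(\<lambda>v. F v - G v) \<in> H0div_dual \<Omega>"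
proof -
  obtain K L where K: "\<And>v. v \<in> H0div \<Omega> \<Longrightarrow> \<bar>F v\<bar> \<le> K * Hdiv_norm \<Omega> v"
    and L: "\<And>v. v \<in> H0div \<Omega> \<Longrightarrow> \<bar>G v\<bar> \<le> L * Hdiv_norm \<Omega> v"
    using assms[THEN H0div_dual_bound] by blast
  have "\<bar>F v - G v\<bar> \<le> (K + L) * Hdiv_norm \<Omega> v" if "v \<in> H0div \<Omega>" for v
    using K[OF that] L[OF that] by (simp add: distrib_right)
  then show ?thesis
    using assms by (auto simp: H0div_dual_def right_diff_distrib)
qed

lemma Hdiv_norm_scaleR: "v \<in> H0div \<Omega> \<Longrightarrow> Hdiv_norm \<Omega> (\<lambda>x. c *\<^sub>R v x) = \<bar>c\<bar> * Hdiv_norm \<Omega> v"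
  unfolding Hdiv_norm_eq by (rule H0div.norm_scale)

lemma dual_norm_bound:
  assumes F: "F \<in> H0div_dual \<Omega>" and v: "v \<in> H0div \<Omega>"
  shows "\<bar>F v\<bar> \<le> dual_norm \<Omega> F * Hdiv_norm \<Omega> v"
proof -
  obtain K where K: "\<And>v. v \<in> H0div \<Omega> \<Longrightarrow> \<bar>F v\<bar> \<le> K * Hdiv_norm \<Omega> v"
    using H0div_dual_bound[OF F] by blast
  show ?thesis
  proof (cases "Hdiv_norm \<Omega> v = 0")
    \<comment> \<open>A field of length zero cannot be normalized; here boundedness of
      \<open>F\<close> already gives \<open>F v = 0\<close>.\<close>
    case True
    then show ?thesis using K[OF v] by simp
  next
    case False
    then have pos: "Hdiv_norm \<Omega> v > 0" using Hdiv_norm_nonneg[of \<Omega> v] by simp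
    \<comment> \<open>A supremum of reals controls its members only if the set is bounded
      above.\<close>
    have bdd: "bdd_above ((\<lambda>v. \<bar>F v\<bar>) ` {v \<in> H0div \<Omega>. Hdiv_norm \<Omega> v \<le> 1})"
    proof (rule bdd_aboveI2)
      fix w assume w: "w \<in> {v \<in> H0div \<Omega>. Hdiv_norm \<Omega> v \<le> 1}"
      then have "\<bar>F w\<bar> \<le> \<bar>K\<bar> * Hdiv_norm \<Omega> w"
        using K[of w] mult_right_mono[OF abs_ge_self[of K] Hdiv_norm_nonneg[of \<Omega> w]] by simp
      also have "\<dots> \<le> \<bar>K\<bar>" using w by (simp add: mult_left_le)
      finally show "\<bar>F w\<bar> \<le> \<bar>K\<bar>" .
    qed
    let ?w = "\<lambda>x. inverse (Hdiv_norm \<Omega> v) *\<^sub>R v x"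
    have "\<bar>F ?w\<bar> \<le> dual_norm \<Omega> F"
      unfolding dual_norm_def using pos v
      by (intro cSUP_upper[OF _ bdd]) (simp add: H0div_scaleR Hdiv_norm_scaleR)
    then show ?thesis
      using pos by (simp add: H0div_dual_scaleR[OF F v] abs_mult field_simps)
  qed
qed

lemma dual_norm_le:
  assumes "\<And>v. v \<in> H0div \<Omega> \<Longrightarrow> \<bar>F v\<bar> \<le> K * Hdiv_norm \<Omega> v" "0 \<le> K"
  shows "dual_norm \<Omega> F \<le> K"
  unfolding dual_norm_def
proof (rule cSUP_least)
  have "Hdiv_inner \<Omega> (\<lambda>x. 0) (\<lambda>x. 0) = 0"
    using H0div.form_scale[OF H0div.zero_mem H0div.zero_mem, of 0] by simp
  then show "{v \<in> H0div \<Omega>. Hdiv_norm \<Omega> v \<le> 1} \<noteq> {}"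
    using H0div.zero_mem by (auto simp: Hdiv_norm_eq intro!: exI[of _ "\<lambda>x. 0"])
  fix v assume v: "v \<in> {v \<in> H0div \<Omega>. Hdiv_norm \<Omega> v \<le> 1}"
  then have "K * Hdiv_norm \<Omega> v \<le> K" using assms(2) by (simp add: mult_left_le)
  then show "\<bar>F v\<bar> \<le> K" using assms(1)[of v] v by simp
qed

text \<open>A negative value would force \<open>F\<close> to vanish on \<open>H0div \<Omega>\<close>
  by \<open>dual_norm_bound\<close>, but then the supremum is that of the constant 0.\<close>

lemma dual_norm_nonneg:
  assumes "F \<in> H0div_dual \<Omega>"
  shows "0 \<le> dual_norm \<Omega> F"
proof (rule ccontr)
  assume neg: "\<not> 0 \<le> dual_norm \<Omega> F"
  then have "dual_norm \<Omega> F * Hdiv_norm \<Omega> v \<le> 0" for v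
    using Hdiv_norm_nonneg[of \<Omega> v] by (intro mult_nonpos_nonneg) auto
  then have F0: "F v = 0" if "v \<in> H0div \<Omega>" for v
    using dual_norm_bound[OF assms that] by (metis abs_le_zero_iff order_trans)
  have "dual_norm \<Omega> F = (SUP v \<in> {v \<in> H0div \<Omega>. Hdiv_norm \<Omega> v \<le> 1}. 0)"
    unfolding dual_norm_def by (rule SUP_cong) (auto simp: F0)
  also have "\<dots> = 0"
  proof (rule cSUP_const)
    have "Hdiv_inner \<Omega> (\<lambda>x. 0) (\<lambda>x. 0) = 0"
      using H0div.form_scale[OF H0div.zero_mem H0div.zero_mem, of 0] by simp
    then show "{v \<in> H0div \<Omega>. Hdiv_norm \<Omega> v \<le> 1} \<noteq> {}"
      using H0div.zero_mem by (auto simp: Hdiv_norm_eq intro!: exI[of _ "\<lambda>x. 0"])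
  qed
  finally show False using neg by simp
qed

lemma H0div_dual_tendsto:
  assumes F: "F \<in> H0div_dual \<Omega>" and v: "\<And>n. v n \<in> H0div \<Omega>" "u \<in> H0div \<Omega>"
    and lim: "(\<lambda>n. Hdiv_norm \<Omega> (\<lambda>x. v n x - u x)) \<longlonglongrightarrow> 0"
  shows "(\<lambda>n. F (v n)) \<longlonglongrightarrow> F u"
proof (rule LIM_zero_cancel, rule Lim_null_comparison[OF always_eventually])
  show "\<forall>n. norm (F (v n) - F u) \<le> dual_norm \<Omega> F * Hdiv_norm \<Omega> (\<lambda>x. v n x - u x)"
    using dual_norm_bound[OF F H0div.diff_mem[OF v]] by (simp add: H0div_dual_diff[OF F v])
  show "(\<lambda>n. dual_norm \<Omega> F * Hdiv_norm \<Omega> (\<lambda>x. v n x - u x)) \<longlonglongrightarrow> 0"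
    by (rule tendsto_mult_right_zero[OF lim])
qed

text \<open>Bounded functionals are continuous and test fields are dense.\<close>

lemma H0div_dual_eqI:
  assumes F: "F \<in> H0div_dual \<Omega>" and G: "G \<in> H0div_dual \<Omega>"
    and eq: "\<And>\<phi>. \<phi> \<in> test_fields \<Omega> \<Longrightarrow> F \<phi> = G \<phi>" and v: "v \<in> H0div \<Omega>"
  shows "F v = G v"
proof -
  obtain \<phi> where \<phi>: "\<And>n. \<phi> n \<in> test_fields \<Omega>" "(\<lambda>n. Hdiv_norm \<Omega> (\<lambda>x. \<phi> n x - v x)) \<longlonglongrightarrow> 0"
    using test_fields_dense[OF v] by blast
  have "(\<lambda>n. F (\<phi> n)) \<longlonglongrightarrow> F v" "(\<lambda>n. G (\<phi> n)) \<longlonglongrightarrow> G v"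
    using H0div_dual_tendsto[OF F test_field_H0div[OF \<phi>(1)] v \<phi>(2)]
      H0div_dual_tendsto[OF G test_field_H0div[OF \<phi>(1)] v \<phi>(2)] by auto
  then show ?thesis using eq[OF \<phi>(1)] by (simp add: LIMSEQ_unique)
qed

section \<open>The weak curl as a functional on \<open>H0div\<close>\<close>

lemma is_weak_curl_weak_curl: "\<tau> \<in> Sigma_space \<Omega> \<Longrightarrow> is_weak_curl \<Omega> \<tau> (weak_curl \<Omega> \<tau>)"
  using someI_ex[of "is_weak_curl \<Omega> \<tau>"] by (simp add: Sigma_space_def weak_curl_def)

lemma weak_curl_dual: "\<tau> \<in> Sigma_space \<Omega> \<Longrightarrow> weak_curl \<Omega> \<tau> \<in> H0div_dual \<Omega>"
  using is_weak_curl_weak_curl by (simp add: is_weak_curl_def)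

lemma weak_curl_test_field:
  "\<tau> \<in> Sigma_space \<Omega> \<Longrightarrow> \<phi> \<in> test_fields \<Omega> \<Longrightarrow> weak_curl \<Omega> \<tau> \<phi> = L2_inner \<Omega> \<tau> (curl_field \<phi>)"
  using is_weak_curl_weak_curl by (simp add: is_weak_curl_def)

lemma Sigma_space_L2: "\<tau> \<in> Sigma_space \<Omega> \<Longrightarrow> \<tau> \<in> L2 \<Omega>"
  by (simp add: Sigma_space_def)

text \<open>By density, every bounded extension of the distributional curl may replace the chosen
  one on \<open>H0div \<Omega>\<close>; this is how weak curls get computed.\<close>

lemma weak_curl_eq:
  assumes "\<tau> \<in> L2 \<Omega>" "is_weak_curl \<Omega> \<tau> F"
  shows "\<tau> \<in> Sigma_space \<Omega>" and "v \<in> H0div \<Omega> \<Longrightarrow> weak_curl \<Omega> \<tau> v = F v"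
proof -
  show S: "\<tau> \<in> Sigma_space \<Omega>" using assms by (auto simp: Sigma_space_def)
  show "weak_curl \<Omega> \<tau> v = F v" if "v \<in> H0div \<Omega>"
    using assms(2) weak_curl_test_field[OF S]
    by (intro H0div_dual_eqI[of "weak_curl \<Omega> \<tau>" F, OF weak_curl_dual[OF S] _ _ that])
      (simp_all add: is_weak_curl_def)
qed

text \<open>Admits the functional \<open>(u, \<cdot>)\<close> as right-hand side of the auxiliary
  problem in the duality argument.\<close>

lemma L2_inner_H0div_dual:
  assumes "u \<in> L2 \<Omega>"
  shows "L2_inner \<Omega> u \<in> H0div_dual \<Omega>"
proof -
  have "\<bar>L2_inner \<Omega> u v\<bar> \<le> L2_norm \<Omega> u * Hdiv_norm \<Omega> v" if "v \<in> H0div \<Omega>" for v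
    using L2_Cauchy_Schwarz[OF assms H0div_L2[OF that]]
      mult_left_mono[OF L2_norm_le_Hdiv_norm[of \<Omega> v] L2_norm_nonneg[of \<Omega> u]] by simp
  moreover have "L2_inner \<Omega> u (\<lambda>x. v x + w x) = L2_inner \<Omega> u v + L2_inner \<Omega> u w"
    if "v \<in> H0div \<Omega>" "w \<in> H0div \<Omega>" for v w
    using L2.form_combination_right[OF H0div_L2[OF that(1)] H0div_L2[OF that(2)] assms, of 1 1] by simp
  moreover have "L2_inner \<Omega> u (\<lambda>x. c *\<^sub>R v x) = c * L2_inner \<Omega> u v" if "v \<in> H0div \<Omega>" for v c
    using L2.form_combination_right[OF H0div_L2[OF that] H0div_L2[OF that] assms, of c 0] by simp
  ultimately show ?thesis by (auto simp: H0div_dual_def)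
qed

text \<open>Makes the divergence term of the second equation a bounded functional, so that moving it
  to the right leaves an admissible curl.\<close>

lemma weak_div_inner_H0div_dual:
  assumes "d \<in> L2 \<Omega>"
  shows "(\<lambda>v. L2_inner \<Omega> d (weak_div \<Omega> v)) \<in> H0div_dual \<Omega>"
proof -
  have "\<bar>L2_inner \<Omega> d (weak_div \<Omega> v)\<bar> \<le> L2_norm \<Omega> d * Hdiv_norm \<Omega> v" if "v \<in> H0div \<Omega>" for v
    using L2_Cauchy_Schwarz[OF assms weak_div_H0div_L2[OF that]]
      mult_left_mono[OF L2_norm_weak_div_le_Hdiv_norm[of \<Omega> v] L2_norm_nonneg[of \<Omega> d]] by simp
  moreover have "L2_inner \<Omega> d (weak_div \<Omega> (\<lambda>x. v x + w x)) = L2_inner \<Omega> d (weak_div \<Omega> v) + L2_inner \<Omega> d (weak_div \<Omega> w)"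
    if v: "v \<in> H0div \<Omega>" and w: "w \<in> H0div \<Omega>" for v w
    using L2.form_combination_right[OF weak_div_H0div_L2[OF v] weak_div_H0div_L2[OF w] assms, of 1 1]
      weak_div_inner_cong_right[OF H0div_L2[OF H0div_add[OF v w]] H0div_add_weak_div[OF v w] assms] by simp
  moreover have "L2_inner \<Omega> d (weak_div \<Omega> (\<lambda>x. c *\<^sub>R v x)) = c * L2_inner \<Omega> d (weak_div \<Omega> v)"
    if v: "v \<in> H0div \<Omega>" for v c
    using L2.form_combination_right[OF weak_div_H0div_L2[OF v] weak_div_H0div_L2[OF v] assms, of c 0]
      weak_div_inner_cong_right[OF H0div_L2[OF H0div_scaleR[OF v]] H0div_scaleR_weak_div[OF v] assms] by simp
  ultimately show ?thesis by (auto simp: H0div_dual_def)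
qed

text \<open>The Dirichlet form of the vector Laplacian; on the diagonal
  \<open>gradient_energy\<close> identifies it with the squared norm of the full gradient.\<close>

definition energy :: "(real^3 \<Rightarrow> real^3) \<Rightarrow> (real^3 \<Rightarrow> real^3) \<Rightarrow> real" where
  "energy \<phi> \<psi> = L2_inner \<Omega> (curl_field \<phi>) (curl_field \<psi>) + L2_inner \<Omega> (div_field \<phi>) (div_field \<psi>)"

sublocale energy: semi_inner_space "test_fields \<Omega>" energy
proof
  fix v w z :: "real^3 \<Rightarrow> real^3" and c :: real
  assume v: "v \<in> test_fields \<Omega>"
  note L2s = test_field_L2[OF curl_field_test] test_function_L2[OF div_field_test]
  show "0 \<le> energy v v" by (simp add: energy_def L2_inner_def)
  { assume w: "w \<in> test_fields \<Omega>"
    show "energy v w = energy w v"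
      unfolding energy_def by (intro arg_cong2[of _ _ _ _ "(+)"] L2_inner_sym)
    assume z: "z \<in> test_fields \<Omega>"
    show "energy (\<lambda>x. v x + w x) z = energy v z + energy w z"
      using v w z by (simp add: energy_def curl_field_add div_field_add L2.form_add L2s) }
  assume z: "z \<in> test_fields \<Omega>"
  show "energy (\<lambda>x. c *\<^sub>R v x) z = c * energy v z"
    unfolding energy_def curl_field_scaleR[OF v] div_field_scaleR[OF v]
    by (simp only: L2.form_scale[OF L2s(1)[OF v] L2s(1)[OF z]] L2.form_scale[OF L2s(2)[OF v] L2s(2)[OF z]]
        distrib_left)
qed (simp_all add: test_field_zero test_field_add test_field_scaleR)

text \<open>The solution is the limit \<open>u\<close> of test fields representing \<open>f\<close> in the energy form, together
  with the limit \<open>\<mu>\<close> of their curls.\<close>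

lemma ex_mixed_solution:
  "\<exists>C>0. \<forall>f\<in>H0div_dual \<Omega>. \<exists>\<mu> u. mixed_solution \<Omega> f \<mu> u \<and>
    (Hdiv_norm \<Omega> u)\<^sup>2 \<le> C * ((L2_norm \<Omega> \<mu>)\<^sup>2 + (L2_norm \<Omega> (weak_div \<Omega> u))\<^sup>2)"
proof -
  obtain C0 where C0: "C0 > 0" "\<And>\<phi>. \<phi> \<in> test_fields \<Omega> \<Longrightarrow> L2_inner \<Omega> \<phi> \<phi> \<le> C0 * energy \<phi> \<phi>"
    unfolding energy_def using Poincare by blast
  \<comment> \<open>The additional 1 pays for the divergence part of the graph norm.\<close>
  define C where "C = C0 + 1"
  have C: "C > 0" using C0(1) by (simp add: C_def)
  have coercive: "Hdiv_inner \<Omega> \<phi> \<phi> \<le> C * energy \<phi> \<phi>" if "\<phi> \<in> test_fields \<Omega>" for \<phi>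
  proof -
    have "L2_inner \<Omega> (div_field \<phi>) (div_field \<phi>) \<le> energy \<phi> \<phi>"
      by (simp add: energy_def L2_inner_def)
    then show ?thesis
      using C0(2)[OF that] by (simp add: Hdiv_inner_test_fields[OF that that] C_def distrib_right)
  qed
  have "\<exists>\<mu> u. mixed_solution \<Omega> f \<mu> u \<and>
    (Hdiv_norm \<Omega> u)\<^sup>2 \<le> C * ((L2_norm \<Omega> \<mu>)\<^sup>2 + (L2_norm \<Omega> (weak_div \<Omega> u))\<^sup>2)" if f: "f \<in> H0div_dual \<Omega>" for f
  proof -
    have "\<exists>\<phi>. (\<forall>n. \<phi> n \<in> test_fields \<Omega>) \<and> (\<forall>e>0. \<exists>N. \<forall>m\<ge>N. \<forall>n\<ge>N.
        energy (\<lambda>x. \<phi> m x - \<phi> n x) (\<lambda>x. \<phi> m x - \<phi> n x) < e) \<and>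
        (\<forall>\<psi>\<in>test_fields \<Omega>. (\<lambda>n. energy (\<phi> n) \<psi>) \<longlonglongrightarrow> f \<psi>)"
    proof (rule energy.representing_sequence[of f "dual_norm \<Omega> f * sqrt C"])
      fix \<psi> \<eta> :: "real^3 \<Rightarrow> real^3" and c :: real assume \<psi>: "\<psi> \<in> test_fields \<Omega>"
      show "f (\<lambda>x. c *\<^sub>R \<psi> x) = c * f \<psi>" by (rule H0div_dual_scaleR[OF f test_field_H0div[OF \<psi>]])
      have "\<bar>f \<psi>\<bar> \<le> dual_norm \<Omega> f * sqrt (Hdiv_inner \<Omega> \<psi> \<psi>)"
        using dual_norm_bound[OF f test_field_H0div[OF \<psi>]] by (simp add: Hdiv_norm_eq)
      also have "\<dots> \<le> dual_norm \<Omega> f * sqrt (C * energy \<psi> \<psi>)"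
        by (intro mult_left_mono real_sqrt_le_mono coercive \<psi> dual_norm_nonneg f)
      finally show "\<bar>f \<psi>\<bar> \<le> dual_norm \<Omega> f * sqrt C * sqrt (energy \<psi> \<psi>)"
        by (simp add: real_sqrt_mult)
      assume "\<eta> \<in> test_fields \<Omega>"
      then show "f (\<lambda>x. \<psi> x + \<eta> x) = f \<psi> + f \<eta>"
        by (intro H0div_dual_add f test_field_H0div \<psi>)
    qed blast
    then obtain \<phi> where \<phi>: "\<And>n. \<phi> n \<in> test_fields \<Omega>"
      and Cauchy: "\<And>e. e > 0 \<Longrightarrow> \<exists>N. \<forall>m\<ge>N. \<forall>n\<ge>N. energy (\<lambda>x. \<phi> m x - \<phi> n x) (\<lambda>x. \<phi> m x - \<phi> n x) < e"
      and lim: "\<And>\<psi>. \<psi> \<in> test_fields \<Omega> \<Longrightarrow> (\<lambda>n. energy (\<phi> n) \<psi>) \<longlonglongrightarrow> f \<psi>"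
      by blast
    note \<phi>_L2 = test_field_L2[OF \<phi>] and div_L2 = test_function_L2[OF div_field_test[OF \<phi>]]
      and curl_L2 = test_field_L2[OF curl_field_test[OF \<phi>]]
    have "\<exists>N. \<forall>m\<ge>N. \<forall>n\<ge>N. Hdiv_inner \<Omega> (\<lambda>x. \<phi> m x - \<phi> n x) (\<lambda>x. \<phi> m x - \<phi> n x) < e" if e: "e > 0" for e
    proof -
      obtain N where N: "\<forall>m\<ge>N. \<forall>n\<ge>N. energy (\<lambda>x. \<phi> m x - \<phi> n x) (\<lambda>x. \<phi> m x - \<phi> n x) < e / C"
        using Cauchy[OF divide_pos_pos[OF e C]] by blast
      have "Hdiv_inner \<Omega> (\<lambda>x. \<phi> m x - \<phi> n x) (\<lambda>x. \<phi> m x - \<phi> n x) < e" if "m \<ge> N" "n \<ge> N" for m n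
      proof -
        have "energy (\<lambda>x. \<phi> m x - \<phi> n x) (\<lambda>x. \<phi> m x - \<phi> n x) < e / C" using N that by blast
        then have "C * energy (\<lambda>x. \<phi> m x - \<phi> n x) (\<lambda>x. \<phi> m x - \<phi> n x) < e"
          using C by (simp add: field_simps)
        then show ?thesis using coercive[OF test_field_diff[OF \<phi> \<phi>], of m n] by simp
      qed
      then show ?thesis by blast
    qed
    then obtain u where u: "u \<in> H0div \<Omega>" "(\<lambda>n. L2_norm \<Omega> (\<lambda>x. \<phi> n x - u x)) \<longlonglongrightarrow> 0"
      "(\<lambda>n. L2_norm \<Omega> (\<lambda>x. div_field (\<phi> n) x - weak_div \<Omega> u x)) \<longlonglongrightarrow> 0"
      using Hdiv_Cauchy_test_fields_limit[of \<phi>, OF \<phi>] by blast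
    have u_lim: "(\<lambda>n. Hdiv_norm \<Omega> (\<lambda>x. \<phi> n x - u x)) \<longlonglongrightarrow> 0"
      by (rule Hdiv_norm_tendsto_0[OF \<phi> u])
    have curl_Cauchy: "\<exists>N. \<forall>m\<ge>N. \<forall>n\<ge>N. L2_inner \<Omega> (\<lambda>x. curl_field (\<phi> m) x - curl_field (\<phi> n) x)
        (\<lambda>x. curl_field (\<phi> m) x - curl_field (\<phi> n) x) < e" if e: "e > 0" for e
    proof -
      obtain N where N: "\<forall>m\<ge>N. \<forall>n\<ge>N. energy (\<lambda>x. \<phi> m x - \<phi> n x) (\<lambda>x. \<phi> m x - \<phi> n x) < e"
        using Cauchy[OF e] by blast
      have "L2_inner \<Omega> (\<lambda>x. curl_field (\<phi> m) x - curl_field (\<phi> n) x)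
        (\<lambda>x. curl_field (\<phi> m) x - curl_field (\<phi> n) x) \<le> energy (\<lambda>x. \<phi> m x - \<phi> n x) (\<lambda>x. \<phi> m x - \<phi> n x)" for m n
        unfolding energy_def curl_field_diff[OF \<phi> \<phi>] by (simp add: L2_inner_def)
      then show ?thesis using N by (meson le_less_trans)
    qed
    obtain \<mu> where \<mu>: "\<mu> \<in> L2 \<Omega>" "(\<lambda>n. L2_norm \<Omega> (\<lambda>x. curl_field (\<phi> n) x - \<mu> x)) \<longlonglongrightarrow> 0"
      by (rule L2_complete[where f="\<lambda>n. curl_field (\<phi> n)", OF lmeasurable_domain curl_L2 curl_Cauchy])
    note div_L2_u = weak_div_H0div_L2[OF u(1)]
    \<comment> \<open>The second equation leaves no other candidate for the curl of
      \<open>\<mu>\<close>; it remains to check that \<open>G\<close> extends the distributional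
      curl.\<close>
    define G where "G v = f v - L2_inner \<Omega> (weak_div \<Omega> u) (weak_div \<Omega> v)" for v
    have "G \<in> H0div_dual \<Omega>"
      unfolding G_def by (intro H0div_dual_minus f weak_div_inner_H0div_dual div_L2_u)
    moreover have "G \<psi> = L2_inner \<Omega> \<mu> (curl_field \<psi>)" if \<psi>: "\<psi> \<in> test_fields \<Omega>" for \<psi>
    proof -
      have "(\<lambda>n. energy (\<phi> n) \<psi>) \<longlonglongrightarrow> L2_inner \<Omega> \<mu> (curl_field \<psi>) + L2_inner \<Omega> (weak_div \<Omega> u) (div_field \<psi>)"
        unfolding energy_def
        by (intro tendsto_add L2_inner_tendsto[OF curl_L2 \<mu>(1) _ \<mu>(2)] L2_inner_tendsto[OF div_L2 div_L2_u _ u(3)]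
            test_field_L2 test_function_L2 curl_field_test div_field_test \<psi>)
      then have "f \<psi> = L2_inner \<Omega> \<mu> (curl_field \<psi>) + L2_inner \<Omega> (weak_div \<Omega> u) (div_field \<psi>)"
        using lim[OF \<psi>] by (simp add: LIMSEQ_unique)
      then show ?thesis
        using weak_div_inner_cong_right[OF test_field_L2[OF \<psi>] is_weak_div_test_field[OF \<psi>] div_L2_u]
        by (simp add: G_def)
    qed
    ultimately have "is_weak_curl \<Omega> \<mu> G" by (simp add: is_weak_curl_def)
    note \<mu>_curl = weak_curl_eq[OF \<mu>(1) this]
    \<comment> \<open>For \<open>\<phi> n\<close> in place of \<open>u\<close> this is the
      definition of the weak curl of \<open>\<tau>\<close>. One side converges because the curls
      converge in \<open>L2\<close>, the other because \<open>weak_curl \<Omega> \<tau>\<close> is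
      continuous in the graph norm.\<close>
    have "L2_inner \<Omega> \<mu> \<tau> = weak_curl \<Omega> \<tau> u" if \<tau>: "\<tau> \<in> Sigma_space \<Omega>" for \<tau>
    proof (rule LIMSEQ_unique)
      show "(\<lambda>n. L2_inner \<Omega> (curl_field (\<phi> n)) \<tau>) \<longlonglongrightarrow> L2_inner \<Omega> \<mu> \<tau>"
        by (rule L2_inner_tendsto[OF curl_L2 \<mu>(1) Sigma_space_L2[OF \<tau>] \<mu>(2)])
      show "(\<lambda>n. L2_inner \<Omega> (curl_field (\<phi> n)) \<tau>) \<longlonglongrightarrow> weak_curl \<Omega> \<tau> u"
        using H0div_dual_tendsto[OF weak_curl_dual[OF \<tau>] test_field_H0div[OF \<phi>] u(1) u_lim]
        by (simp only: weak_curl_test_field[OF \<tau> \<phi>] L2_inner_sym[of \<Omega> \<tau>])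
    qed
    then have sol: "mixed_solution \<Omega> f \<mu> u"
      using \<mu>_curl u(1) by (simp add: mixed_solution_def G_def)
    \<comment> \<open>Coercivity holds along the test fields and is inherited by the limit, since
      all norms involved converge.\<close>
    have "(\<lambda>n. (L2_norm \<Omega> (\<phi> n))\<^sup>2 + (L2_norm \<Omega> (div_field (\<phi> n)))\<^sup>2)
        \<longlonglongrightarrow> (L2_norm \<Omega> u)\<^sup>2 + (L2_norm \<Omega> (weak_div \<Omega> u))\<^sup>2"
      by (intro tendsto_add tendsto_power L2_norm_tendsto[OF \<phi>_L2 H0div_L2[OF u(1)] u(2)]
          L2_norm_tendsto[OF div_L2 div_L2_u u(3)])
    moreover have "(\<lambda>n. C * ((L2_norm \<Omega> (curl_field (\<phi> n)))\<^sup>2 + (L2_norm \<Omega> (div_field (\<phi> n)))\<^sup>2))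
        \<longlonglongrightarrow> C * ((L2_norm \<Omega> \<mu>)\<^sup>2 + (L2_norm \<Omega> (weak_div \<Omega> u))\<^sup>2)"
      by (intro tendsto_mult_left tendsto_add tendsto_power L2_norm_tendsto[OF curl_L2 \<mu>]
          L2_norm_tendsto[OF div_L2 div_L2_u u(3)])
    moreover have "(L2_norm \<Omega> (\<phi> n))\<^sup>2 + (L2_norm \<Omega> (div_field (\<phi> n)))\<^sup>2
        \<le> C * ((L2_norm \<Omega> (curl_field (\<phi> n)))\<^sup>2 + (L2_norm \<Omega> (div_field (\<phi> n)))\<^sup>2)" for n
      using coercive[OF \<phi>] by (simp add: L2_norm_power2 Hdiv_inner_test_fields \<phi> energy_def)
    ultimately have "(Hdiv_norm \<Omega> u)\<^sup>2 \<le> C * ((L2_norm \<Omega> \<mu>)\<^sup>2 + (L2_norm \<Omega> (weak_div \<Omega> u))\<^sup>2)"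
      unfolding Hdiv_norm_power2 by (intro LIMSEQ_le) auto
    with sol show ?thesis by blast
  qed
  with C show ?thesis by blast
qed

section \<open>The a priori bound and uniqueness\<close>

lemma mixed_solution_Sigma: "mixed_solution \<Omega> f \<mu> u \<Longrightarrow> \<mu> \<in> Sigma_space \<Omega>"
  and mixed_solution_H0div: "mixed_solution \<Omega> f \<mu> u \<Longrightarrow> u \<in> H0div \<Omega>"
  and mixed_solution_eq1: "mixed_solution \<Omega> f \<mu> u \<Longrightarrow> \<tau> \<in> Sigma_space \<Omega> \<Longrightarrow> L2_inner \<Omega> \<mu> \<tau> = weak_curl \<Omega> \<tau> u"
  and mixed_solution_eq2: "mixed_solution \<Omega> f \<mu> u \<Longrightarrow> v \<in> H0div \<Omega> \<Longrightarrow>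
    weak_curl \<Omega> \<mu> v + L2_inner \<Omega> (weak_div \<Omega> u) (weak_div \<Omega> v) = f v"
  by (simp_all add: mixed_solution_def)

text \<open>With \<open>\<tau> = \<mu>\<close> in the first equation and \<open>v = u\<close> in the
  second, the two curl terms coincide.\<close>

lemma mixed_solution_energy:
  assumes "mixed_solution \<Omega> f \<mu> u"
  shows "(L2_norm \<Omega> \<mu>)\<^sup>2 + (L2_norm \<Omega> (weak_div \<Omega> u))\<^sup>2 = f u"
  using mixed_solution_eq1[OF assms mixed_solution_Sigma[OF assms]]
    mixed_solution_eq2[OF assms mixed_solution_H0div[OF assms]]
  by (simp add: L2_norm_power2)

text \<open>Cancels a factor that may be zero; in that case the claim is the non-negativity of
  \<open>b\<close>.\<close>

lemma le_if_mult_le: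
  fixes a b :: real
  assumes "a * a \<le> b * a" "0 \<le> a" "0 \<le> b"
  shows "a \<le> b"
  using assms by (metis mult_le_cancel_right order_le_less)

text \<open>Duality argument: \<open>\<parallel>u\<parallel>\<^sup>2\<close> is computed by testing the problem with right-hand side
  \<open>(u, \<cdot>)\<close> against \<open>u\<close>, so the coercivity of the constructed solutions passes to every solution.\<close>

lemma mixed_solution_bound:
  "\<exists>C>0. \<forall>f\<in>H0div_dual \<Omega>. \<forall>\<mu> u. mixed_solution \<Omega> f \<mu> u \<longrightarrow>
    Sigma_norm \<Omega> \<mu> + Hdiv_norm \<Omega> u \<le> C * dual_norm \<Omega> f"
proof -
  obtain C0 where C0: "C0 > 0" "\<And>f. f \<in> H0div_dual \<Omega> \<Longrightarrow> \<exists>\<mu> u. mixed_solution \<Omega> f \<mu> u \<and>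
      (Hdiv_norm \<Omega> u)\<^sup>2 \<le> C0 * ((L2_norm \<Omega> \<mu>)\<^sup>2 + (L2_norm \<Omega> (weak_div \<Omega> u))\<^sup>2)"
    using ex_mixed_solution by blast
  \<comment> \<open>The summand 1 makes \<open>c\<close> at least 1, so that \<open>E\<close> is
    itself bounded by \<open>c * E\<close>.\<close>
  define c where "c = sqrt (C0 + 1)"
  have c: "c \<ge> 1" "c\<^sup>2 = C0 + 1" using C0(1) by (auto simp: c_def)
  show ?thesis
  \<comment> \<open>With \<open>D\<close> the dual norm of \<open>f\<close>, the norm of
    \<open>\<mu>\<close> is at most \<open>2 * c * D\<close>, that of its curl at most
    \<open>D + 2 * c * D\<close>, and the graph norm of \<open>u\<close> at most
    \<open>4 * c\<^sup>2 * D\<close>.\<close>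
  proof (intro exI[of _ "4 * c + 1 + 4 * c\<^sup>2"] conjI ballI allI impI)
    show "4 * c + 1 + 4 * c\<^sup>2 > 0" using c C0(1) by simp
    fix f \<mu> u assume f: "f \<in> H0div_dual \<Omega>" and sol: "mixed_solution \<Omega> f \<mu> u"
    note \<mu> = mixed_solution_Sigma[OF sol] and u = mixed_solution_H0div[OF sol]
    define D where "D = dual_norm \<Omega> f"
    define H where "H = Hdiv_norm \<Omega> u"
    define E where "E = sqrt ((L2_norm \<Omega> \<mu>)\<^sup>2 + (L2_norm \<Omega> (weak_div \<Omega> u))\<^sup>2)"
    define U where "U = L2_norm \<Omega> u"
    have E: "0 \<le> E" "E\<^sup>2 = f u"
      unfolding mixed_solution_energy[OF sol, symmetric] by (simp_all add: E_def)
    have nn: "0 \<le> D" "0 \<le> H" "0 \<le> U"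
      by (simp_all add: D_def H_def U_def dual_norm_nonneg f Hdiv_norm_nonneg L2_norm_nonneg)
    \<comment> \<open>Coercivity is available for this constructed solution, not yet for
      \<open>u\<close>.\<close>
    obtain \<mu>' w where sol': "mixed_solution \<Omega> (L2_inner \<Omega> u) \<mu>' w"
      and w: "(Hdiv_norm \<Omega> w)\<^sup>2 \<le> C0 * ((L2_norm \<Omega> \<mu>')\<^sup>2 + (L2_norm \<Omega> (weak_div \<Omega> w))\<^sup>2)"
      using C0(2)[OF L2_inner_H0div_dual[OF H0div_L2[OF u]]] by blast
    note \<mu>' = mixed_solution_Sigma[OF sol'] and w_mem = mixed_solution_H0div[OF sol']
    define E' where "E' = sqrt ((L2_norm \<Omega> \<mu>')\<^sup>2 + (L2_norm \<Omega> (weak_div \<Omega> w))\<^sup>2)"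
    have E': "0 \<le> E'" "E'\<^sup>2 = L2_inner \<Omega> u w"
      unfolding mixed_solution_energy[OF sol', symmetric] by (simp_all add: E'_def)
    have "(L2_norm \<Omega> w)\<^sup>2 \<le> (c * E')\<^sup>2"
    proof -
      have "(L2_norm \<Omega> w)\<^sup>2 \<le> (Hdiv_norm \<Omega> w)\<^sup>2" by (simp add: Hdiv_norm_power2)
      also have "\<dots> \<le> C0 * E'\<^sup>2" using w by (simp add: E'_def)
      also have "\<dots> \<le> c\<^sup>2 * E'\<^sup>2" using c by (intro mult_right_mono) auto
      finally show ?thesis by (simp add: power_mult_distrib)
    qed
    then have w_le: "L2_norm \<Omega> w \<le> c * E'" by (rule power2_le_imp_le) (use c E' in simp)
    have "E'\<^sup>2 \<le> U * L2_norm \<Omega> w"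
      using L2_Cauchy_Schwarz[OF H0div_L2[OF u] H0div_L2[OF w_mem]] E' by (simp add: U_def)
    also have "\<dots> \<le> U * (c * E')" by (rule mult_left_mono[OF w_le nn(3)])
    finally have "E' * E' \<le> (c * U) * E'" by (simp only: power2_eq_square mult_ac)
    then have E'_le: "E' \<le> c * U"
      by (rule le_if_mult_le) (use E' nn c in simp_all)
    \<comment> \<open>The second auxiliary equation tested with \<open>u\<close> contains the curl
      of \<open>\<mu>'\<close> applied to \<open>u\<close>, which the first original equation tested
      with \<open>\<mu>'\<close> turns into an inner product.\<close>
    have "U\<^sup>2 = L2_inner \<Omega> u u" by (simp add: U_def L2_norm_power2)
    also have "\<dots> = L2_inner \<Omega> \<mu> \<mu>' + L2_inner \<Omega> (weak_div \<Omega> w) (weak_div \<Omega> u)"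
      using mixed_solution_eq2[OF sol' u] mixed_solution_eq1[OF sol \<mu>'] by simp
    also have "\<dots> \<le> L2_norm \<Omega> \<mu> * L2_norm \<Omega> \<mu>' + L2_norm \<Omega> (weak_div \<Omega> u) * L2_norm \<Omega> (weak_div \<Omega> w)"
      using L2_Cauchy_Schwarz[OF Sigma_space_L2[OF \<mu>] Sigma_space_L2[OF \<mu>']]
        L2_Cauchy_Schwarz[OF weak_div_H0div_L2[OF w_mem] weak_div_H0div_L2[OF u]] by (simp add: mult.commute)
    also have "\<dots> \<le> E * E'"
    proof -
      \<comment> \<open>Cauchy-Schwarz in the plane joins the two products into
        \<open>E * E'\<close>.\<close>
      have "\<bar>inner (L2_norm \<Omega> \<mu>, L2_norm \<Omega> (weak_div \<Omega> u)) (L2_norm \<Omega> \<mu>', L2_norm \<Omega> (weak_div \<Omega> w))\<bar>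
          \<le> norm (L2_norm \<Omega> \<mu>, L2_norm \<Omega> (weak_div \<Omega> u)) * norm (L2_norm \<Omega> \<mu>', L2_norm \<Omega> (weak_div \<Omega> w))"
        by (rule Cauchy_Schwarz_ineq2)
      then show ?thesis by (simp add: E_def E'_def norm_prod_def)
    qed
    also have "\<dots> \<le> E * (c * U)" by (rule mult_left_mono[OF E'_le E(1)])
    finally have "U * U \<le> (c * E) * U" by (simp only: power2_eq_square mult_ac)
    then have U_le: "U \<le> c * E"
      by (rule le_if_mult_le) (use E nn c in simp_all)
    have H_le: "H \<le> 2 * c * E"
    proof -
      have "H \<le> U + L2_norm \<Omega> (weak_div \<Omega> u)"
        using sqrt_sum_squares_le_sum[OF L2_norm_nonneg[of \<Omega> u] L2_norm_nonneg[of \<Omega> "weak_div \<Omega> u"]]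
        by (simp add: H_def U_def Hdiv_norm_def)
      also have "L2_norm \<Omega> (weak_div \<Omega> u) \<le> E"
        unfolding E_def by (rule real_le_rsqrt) simp
      also have "E \<le> c * E" using c E by (simp add: mult_le_cancel_right1)
      finally show ?thesis using U_le by simp
    qed
    show "Sigma_norm \<Omega> \<mu> + Hdiv_norm \<Omega> u \<le> (4 * c + 1 + 4 * c\<^sup>2) * dual_norm \<Omega> f"
    proof -
      \<comment> \<open>The energy is quadratic in \<open>E\<close> while \<open>f u\<close> is
        bounded linearly through \<open>H_le\<close>, so one factor \<open>E\<close>
        cancels.\<close>
      have "E\<^sup>2 \<le> D * H"
        using dual_norm_bound[OF f u] E by (simp add: D_def H_def)
      also have "\<dots> \<le> D * (2 * c * E)" by (rule mult_left_mono[OF H_le nn(1)])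
      finally have "E * E \<le> (2 * c * D) * E" by (simp only: power2_eq_square mult_ac)
      then have E_le: "E \<le> 2 * c * D"
        by (rule le_if_mult_le) (use E nn c in simp_all)
      have "2 * c * E \<le> 2 * c * (2 * c * D)" using c by (intro mult_left_mono E_le) auto
      from order_trans[OF H_le this] have "H \<le> 4 * c\<^sup>2 * D" by (simp add: power2_eq_square mult_ac)
      moreover have \<mu>_E: "L2_norm \<Omega> \<mu> \<le> E" "L2_norm \<Omega> (weak_div \<Omega> u) \<le> E"
        unfolding E_def by (auto intro: real_le_rsqrt)
      \<comment> \<open>The second equation expresses the curl of \<open>\<mu>\<close> by
        \<open>f\<close> and the divergence term.\<close>
      have "dual_norm \<Omega> (weak_curl \<Omega> \<mu>) \<le> D + E"
      proof (rule dual_norm_le)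
        fix v assume v: "v \<in> H0div \<Omega>"
        have "\<bar>weak_curl \<Omega> \<mu> v\<bar> \<le> \<bar>f v\<bar> + \<bar>L2_inner \<Omega> (weak_div \<Omega> u) (weak_div \<Omega> v)\<bar>"
          using mixed_solution_eq2[OF sol v] by linarith
        also have "\<bar>f v\<bar> \<le> D * Hdiv_norm \<Omega> v" unfolding D_def by (rule dual_norm_bound[OF f v])
        also have "\<bar>L2_inner \<Omega> (weak_div \<Omega> u) (weak_div \<Omega> v)\<bar> \<le> L2_norm \<Omega> (weak_div \<Omega> u) * L2_norm \<Omega> (weak_div \<Omega> v)"
          by (rule L2_Cauchy_Schwarz[OF weak_div_H0div_L2[OF u] weak_div_H0div_L2[OF v]])
        also have "\<dots> \<le> E * Hdiv_norm \<Omega> v"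
          by (intro mult_mono \<mu>_E L2_norm_weak_div_le_Hdiv_norm L2_norm_nonneg E)
        finally show "\<bar>weak_curl \<Omega> \<mu> v\<bar> \<le> (D + E) * Hdiv_norm \<Omega> v" by (simp add: distrib_right)
      qed (use nn E in simp)
      then have "Sigma_norm \<Omega> \<mu> \<le> L2_norm \<Omega> \<mu> + (D + E)"
        using sqrt_sum_squares_le_sum[OF L2_norm_nonneg[of \<Omega> \<mu>] dual_norm_nonneg[OF weak_curl_dual[OF \<mu>]]]
        by (simp add: Sigma_norm_def)
      then have "Sigma_norm \<Omega> \<mu> \<le> 4 * c * D + D" using \<mu>_E(1) E_le by simp
      ultimately show ?thesis by (simp add: D_def[symmetric] H_def[symmetric] distrib_right)
    qed
  qed
qed

text \<open>Uniqueness is the bound applied to the difference of two solutions.\<close>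

lemma mixed_solution_unique:
  assumes sol: "mixed_solution \<Omega> f \<mu> u" and sol': "mixed_solution \<Omega> f \<mu>' u'"
  shows "AE x in lebesgue_on \<Omega>. \<mu>' x = \<mu> x" and "AE x in lebesgue_on \<Omega>. u' x = u x"
proof -
  note \<mu> = mixed_solution_Sigma[OF sol] and u = mixed_solution_H0div[OF sol]
    and \<mu>' = mixed_solution_Sigma[OF sol'] and u' = mixed_solution_H0div[OF sol']
  let ?\<nu> = "\<lambda>x. \<mu>' x - \<mu> x" and ?w = "\<lambda>x. u' x - u x"
  have \<nu>_L2: "?\<nu> \<in> L2 \<Omega>" by (rule L2.diff_mem[OF Sigma_space_L2[OF \<mu>'] Sigma_space_L2[OF \<mu>]])
  have w: "?w \<in> H0div \<Omega>" by (rule H0div.diff_mem[OF u' u])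
  \<comment> \<open>The difference of the two chosen curls is a bounded extension of the curl of the
    difference, so it agrees with the chosen curl of \<open>?\<nu>\<close> on
    \<open>H0div \<Omega>\<close>.\<close>
  have "is_weak_curl \<Omega> ?\<nu> (\<lambda>v. weak_curl \<Omega> \<mu>' v - weak_curl \<Omega> \<mu> v)"
    using H0div_dual_minus[OF weak_curl_dual[OF \<mu>'] weak_curl_dual[OF \<mu>]]
      L2.form_diff[OF Sigma_space_L2[OF \<mu>'] Sigma_space_L2[OF \<mu>] test_field_L2[OF curl_field_test]]
    by (simp add: is_weak_curl_def weak_curl_test_field \<mu> \<mu>')
  note \<nu> = weak_curl_eq[OF \<nu>_L2 this]
  have zero: "(\<lambda>v. 0) \<in> H0div_dual \<Omega>" by (auto simp: H0div_dual_def intro: exI[of _ 0])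
  have sol0: "mixed_solution \<Omega> (\<lambda>v. 0) ?\<nu> ?w"
    unfolding mixed_solution_def
  proof (intro conjI ballI \<nu>(1) w)
    fix \<tau> assume \<tau>: "\<tau> \<in> Sigma_space \<Omega>"
    show "L2_inner \<Omega> ?\<nu> \<tau> - weak_curl \<Omega> \<tau> ?w = 0"
      using mixed_solution_eq1[OF sol \<tau>] mixed_solution_eq1[OF sol' \<tau>]
        L2.form_diff[OF Sigma_space_L2[OF \<mu>'] Sigma_space_L2[OF \<mu>] Sigma_space_L2[OF \<tau>]]
        H0div_dual_diff[OF weak_curl_dual[OF \<tau>] u' u] by simp
  next
    fix v assume v: "v \<in> H0div \<Omega>"
    note v_div = weak_div_H0div_L2[OF v]
    have "L2_inner \<Omega> (weak_div \<Omega> ?w) (weak_div \<Omega> v)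
        = L2_inner \<Omega> (weak_div \<Omega> u') (weak_div \<Omega> v) - L2_inner \<Omega> (weak_div \<Omega> u) (weak_div \<Omega> v)"
      using H0div_dual_diff[OF weak_div_inner_H0div_dual[OF v_div] u' u] by (simp add: L2_inner_sym[of \<Omega> "weak_div \<Omega> v"])
    then show "weak_curl \<Omega> ?\<nu> v + L2_inner \<Omega> (weak_div \<Omega> ?w) (weak_div \<Omega> v) = 0"
      using mixed_solution_eq2[OF sol v] mixed_solution_eq2[OF sol' v] \<nu>(2)[OF v] by simp
  qed
  have "dual_norm \<Omega> (\<lambda>v. 0) = 0"
    using dual_norm_nonneg[OF zero] dual_norm_le[of "\<lambda>v. 0" 0] by simp
  moreover obtain C where C: "\<forall>f\<in>H0div_dual \<Omega>. \<forall>\<mu> u. mixed_solution \<Omega> f \<mu> u \<longrightarrow>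
      Sigma_norm \<Omega> \<mu> + Hdiv_norm \<Omega> u \<le> C * dual_norm \<Omega> f"
    using mixed_solution_bound by blast
  ultimately have le: "Sigma_norm \<Omega> ?\<nu> + Hdiv_norm \<Omega> ?w \<le> 0"
    using C[rule_format, OF zero sol0] by simp
  have "L2_norm \<Omega> ?\<nu> \<le> Sigma_norm \<Omega> ?\<nu>"
    unfolding Sigma_norm_def by (rule real_le_rsqrt) simp
  then have norm0: "L2_norm \<Omega> ?\<nu> = 0" "L2_norm \<Omega> ?w = 0"
    using le L2_norm_nonneg[of \<Omega> ?\<nu>] L2_norm_nonneg[of \<Omega> ?w] L2_norm_le_Hdiv_norm[of \<Omega> ?w] by linarith+
  show "AE x in lebesgue_on \<Omega>. \<mu>' x = \<mu> x" "AE x in lebesgue_on \<Omega>. u' x = u x"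
    using AE_zero_if_L2_norm_zero[OF \<nu>_L2 norm0(1)] AE_zero_if_L2_norm_zero[OF H0div_L2[OF w] norm0(2)]
    by simp_all
qed

end

theorem theorem2p5:
  fixes \<Omega> :: "(real^3) set"
  assumes "lipschitz_polyhedral_domain \<Omega>"
  shows "(\<forall>f \<in> H0div_dual \<Omega>.
            \<exists>\<mu> u. mixed_solution \<Omega> f \<mu> u \<and>
              (\<forall>\<mu>' u'. mixed_solution \<Omega> f \<mu>' u' \<longrightarrow>
                 (AE x in lebesgue_on \<Omega>. \<mu>' x = \<mu> x) \<and> (AE x in lebesgue_on \<Omega>. u' x = u x)))
       \<and> (\<exists>C>0. \<forall>f \<in> H0div_dual \<Omega>. \<forall>\<mu> u. mixed_solution \<Omega> f \<mu> u \<longrightarrow>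
            Sigma_norm \<Omega> \<mu> + Hdiv_norm \<Omega> u \<le> C * dual_norm \<Omega> f)"
proof -
  interpret bounded_open_domain \<Omega>
    using assms by unfold_locales (auto simp: lipschitz_polyhedral_domain_def)
  show ?thesis
  proof (intro conjI ballI)
    fix f assume f: "f \<in> H0div_dual \<Omega>"
    obtain \<mu> u where sol: "mixed_solution \<Omega> f \<mu> u"
      using ex_mixed_solution f by blast
    show "\<exists>\<mu> u. mixed_solution \<Omega> f \<mu> u \<and>
        (\<forall>\<mu>' u'. mixed_solution \<Omega> f \<mu>' u' \<longrightarrow>
           (AE x in lebesgue_on \<Omega>. \<mu>' x = \<mu> x) \<and> (AE x in lebesgue_on \<Omega>. u' x = u x))"
      by (intro exI[of _ \<mu>] exI[of _ u] conjI allI impI sol mixed_solution_unique[OF sol])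
  qed (rule mixed_solution_bound)
qed

end
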